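(* For any $\epsilon>0$ there are $4RT+O(\log R)+O(T)$ eigenvalues of $W_R$ larger than $1-\epsilon$ as $R,T\to\infty$.
   Context: The Fourier transform is $\hat f(t)=\int_{\mathbb{R}} f(x)e^{-2\pi i t x}\,dx$. For $T>0$, the weighted Paley--Wiener space $PW_T(1+x^2)$ is the Hilbert space of functions $f$ on $\mathbb{R}$ whose Fourier transform is supported in $[-T,T]$ and with norm $$\|f\|^2=\int_{\mathbb{R}}|f(x)|^2(1+x^2)\,dx<\infty.$$ It is a reproducing kernel Hilbert space; $L_t$ denotes its reproducing kernel at $t\in\mathbb{R}$, i.e. $f(t)=\int_{\mathbb{R}} f(x)\overline{L_t(x)}(1+x^2)\,dx$ for all $f\in PW_T(1+x^2)$. For $R>0$, the operator $W_R:PW_T(1+x^2)\to PW_T(1+x^2)$ (which depends also on $T$) is defined by $$W_Rf(t)=\int_{-R}^R f(x)\overline{L_t(x)}(1+x^2)\,dx.$$ Eigenvalues are counted with multiplicity. For each fixed $\epsilon$, the $O$ terms may depend on $\epsilon$.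
   Formalization: The claim is stated for 0 < ε < 1 instead of any ε > 0: for ε ≥ 1 it is false, since W_R is compact, positive and injective on an infinite-dimensional space and so has infinitely many eigenvalues larger than 1-ε. *)

theory Defs
  imports "HOL-Analysis.Analysis" "HOL-Library.Landau_Symbols" "HOL-Library.Function_Algebras"
begin

definition fourier :: "(real \<Rightarrow> complex) \<Rightarrow> real \<Rightarrow> complex" where
  "fourier f t = (LINT x|lborel. f x * exp (- 2 * pi * \<i> * t * x))"

text \<open>
  A function with finite weighted norm is integrable, so its Fourier transform is given by
  the integral and is continuous. If that transform has compact support, the function agrees
  almost everywhere with exactly one continuous function. This is the representative for which
  the point values in the reproducing property are meaningful, and continuity in the next
  definition selects it.
\<close>

definition PW :: "real \<Rightarrow> (real \<Rightarrow> complex) set" where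
  "PW T = {f. continuous_on UNIV f \<and>
              integrable lborel (\<lambda>x. (cmod (f x))\<^sup>2 * (1 + x\<^sup>2)) \<and>
              {t. fourier f t \<noteq> 0} \<subseteq> {-T..T}}"

definition reproducing_kernel_at :: "real \<Rightarrow> real \<Rightarrow> (real \<Rightarrow> complex) \<Rightarrow> bool" where
  "reproducing_kernel_at T t L \<longleftrightarrow>
     L \<in> PW T \<and> (\<forall>f\<in>PW T. f t = (LINT x|lborel. f x * cnj (L x) * (1 + x\<^sup>2)))"

definition repr_kernel :: "real \<Rightarrow> real \<Rightarrow> real \<Rightarrow> complex" where
  "repr_kernel T t = (THE L. reproducing_kernel_at T t L)"

definition W :: "real \<Rightarrow> real \<Rightarrow> (real \<Rightarrow> complex) \<Rightarrow> real \<Rightarrow> complex" where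
  "W R T f t = (LINT x:{-R..R}|lborel. f x * cnj (repr_kernel T t x) * (1 + x\<^sup>2))"

definition eigenspace :: "real \<Rightarrow> real \<Rightarrow> complex \<Rightarrow> (real \<Rightarrow> complex) set" where
  "eigenspace R T c = {f \<in> PW T. \<forall>t. W R T f t = c * f t}"

interpretation cfun: vector_space "\<lambda>(c::complex) (f::real \<Rightarrow> complex) x. c * f x"
  by standard (auto simp: fun_eq_iff algebra_simps)

text \<open>
  The operator is self-adjoint. Hence its eigenvalues are real, and the multiplicity of an
  eigenvalue is the complex dimension of its eigenspace.
\<close>

definition eigenvalues_above :: "real \<Rightarrow> real \<Rightarrow> real \<Rightarrow> real set" where
  "eigenvalues_above R T a = {c. a < c \<and> (\<exists>f\<in>eigenspace R T (of_real c). f \<noteq> 0)}"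

text \<open>
  Both \<open>sum\<close> and \<open>dim\<close> silently return 0 in the infinite case, so having
  exactly \<open>n\<close> eigenvalues includes finiteness of the set of eigenvalues and of the
  dimension of every eigenspace involved.
\<close>

definition has_num_eigenvalues_above :: "real \<Rightarrow> real \<Rightarrow> real \<Rightarrow> nat \<Rightarrow> bool" where
  "has_num_eigenvalues_above R T a n \<longleftrightarrow>
     finite (eigenvalues_above R T a) \<and>
     (\<forall>c\<in>eigenvalues_above R T a. \<exists>B. finite B \<and> eigenspace R T (of_real c) \<subseteq> cfun.span B) \<and>
     n = (\<Sum>c\<in>eigenvalues_above R T a. cfun.dim (eigenspace R T (of_real c)))"

end

theory Submission
  imports Defs "HOL-Probability.Probability" "HOL-Complex_Analysis.Great_Picard"
begin

text \<open>
  The reproducing kernel has a closed form: its Fourier transform solves a two-point boundary value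
  problem on \<open>[-T, T]\<close>, and times the weight it equals the kernel
  \<open>sin (2 \<pi> T (x - t)) / (\<pi> (x - t))\<close> of the unweighted space plus a
  correction of order \<open>1 / (1 + |t|)\<close>, which improves to \<open>1 / (1 + t\<^sup>2)\<close> on the diagonal
  \<open>x = t\<close>. Hence the trace \<open>\<tau>\<close> of \<open>W\<close>, the integral
  of the kernel over the diagonal of \<open>[-R, R]\<^sup>2\<close>, is \<open>4RT + O(1)\<close>, and the energy
  \<open>\<delta>\<close> that the kernels centred in \<open>[-R, R]\<close> lose outside this interval, which is the trace of
  \<open>W - W\<^sup>2\<close>, is \<open>O(T + log R)\<close>.

  Let \<open>B\<close> be a maximal orthonormal set of eigenvectors for eigenvalues \<open>\<lambda> > a = 1 - \<epsilon>\<close>.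
  Projecting the kernel at \<open>y\<close> onto the complement of \<open>B\<close>, where \<open>W \<le> a\<close> by
  compactness, and integrating over \<open>y \<in> [-R, R]\<close> gives
  \<open>\<Sum>\<lambda> \<le> \<tau>\<close>, \<open>\<Sum>\<lambda>(1 - \<lambda>) \<le> \<delta>\<close> and
  \<open>(1 - a)\<tau> - \<delta> \<le> \<Sum>\<lambda>(\<lambda> - a)\<close>, and so
  \<open>\<tau> - \<delta> / (1 - a) \<le> |B| \<le> \<tau> + \<delta> / a\<close>.
\<close>

section \<open>Compact positive contractions with finitely many large eigenvalues\<close>

text \<open>On the Fourier side the weight 1 + x^2 acts as 1 - (1 / (4 pi^2)) d^2/ds^2. The
  transform of a function of finite weighted norm is continuous, so the support condition makes it
  vanish at both ends of [-T, T]. Hence the transform u of the kernel at t solves u - u'' / (4 pi^2)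
  = exp (-2 pi i t s) with u(-T) = u(T) = 0: exp (-2 pi i t s) / (1 + t^2) is a particular solution,
  and multiples of cosh (2 pi s) and sinh (2 pi s) correct its boundary values. The number of
  eigenvalues includes its own finiteness, so the count cannot start from a complete list of
  eigenvalues. Only finite orthonormal families of eigenvectors occur. Trace identities become
  inequalities between quadratic forms at a kernel, pointwise in its centre y, which are integrated
  afterwards. The upper bound for the size of a family is what makes a maximal family exist;
  compactness enters only for the lower bound. Neither completeness of the space nor a spectral
  decomposition is invoked.\<close>

locale psd_form = vector_space scale
  for scale :: "complex \<Rightarrow> 'v::ab_group_add \<Rightarrow> 'v" (infixr "\<odot>" 75) +
  fixes H :: "'v set" and ip :: "'v \<Rightarrow> 'v \<Rightarrow> complex"
  assumes subspace_H: "subspace H"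
    and ip_add_left: "\<lbrakk>f \<in> H; g \<in> H; h \<in> H\<rbrakk> \<Longrightarrow> ip (f + g) h = ip f h + ip g h"
    and ip_scale_left: "\<lbrakk>f \<in> H; g \<in> H\<rbrakk> \<Longrightarrow> ip (c \<odot> f) g = c * ip f g"
    and ip_commute: "\<lbrakk>f \<in> H; g \<in> H\<rbrakk> \<Longrightarrow> ip g f = cnj (ip f g)"
    and ip_ge0: "f \<in> H \<Longrightarrow> 0 \<le> Re (ip f f)"
begin

definition sqn :: "'v \<Rightarrow> real" where "sqn f = Re (ip f f)"

lemma H_add: "\<lbrakk>f \<in> H; g \<in> H\<rbrakk> \<Longrightarrow> f + g \<in> H"
  and H_scale: "f \<in> H \<Longrightarrow> c \<odot> f \<in> H"
  and H_diff: "\<lbrakk>f \<in> H; g \<in> H\<rbrakk> \<Longrightarrow> f - g \<in> H"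
  and H_0: "0 \<in> H"
  and H_sum: "(\<And>i. i \<in> I \<Longrightarrow> F i \<in> H) \<Longrightarrow> sum F I \<in> H"
  using subspace_H
  by (auto intro: subspace_add subspace_scale subspace_diff subspace_0 subspace_sum)

lemma ip_self: "f \<in> H \<Longrightarrow> ip f f = complex_of_real (sqn f)"
  using ip_commute[of f f] by (auto simp: sqn_def complex_eq_iff)

lemma ip_add_right: "\<lbrakk>f \<in> H; g \<in> H; h \<in> H\<rbrakk> \<Longrightarrow> ip h (f + g) = ip h f + ip h g"
  using ip_commute[of "f + g" h] ip_commute[of f h] ip_commute[of g h] ip_add_left[of f g h] H_add
  by simp

lemma ip_scale_right: "\<lbrakk>f \<in> H; g \<in> H\<rbrakk> \<Longrightarrow> ip g (c \<odot> f) = cnj c * ip g f"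
  using ip_commute[of "c \<odot> f" g] ip_commute[of f g] ip_scale_left[of f g c] H_scale by simp

lemma ip_diff_left: "\<lbrakk>f \<in> H; g \<in> H; h \<in> H\<rbrakk> \<Longrightarrow> ip (f - g) h = ip f h - ip g h"
  using ip_add_left[of "f - g" g h] H_diff by simp

lemma ip_diff_right: "\<lbrakk>f \<in> H; g \<in> H; h \<in> H\<rbrakk> \<Longrightarrow> ip h (f - g) = ip h f - ip h g"
  using ip_add_right[of "f - g" g h] H_diff by simp

lemma ip_0_left: "f \<in> H \<Longrightarrow> ip 0 f = 0"
  using ip_scale_left[of 0 f 0] H_0 by simp

lemma ip_sum_left:
  assumes "\<And>i. i \<in> I \<Longrightarrow> F i \<in> H" "h \<in> H"
  shows "ip (sum F I) h = (\<Sum>i\<in>I. ip (F i) h)"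
  using assms
proof (induction I rule: infinite_finite_induct)
  case (insert x I)
  then show ?case by (simp add: ip_add_left H_sum)
qed (auto simp: ip_0_left)

lemma ip_sum_right:
  assumes "\<And>i. i \<in> I \<Longrightarrow> F i \<in> H" "h \<in> H"
  shows "ip h (sum F I) = (\<Sum>i\<in>I. ip h (F i))"
proof -
  have "ip h (sum F I) = cnj (ip (sum F I) h)"
    using ip_commute H_sum assms by blast
  also have "\<dots> = (\<Sum>i\<in>I. cnj (ip (F i) h))"
    by (simp add: ip_sum_left assms)
  also have "\<dots> = (\<Sum>i\<in>I. ip h (F i))"
    using assms by (intro sum.cong refl ip_commute[symmetric]) auto
  finally show ?thesis .
qed

lemma sqn_ge0: "f \<in> H \<Longrightarrow> 0 \<le> sqn f"
  using ip_ge0 by (simp add: sqn_def)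

lemma sqn_scale: "f \<in> H \<Longrightarrow> sqn (c \<odot> f) = (cmod c)\<^sup>2 * sqn f"
  using ip_self[of f] unfolding cmod_power2
  by (simp add: sqn_def ip_scale_left ip_scale_right H_scale power2_eq_square algebra_simps)

lemma sqn_diff:
  assumes "f \<in> H" "g \<in> H"
  shows "sqn (f - g) = sqn f - 2 * Re (ip f g) + sqn g"
  using assms ip_commute[of f g]
  by (simp add: sqn_def ip_diff_left ip_diff_right H_diff)

lemma Cauchy_Schwarz:
  assumes f: "f \<in> H" and g: "g \<in> H"
  shows "(cmod (ip f g))\<^sup>2 \<le> sqn f * sqn g"
proof -
  define u where "u = ip f g"
  have *: "0 \<le> sqn f - 2 * s * (cmod u)\<^sup>2 + s\<^sup>2 * (cmod u)\<^sup>2 * sqn g" for s :: real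
  proof -
    have "0 \<le> sqn (f - (of_real s * u) \<odot> g)"
      using f g by (intro sqn_ge0 H_diff H_scale)
    also have "\<dots> = sqn f - 2 * Re (ip f ((of_real s * u) \<odot> g)) + (cmod (of_real s * u))\<^sup>2 * sqn g"
      using f g by (simp add: sqn_diff H_scale sqn_scale)
    also have "ip f ((of_real s * u) \<odot> g) = of_real s * (cnj u * u)"
      using f g by (simp add: ip_scale_right u_def)
    also have "\<dots> = of_real (s * (cmod u)\<^sup>2)"
      using complex_norm_square[of u] by (simp add: mult.commute)
    finally show ?thesis
      by (simp add: norm_mult power_mult_distrib algebra_simps)
  qed
  show ?thesis
  proof (cases "sqn g = 0")
    case True
    have "(cmod u)\<^sup>2 = 0"
    proof (rule ccontr)
      assume "(cmod u)\<^sup>2 \<noteq> 0"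
      \<comment> \<open>This choice of \<open>s\<close> makes the right-hand side of
        \<open>*\<close> equal to -1.\<close>
      then show False
        using *[of "(sqn f + 1) / (2 * (cmod u)\<^sup>2)"] True by (simp add: field_simps)
    qed
    then show ?thesis using True by (simp add: u_def)
  next
    case False
    then have "0 < sqn g" using sqn_ge0[OF g] by simp
    then show ?thesis
      using *[of "1 / sqn g"] by (simp add: u_def field_simps power2_eq_square)
  qed
qed

text \<open>The parallelogram law. It replaces the triangle inequality in the limit arguments, so
  that no square roots of \<open>sqn\<close> appear.\<close>

lemma sqn_add_le:
  assumes f: "f \<in> H" and g: "g \<in> H"
  shows "sqn (f + g) \<le> 2 * sqn f + 2 * sqn g"
proof -
  have "sqn (f + g) + sqn (f - g) = 2 * sqn f + 2 * sqn g"
    using f g by (simp add: sqn_def ip_diff_left ip_diff_right ip_add_left ip_add_right H_diff H_add)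
  then show ?thesis using sqn_ge0[OF H_diff[OF f g]] by linarith
qed

end

text \<open>\<open>A_compact\<close> asks for a limit that already lies in \<open>H\<close>, so
  completeness of \<open>H\<close> need not be assumed. Contraction is required of the quadratic
  form only; the norm bound follows in \<open>sqn_A_le_sqn\<close>.\<close>

locale compact_contraction = psd_form +
  fixes A :: "'a \<Rightarrow> 'a"
  assumes definite: "\<lbrakk>f \<in> H; sqn f = 0\<rbrakk> \<Longrightarrow> f = 0"
    and A_in: "f \<in> H \<Longrightarrow> A f \<in> H"
    and A_add: "\<lbrakk>f \<in> H; g \<in> H\<rbrakk> \<Longrightarrow> A (f + g) = A f + A g"
    and A_scale: "f \<in> H \<Longrightarrow> A (c \<odot> f) = c \<odot> A f"
    and A_sym: "\<lbrakk>f \<in> H; g \<in> H\<rbrakk> \<Longrightarrow> ip (A f) g = ip f (A g)"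
    and A_pos: "f \<in> H \<Longrightarrow> 0 \<le> Re (ip (A f) f)"
    and A_le: "f \<in> H \<Longrightarrow> Re (ip (A f) f) \<le> sqn f"
    and A_compact: "\<lbrakk>\<And>n::nat. F n \<in> H; \<And>n. sqn (F n) \<le> 1\<rbrakk> \<Longrightarrow>
          \<exists>r g. strict_mono r \<and> g \<in> H \<and> (\<lambda>n. sqn (A (F (r n)) - g)) \<longlonglongrightarrow> 0"
begin

section \<open>Invariant complements of eigenvector families and the maximum of the quadratic
  form\<close>

lemma A_diff: "\<lbrakk>f \<in> H; g \<in> H\<rbrakk> \<Longrightarrow> A (f - g) = A f - A g"
  using A_add[of "f - g" g] H_diff by simp

definition eig :: "complex \<Rightarrow> 'a set" where
  "eig c = {f \<in> H. A f = c \<odot> f}"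

text \<open>Each vector carries its own eigenvalue above \<open>a\<close>, so one family may draw on
  several eigenspaces, and its cardinality counts eigenvalues with multiplicity.\<close>

definition eigset :: "real \<Rightarrow> 'a set \<Rightarrow> bool" where
  "eigset a B \<longleftrightarrow> finite B \<and> B \<subseteq> H \<and>
     (\<forall>b\<in>B. ip b b = 1 \<and> (\<exists>c>a. b \<in> eig (complex_of_real c))) \<and>
     (\<forall>b\<in>B. \<forall>b'\<in>B. b \<noteq> b' \<longrightarrow> ip b b' = 0)"

definition perp :: "'a set \<Rightarrow> 'a set" where
  "perp B = {f \<in> H. \<forall>b\<in>B. ip f b = 0}"

lemma perp_subspace: assumes "B \<subseteq> H" shows "subspace (perp B)"
  using assms subspace_H unfolding subspace_def perp_def
  by (auto simp: ip_0_left ip_add_left ip_scale_left subset_iff)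

lemma A_perp:
  assumes B: "eigset a B" and f: "f \<in> perp B"
  shows "A f \<in> perp B"
proof -
  have "ip (A f) b = 0" if "b \<in> B" for b
  proof -
    obtain c where c: "b \<in> eig (complex_of_real c)" using B \<open>b \<in> B\<close> by (auto simp: eigset_def)
    have "ip (A f) b = ip f (A b)"
      using f c by (intro A_sym) (auto simp: perp_def eig_def)
    also have "\<dots> = 0"
      using f c that by (auto simp: perp_def eig_def ip_scale_right)
    finally show ?thesis .
  qed
  then show ?thesis using f A_in by (auto simp: perp_def)
qed

text \<open>Cauchy-Schwarz is needed for the form \<open>ip (A f) g\<close> too. That form is merely
  semidefinite when \<open>A\<close> has a kernel, which is why \<open>psd_form\<close> does not ask
  for definiteness.\<close>

lemma quad_form: "psd_form (\<odot>) H (\<lambda>f g. ip (A f) g)"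
proof unfold_locales
  fix f g assume "f \<in> H" "g \<in> H"
  then show "ip (A g) f = cnj (ip (A f) g)"
    using A_sym[of g f] ip_commute[of "A f" g] A_in by simp
qed (auto simp: A_add A_scale A_in ip_add_left ip_scale_left H_add H_scale A_pos subspace_H)

text \<open>The inequality A^2 <= l A on an invariant subspace where A <= l: apply Cauchy-Schwarz
  for the form of \<open>A\<close> to \<open>f\<close> and \<open>A f\<close>, bound the form at
  \<open>A f\<close> by \<open>l\<close>, and cancel the factor \<open>sqn (A f)\<close>.\<close>

lemma sqn_A_le:
  assumes V: "subspace V" "V \<subseteq> H" "\<And>f. f \<in> V \<Longrightarrow> A f \<in> V" and f: "f \<in> V"
    and l: "\<And>f. f \<in> V \<Longrightarrow> Re (ip (A f) f) \<le> l * sqn f"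
  shows "sqn (A f) \<le> l * Re (ip (A f) f)"
proof -
  interpret q: psd_form "(\<odot>)" H "\<lambda>f g. ip (A f) g" by (rule quad_form)
  have fH: "f \<in> H" "A f \<in> H" "A f \<in> V" using V f by auto
  have "(cmod (ip (A f) (A f)))\<^sup>2 \<le> Re (ip (A f) f) * Re (ip (A (A f)) (A f))"
    using q.Cauchy_Schwarz[of f "A f"] fH by (simp add: q.sqn_def)
  also have "ip (A f) (A f) = of_real (sqn (A f))"
    using fH ip_self by auto
  also have "(cmod (complex_of_real (sqn (A f))))\<^sup>2 = sqn (A f) * sqn (A f)"
    by (simp add: power2_eq_square)
  also have "Re (ip (A f) f) * Re (ip (A (A f)) (A f)) \<le> Re (ip (A f) f) * (l * sqn (A f))"
    using l[OF fH(3)] A_pos[OF fH(1)] by (intro mult_left_mono)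
  finally have *: "sqn (A f) * sqn (A f) \<le> (l * Re (ip (A f) f)) * sqn (A f)" by (simp add: mult_ac)
  show ?thesis
  proof (cases "sqn (A f) = 0")
    case True
    then have "A f = 0" using definite fH by blast
    then have "Re (ip (A f) f) = 0" using fH by (simp add: ip_0_left)
    then show ?thesis using True by simp
  next
    case False
    then have "0 < sqn (A f)" using sqn_ge0[OF fH(2)] by simp
    then show ?thesis using * by simp
  qed
qed

lemma sqn_A_le_sqn: assumes "f \<in> H" shows "sqn (A f) \<le> sqn f"
  using sqn_A_le[of H f 1] A_le[of f] assms subspace_H A_in A_le by fastforce

text \<open>The supremum of the quadratic form on an invariant subspace is attained, by compactness of a
  maximising sequence, and is attained at an eigenvector.\<close>

lemma top_eigenvector:
  assumes B: "eigset a B" and a: "0 \<le> a"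
    and f0: "f0 \<in> perp B" "a * sqn f0 < Re (ip (A f0) f0)"
  shows "\<exists>g l. g \<in> perp B \<and> g \<noteq> 0 \<and> a < l \<and> A g = complex_of_real l \<odot> g"
proof -
  define U where "U = perp B"
  have BH: "B \<subseteq> H" using B by (auto simp: eigset_def)
  have U: "subspace U" "U \<subseteq> H" "\<And>f. f \<in> U \<Longrightarrow> A f \<in> U"
    using perp_subspace[OF BH] A_perp[OF B] by (auto simp: U_def perp_def)
  define Q where "Q f = Re (ip (A f) f)" for f
  define X where "X = Q ` {f \<in> U. sqn f = 1}"
  define l where "l = Sup X"
  have Q_scale: "Q (c \<odot> f) = (cmod c)\<^sup>2 * Q f" if "f \<in> H" for c f
    using psd_form.sqn_scale[OF quad_form that] psd_form.sqn_def[OF quad_form] by (simp add: Q_def)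
  have bdd: "bdd_above X"
    unfolding X_def Q_def bdd_above_def
  proof (intro exI ballI)
    fix x assume "x \<in> (\<lambda>f. Re (ip (A f) f)) ` {f \<in> U. sqn f = 1}"
    then show "x \<le> 1" using A_le U(2) by fastforce
  qed
  have normed: "sqn ((complex_of_real (1 / sqrt (sqn f))) \<odot> f) = 1"
    if "f \<in> H" "sqn f \<noteq> 0" for f
    using that sqn_ge0[of f] by (simp add: sqn_scale norm_divide power_divide)
  have Ql: "Q f \<le> l * sqn f" if "f \<in> U" for f
  proof (cases "sqn f = 0")
    case True
    then have "f = 0" using definite U that by blast
    then show ?thesis using A_le[OF H_0] True by (simp add: Q_def)
  next
    case False
    have fH: "f \<in> H" using U that by auto
    have "Q ((complex_of_real (1 / sqrt (sqn f))) \<odot> f) \<in> X"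
      using normed[OF fH False] subspace_scale[OF U(1) that] by (auto simp: X_def)
    then have "Q ((complex_of_real (1 / sqrt (sqn f))) \<odot> f) \<le> l"
      unfolding l_def using bdd by (rule cSup_upper)
    then show ?thesis using False sqn_ge0[OF fH] fH
      by (simp add: Q_scale norm_divide power_divide field_simps)
  qed
  have f0U: "f0 \<in> U" "f0 \<in> H" using f0 U by (auto simp: U_def)
  have f0n: "sqn f0 > 0"
  proof -
    have "sqn f0 \<noteq> 0"
      using f0(2) A_le[OF f0U(2)] by auto
    then show ?thesis using sqn_ge0[OF f0U(2)] by simp
  qed
  have la: "a < l"
  proof -
    have "a * sqn f0 < l * sqn f0" using f0(2) Ql[OF f0U(1)] by (simp add: Q_def)
    then show ?thesis using f0n by simp
  qed
  then have l0: "0 < l" using a by simp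
  have Xne: "X \<noteq> {}"
    using normed[OF f0U(2)] f0n subspace_scale[OF U(1) f0U(1)] by (fastforce simp: X_def)
  have "\<exists>f. f \<in> U \<and> sqn f = 1 \<and> l - 1 / real (Suc n) < Q f" for n
  proof -
    have "\<exists>x\<in>X. l - 1 / real (Suc n) < x"
      using less_cSup_iff[OF Xne bdd, of "l - 1 / real (Suc n)"] by (simp add: l_def)
    then show ?thesis by (auto simp: X_def)
  qed
  then obtain F where F: "\<And>n. F n \<in> U" "\<And>n. sqn (F n) = 1"
      "\<And>n. l - 1 / real (Suc n) < Q (F n)"
    by metis
  have FH: "F n \<in> H" for n using F U by auto
  obtain r g where r: "strict_mono r" and g: "g \<in> H"
    and lim: "(\<lambda>n. sqn (A (F (r n)) - g)) \<longlonglongrightarrow> 0"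
    using A_compact[of F] FH F(2) by fastforce
  define G where "G n = F (r n)" for n
  have GH: "G n \<in> H" "A (G n) \<in> H" "G n \<in> U" for n
    using FH A_in F by (auto simp: G_def)
  have Q_lim: "(\<lambda>n. Q (G n)) \<longlonglongrightarrow> l"
  proof (rule tendsto_sandwich)
    show "\<forall>\<^sub>F n in sequentially. l - 1 / real (Suc n) \<le> Q (G n)"
    proof (rule always_eventually, rule allI)
      fix n
      have "l - 1 / real (Suc n) \<le> l - 1 / real (Suc (r n))"
        using seq_suble[OF r, of n] by (simp add: frac_le)
      also have "\<dots> \<le> Q (G n)" using F(3)[of "r n"] by (simp add: G_def)
      finally show "l - 1 / real (Suc n) \<le> Q (G n)" .
    qed
    show "\<forall>\<^sub>F n in sequentially. Q (G n) \<le> l"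
      using Ql[OF GH(3)] F(2) by (simp add: G_def)
    have "(\<lambda>n. l - 1 / real (Suc n)) \<longlonglongrightarrow> l - 0"
      by (intro tendsto_intros LIMSEQ_Suc[OF lim_1_over_n])
    then show "(\<lambda>n. l - 1 / real (Suc n)) \<longlonglongrightarrow> l" by simp
  qed simp
  \<comment> \<open>Maximisers are approximate eigenvectors: after expanding the square,
    \<open>sqn (A (G n)) \<le> l * Q (G n)\<close> leaves at most l^2 - l Q(G n), which tends to
    0.\<close>
  have approx: "(\<lambda>n. sqn (A (G n) - complex_of_real l \<odot> G n)) \<longlonglongrightarrow> 0"
  proof (rule tendsto_sandwich)
    show "\<forall>\<^sub>F n in sequentially. 0 \<le> sqn (A (G n) - complex_of_real l \<odot> G n)"
      using GH H_diff H_scale sqn_ge0 by auto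
    show "\<forall>\<^sub>F n in sequentially. sqn (A (G n) - complex_of_real l \<odot> G n) \<le> l * l - l * Q (G n)"
    proof (rule always_eventually, rule allI)
      fix n
      have "sqn (A (G n) - complex_of_real l \<odot> G n)
          = sqn (A (G n)) - 2 * l * Q (G n) + l\<^sup>2 * sqn (G n)"
        using GH by (simp add: sqn_diff H_scale ip_scale_right sqn_scale Q_def)
      also have "sqn (G n) = 1" using F by (simp add: G_def)
      also have "sqn (A (G n)) \<le> l * Q (G n)"
        using sqn_A_le[OF U GH(3)] Ql by (simp add: Q_def)
      finally show "sqn (A (G n) - complex_of_real l \<odot> G n) \<le> l * l - l * Q (G n)"
        by (simp add: power2_eq_square)
    qed
    have "(\<lambda>n. l * l - l * Q (G n)) \<longlonglongrightarrow> l * l - l * l"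
      by (intro tendsto_intros Q_lim)
    then show "(\<lambda>n. l * l - l * Q (G n)) \<longlonglongrightarrow> 0" by simp
  qed simp
  \<comment> \<open>Compactness gives convergence of \<open>A (G n)\<close> only. Combined with
    \<open>approx\<close> it shows that l times \<open>G n\<close> tends to \<open>g\<close>, so
    \<open>g\<close> itself is the candidate eigenvector.\<close>
  define D where "D n = g - complex_of_real l \<odot> G n" for n
  have DH: "D n \<in> H" for n using g GH by (auto simp: D_def intro: H_diff H_scale)
  have D_lim: "(\<lambda>n. sqn (D n)) \<longlonglongrightarrow> 0"
  proof (rule tendsto_sandwich)
    show "\<forall>\<^sub>F n in sequentially. 0 \<le> sqn (D n)" using DH sqn_ge0 by auto
    show "\<forall>\<^sub>F n in sequentially. sqn (D n) \<le>
        2 * sqn (A (G n) - g) + 2 * sqn (A (G n) - complex_of_real l \<odot> G n)"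
    proof (rule always_eventually, rule allI)
      fix n
      have "D n = (-1) \<odot> (A (G n) - g) + (A (G n) - complex_of_real l \<odot> G n)"
        by (simp add: D_def scale_right_diff_distrib)
      then have "sqn (D n) \<le> 2 * sqn ((-1) \<odot> (A (G n) - g)) + 2 * sqn (A (G n) - complex_of_real l \<odot> G n)"
        using sqn_add_le[of "(-1) \<odot> (A (G n) - g)" "A (G n) - complex_of_real l \<odot> G n"] GH g
          H_diff H_scale by metis
      also have "sqn ((-1) \<odot> (A (G n) - g)) = sqn (A (G n) - g)"
        using GH g H_diff sqn_scale[of "A (G n) - g" "-1"] by simp
      finally show "sqn (D n) \<le>
        2 * sqn (A (G n) - g) + 2 * sqn (A (G n) - complex_of_real l \<odot> G n)" .
    qed
    have "(\<lambda>n. 2 * sqn (A (G n) - g) + 2 * sqn (A (G n) - complex_of_real l \<odot> G n)) \<longlonglongrightarrow> 2 * 0 + 2 * 0"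
      using lim unfolding G_def[symmetric] by (intro tendsto_intros approx)
    then show "(\<lambda>n. 2 * sqn (A (G n) - g) + 2 * sqn (A (G n) - complex_of_real l \<odot> G n)) \<longlonglongrightarrow> 0"
      by simp
  qed simp
  have "g \<in> perp B"
  proof -
    have "ip g b = 0" if "b \<in> B" for b
    proof -
      have bH: "b \<in> H" using that BH by auto
      have "(cmod (ip g b))\<^sup>2 \<le> sqn (D n) * sqn b" for n
      proof -
        have "ip (G n) b = 0" using GH(3)[of n] that by (auto simp: U_def perp_def)
        then have "ip (D n) b = ip g b"
          using g GH bH by (simp add: D_def ip_diff_left H_scale ip_scale_left)
        then show ?thesis using Cauchy_Schwarz[OF DH bH, of n] by simp
      qed
      moreover have "(\<lambda>n. sqn (D n) * sqn b) \<longlonglongrightarrow> 0 * sqn b"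
        by (intro tendsto_intros D_lim)
      ultimately have "(cmod (ip g b))\<^sup>2 \<le> 0 * sqn b"
        by (intro LIMSEQ_le_const) auto
      then show ?thesis by simp
    qed
    then show ?thesis using g by (simp add: perp_def)
  qed
  moreover have "A g = complex_of_real l \<odot> g"
  proof -
    define E where "E = A g - complex_of_real l \<odot> g"
    have EH: "E \<in> H" using g A_in by (auto simp: E_def intro: H_diff H_scale)
    have "sqn E \<le> 2 * sqn (D n) + 2 * (l\<^sup>2 * sqn (A (G n) - g))" for n
    proof -
      \<comment> \<open>Insert and remove l times \<open>A (G n)\<close>; both summands tend to
        0.\<close>
      have "E = A (D n) + complex_of_real l \<odot> (A (G n) - g)"
        using g GH by (simp add: E_def D_def A_diff A_scale H_scale scale_right_diff_distrib)
      then have "sqn E \<le> 2 * sqn (A (D n)) + 2 * sqn (complex_of_real l \<odot> (A (G n) - g))"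
        using sqn_add_le[of "A (D n)" "complex_of_real l \<odot> (A (G n) - g)"] DH A_in GH g
          H_diff H_scale by metis
      also have "sqn (complex_of_real l \<odot> (A (G n) - g)) = l\<^sup>2 * sqn (A (G n) - g)"
        using GH g H_diff by (simp add: sqn_scale)
      finally show ?thesis using sqn_A_le_sqn[OF DH, of n] by linarith
    qed
    moreover have "(\<lambda>n. 2 * sqn (D n) + 2 * (l\<^sup>2 * sqn (A (G n) - g))) \<longlonglongrightarrow> 2 * 0 + 2 * (l\<^sup>2 * 0)"
      using lim unfolding G_def[symmetric] by (intro tendsto_intros D_lim)
    ultimately have "sqn E \<le> 2 * 0 + 2 * (l\<^sup>2 * 0)"
      by (intro LIMSEQ_le_const) auto
    then have "sqn E = 0" using sqn_ge0[OF EH] by simp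
    then have "E = 0" using definite[OF EH] by simp
    then show ?thesis by (simp add: E_def)
  qed
  moreover have "g \<noteq> 0"
  proof
    assume "g = 0"
    \<comment> \<open>With \<open>g = 0\<close> the vector \<open>D n\<close> is -l times a unit
      vector, so its squared norm stays at l^2 > 0 instead of tending to 0.\<close>
    then have "sqn (D n) = l\<^sup>2" for n
      using GH(1)[of n] F(2)[of "r n"] H_0 sqn_scale[of "complex_of_real l \<odot> G n" "-1"]
      by (simp add: D_def H_scale sqn_scale G_def)
    then show False using D_lim l0 LIMSEQ_unique[OF D_lim, of "l\<^sup>2"] by simp
  qed
  ultimately show ?thesis using la by blast
qed

section \<open>Maximal eigenvector families, residuals and multiplicities\<close>

lemma eigenvalue_unique:
  assumes "f \<in> eig c" "f \<in> eig d" "f \<noteq> 0" shows "c = d"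
  using assms by (auto simp: eig_def)

lemma eig_orthogonal:
  assumes f: "f \<in> eig (complex_of_real c)" and g: "g \<in> eig (complex_of_real d)" and "c \<noteq> d"
  shows "ip f g = 0"
proof -
  have "of_real c * ip f g = of_real d * ip f g"
    using A_sym[of f g] f g by (auto simp: eig_def ip_scale_left ip_scale_right)
  then show ?thesis using \<open>c \<noteq> d\<close> by simp
qed

lemma eigset_insert:
  assumes B: "eigset a B" and g: "g \<in> perp B" "g \<noteq> 0" "g \<in> eig (complex_of_real l)" "a < l"
  shows "\<exists>B'. eigset a B' \<and> card B' = Suc (card B)"
proof -
  have gH: "g \<in> H" using g by (auto simp: perp_def)
  have "sqn g \<noteq> 0" using definite[OF gH] g by auto
  then have s: "sqn g > 0" using sqn_ge0[OF gH] by simp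
  define h where "h = complex_of_real (1 / sqrt (sqn g)) \<odot> g"
  have BH: "B \<subseteq> H" using B by (auto simp: eigset_def)
  have hp: "h \<in> perp B" "h \<in> H"
    using subspace_scale[OF perp_subspace[OF BH] g(1)] H_scale gH by (auto simp: h_def)
  have "sqn h = 1" using s gH by (simp add: h_def sqn_scale norm_divide power_divide)
  then have h1: "ip h h = 1" using ip_self[OF hp(2)] by simp
  have he: "h \<in> eig (complex_of_real l)"
    using g hp gH by (simp add: eig_def h_def A_scale scale_left_commute)
  have hb: "ip h b = 0" "ip b h = 0" if "b \<in> B" for b
    using hp that ip_commute[of h b] BH by (auto simp: perp_def)
  have "h \<notin> B" using hb h1 by force
  then have "card (insert h B) = Suc (card B)" using B by (simp add: eigset_def)
  moreover have "eigset a (insert h B)"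
    using B h1 he hb hp(2) g(4) by (auto simp: eigset_def)
  ultimately show ?thesis by blast
qed

text \<open>A family of greatest cardinality cannot be extended by a normalised eigenvector from its
  complement. The uniform bound \<open>N\<close> is supplied later by the trace estimate.\<close>

lemma maximal_eigset:
  assumes "\<And>B. eigset a B \<Longrightarrow> card B \<le> N"
  obtains B where "eigset a B"
    "\<And>g l. \<lbrakk>g \<in> perp B; g \<in> eig (complex_of_real l); a < l\<rbrakk> \<Longrightarrow> g = 0"
proof -
  have "eigset a {}" by (simp add: eigset_def)
  then obtain B where B: "eigset a B" "\<And>B'. eigset a B' \<Longrightarrow> card B' \<le> card B"
    using ex_has_greatest_nat[of "eigset a" "{}" card "Suc N"] assms le_imp_less_Suc by metis
  show ?thesis
  proof (rule that[OF B(1)])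
    fix g l assume "g \<in> perp B" "g \<in> eig (complex_of_real l)" "a < l"
    then show "g = 0" using eigset_insert[OF B(1), of g l] B(2) by fastforce
  qed
qed

text \<open>The link from eigenvalues to the quadratic form: a vector of the complement violating
  the bound would yield, by compactness, an eigenvector there with eigenvalue above
  \<open>a\<close>.\<close>

lemma perp_quad_le:
  assumes B: "eigset a B" and a: "0 \<le> a"
    and max: "\<And>g l. \<lbrakk>g \<in> perp B; g \<in> eig (complex_of_real l); a < l\<rbrakk> \<Longrightarrow> g = 0"
    and f: "f \<in> perp B"
  shows "Re (ip (A f) f) \<le> a * sqn f"
proof (rule ccontr)
  assume "\<not> ?thesis"
  then obtain g l where g: "g \<in> perp B" "g \<noteq> 0" "a < l" "A g = complex_of_real l \<odot> g"
    using top_eigenvector[OF B a f] by force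
  then show False using max[of g l] by (auto simp: eig_def perp_def)
qed

lemma eigset_projection:
  assumes B: "eigset a B" and f: "f \<in> H"
  shows "f - (\<Sum>b\<in>B. ip f b \<odot> b) \<in> perp B"
proof -
  have BH: "B \<subseteq> H" and fin: "finite B" using B by (auto simp: eigset_def)
  have s: "(\<Sum>b\<in>B. ip f b \<odot> b) \<in> H" using BH by (intro H_sum H_scale) auto
  have "ip (f - (\<Sum>b\<in>B. ip f b \<odot> b)) d = 0" if d: "d \<in> B" for d
  proof -
    have dH: "d \<in> H" using BH d by auto
    have "ip (\<Sum>b\<in>B. ip f b \<odot> b) d = (\<Sum>b\<in>B. ip f b * ip b d)"
      using BH dH by (subst ip_sum_left) (auto intro!: sum.cong H_scale simp: ip_scale_left subset_iff)
    also have "\<dots> = (\<Sum>b\<in>B. if b = d then ip f d else 0)"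
      using B d by (intro sum.cong) (auto simp: eigset_def)
    also have "\<dots> = ip f d" using fin d by simp
    finally show ?thesis using s f dH by (simp add: ip_diff_left)
  qed
  then show ?thesis using f s by (auto simp: perp_def intro: H_diff)
qed

lemma perp_ip_sum:
  assumes "B \<subseteq> H" "h \<in> perp B"
  shows "ip h (\<Sum>b\<in>B. c b \<odot> b) = 0"
  using assms by (subst ip_sum_right) (auto simp: perp_def ip_scale_right H_scale subset_iff)

text \<open>Pythagoras, for the norm and for the quadratic form of \<open>A\<close> at once: the
  span of \<open>B\<close> and its complement are orthogonal and both invariant under
  \<open>A\<close>, so neither form has cross terms. The weight \<open>Re (ip (A b) b)\<close> is
  the eigenvalue of \<open>b\<close>.\<close>

lemma eigset_residual:
  assumes B: "eigset a B" and f: "f \<in> H"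
  defines "g \<equiv> f - (\<Sum>b\<in>B. ip f b \<odot> b)"
  shows "g \<in> perp B"
    and "sqn g = sqn f - (\<Sum>b\<in>B. (cmod (ip f b))\<^sup>2)"
    and "Re (ip (A g) g) = Re (ip (A f) f) - (\<Sum>b\<in>B. Re (ip (A b) b) * (cmod (ip f b))\<^sup>2)"
proof -
  have BH: "B \<subseteq> H" and fin: "finite B" using B by (auto simp: eigset_def)
  define p where "p = (\<Sum>b\<in>B. ip f b \<odot> b)"
  have p: "p \<in> H" unfolding p_def using BH by (intro H_sum H_scale) auto
  have g: "g = f - p" by (simp add: g_def p_def)
  show gp: "g \<in> perp B" unfolding g_def by (rule eigset_projection[OF B f])
  then have gH: "g \<in> H" by (simp add: perp_def)
  have sq: "ip f b * ip b f = of_real ((cmod (ip f b))\<^sup>2)" if "b \<in> B" for b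
    using ip_commute[of f b] f BH that complex_norm_square[of "ip f b"] by auto
  have "ip g g = ip g f"
    using perp_ip_sum[OF BH gp] ip_diff_right[OF f p gH] by (simp add: g p_def)
  also have "\<dots> = ip f f - ip p f" using ip_diff_left[OF f p f] by (simp add: g)
  also have "ip p f = (\<Sum>b\<in>B. ip f b * ip b f)"
    unfolding p_def using BH f
    by (subst ip_sum_left) (auto intro!: sum.cong H_scale simp: ip_scale_left subset_iff)
  also have "\<dots> = of_real (\<Sum>b\<in>B. (cmod (ip f b))\<^sup>2)"
    unfolding of_real_sum by (intro sum.cong refl sq)
  finally show "sqn g = sqn f - (\<Sum>b\<in>B. (cmod (ip f b))\<^sup>2)" by (simp add: sqn_def)
  have "ip (A g) g = ip (A g) f"
    using perp_ip_sum[OF BH A_perp[OF B gp]] ip_diff_right[OF f p A_in[OF gH]] by (simp add: g p_def)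
  also have "\<dots> = ip (A f) f - ip (A p) f"
    using ip_diff_left[OF A_in[OF f] A_in[OF p] f] by (simp add: g A_diff f p)
  also have "ip (A p) f = ip p (A f)" by (rule A_sym[OF p f])
  also have "\<dots> = (\<Sum>b\<in>B. ip f b * ip b (A f))"
    unfolding p_def using BH A_in[OF f]
    by (subst ip_sum_left) (auto intro!: sum.cong H_scale simp: ip_scale_left subset_iff)
  also have "\<dots> = of_real (\<Sum>b\<in>B. Re (ip (A b) b) * (cmod (ip f b))\<^sup>2)"
    unfolding of_real_sum
  proof (intro sum.cong refl)
    fix b assume b: "b \<in> B"
    then have bH: "b \<in> H" using BH by auto
    have "\<exists>c>a. b \<in> eig (complex_of_real c)" using B b by (simp add: eigset_def)
    then obtain c where "b \<in> eig (complex_of_real c)" by blast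
    then have Ab: "A b = complex_of_real c \<odot> b" by (simp add: eig_def)
    have "ip b b = 1" using B b by (simp add: eigset_def)
    then have c: "Re (ip (A b) b) = c" using bH by (simp add: Ab ip_scale_left)
    have "ip b (A f) = ip (A b) f" using A_sym[OF bH f] by simp
    also have "\<dots> = of_real c * ip b f" using bH f by (simp add: Ab ip_scale_left)
    finally have "ip f b * ip b (A f) = of_real c * (ip f b * ip b f)" by simp
    then show "ip f b * ip b (A f) = of_real (Re (ip (A b) b) * (cmod (ip f b))\<^sup>2)"
      by (simp only: sq[OF b] c of_real_mult)
  qed
  finally show "Re (ip (A g) g) = Re (ip (A f) f) - (\<Sum>b\<in>B. Re (ip (A b) b) * (cmod (ip f b))\<^sup>2)"
    by simp
qed

lemma eigset_eigenvalue:
  assumes B: "eigset a B" and b: "b \<in> B"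
  shows "a < Re (ip (A b) b)" "Re (ip (A b) b) \<le> 1"
proof -
  have bH: "b \<in> H" and bb: "ip b b = 1" using B b by (auto simp: eigset_def)
  have "\<exists>c>a. b \<in> eig (complex_of_real c)" using B b by (simp add: eigset_def)
  then obtain c where c: "a < c" "b \<in> eig (complex_of_real c)" by blast
  then have "A b = complex_of_real c \<odot> b" by (simp add: eig_def)
  then have "Re (ip (A b) b) = c" using bH bb by (simp add: ip_scale_left)
  then show "a < Re (ip (A b) b)" using c by simp
  show "Re (ip (A b) b) \<le> 1" using A_le[OF bH] bb by (simp add: sqn_def)
qed

lemma eigset_independent:
  assumes B: "eigset a B" and C: "C \<subseteq> B"
  shows "independent C"
proof -
  have fin: "finite C" and CH: "C \<subseteq> H" using B C finite_subset by (auto simp: eigset_def)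
  have "u v = 0" if s: "(\<Sum>v\<in>C. u v \<odot> v) = 0" and v: "v \<in> C" for u v
  proof -
    have vH: "v \<in> H" using v CH by auto
    have "0 = ip (\<Sum>v\<in>C. u v \<odot> v) v" using s vH by (simp add: ip_0_left)
    also have "\<dots> = (\<Sum>b\<in>C. u b * ip b v)"
      using CH vH by (subst ip_sum_left) (auto intro!: sum.cong H_scale simp: ip_scale_left subset_iff)
    also have "\<dots> = (\<Sum>b\<in>C. if b = v then u v else 0)"
      using B C v by (intro sum.cong) (auto simp: eigset_def subset_iff)
    also have "\<dots> = u v" using fin v by simp
    finally show ?thesis by simp
  qed
  then show ?thesis using independent_if_scalars_zero[OF fin] by blast
qed

lemma eig_subspace: "subspace (eig c)"
proof -
  have "A 0 = 0" using A_scale[of 0 0] H_0 by simp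
  then have "0 \<in> eig c" using H_0 by (simp add: eig_def)
  moreover have "f + g \<in> eig c" if "f \<in> eig c" "g \<in> eig c" for f g
    using that by (simp add: eig_def H_add A_add scale_right_distrib)
  moreover have "d \<odot> f \<in> eig c" if "f \<in> eig c" for d f
    using that by (simp add: eig_def H_scale A_scale scale_left_commute[of d c])
  ultimately show ?thesis by (simp add: subspace_def)
qed

text \<open>Members of \<open>B\<close> with another eigenvalue are orthogonal to \<open>f\<close>,
  so subtracting the projection of \<open>f\<close> removes only vectors of the same eigenspace.
  What remains is an eigenvector in the complement of \<open>B\<close>, hence 0 by
  maximality.\<close>

lemma eig_span_eigset:
  assumes B: "eigset a B" and c: "a < c"
    and max: "\<And>g l. \<lbrakk>g \<in> perp B; g \<in> eig (complex_of_real l); a < l\<rbrakk> \<Longrightarrow> g = 0"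
  shows "eig (complex_of_real c) \<subseteq> span (B \<inter> eig (complex_of_real c))"
proof
  fix f assume f: "f \<in> eig (complex_of_real c)"
  have fH: "f \<in> H" using f by (auto simp: eig_def)
  have fin: "finite B" using B by (auto simp: eigset_def)
  define C where "C = B \<inter> eig (complex_of_real c)"
  have z: "ip f b = 0" if "b \<in> B - C" for b
  proof -
    have "b \<in> B" using that by simp
    then have "\<exists>d>a. b \<in> eig (complex_of_real d)" using B by (simp add: eigset_def)
    then obtain d where "b \<in> eig (complex_of_real d)" by blast
    then show ?thesis using eig_orthogonal[OF f, of b d] that by (auto simp: C_def)
  qed
  have eq: "(\<Sum>b\<in>B. ip f b \<odot> b) = (\<Sum>b\<in>C. ip f b \<odot> b)"
    using fin z by (intro sum.mono_neutral_right) (auto simp: C_def)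
  have "(\<Sum>b\<in>C. ip f b \<odot> b) \<in> eig (complex_of_real c)"
    by (intro subspace_sum[OF eig_subspace] subspace_scale[OF eig_subspace]) (auto simp: C_def)
  then have "f - (\<Sum>b\<in>C. ip f b \<odot> b) \<in> eig (complex_of_real c)"
    using f subspace_diff[OF eig_subspace] by blast
  then have "f - (\<Sum>b\<in>C. ip f b \<odot> b) = 0"
    using max[OF eigset_projection[OF B fH] _ c] eq by simp
  then have "f = (\<Sum>b\<in>C. ip f b \<odot> b)" by simp
  also have "\<dots> \<in> span C" by (intro span_sum span_scale span_base)
  finally show "f \<in> span (B \<inter> eig (complex_of_real c))" by (simp add: C_def)
qed

text \<open>Sorting \<open>B\<close> by eigenvalue splits it into disjoint bases of the eigenspaces,
  one for each element of \<open>X\<close>, so the cardinalities add up to the sum of the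
  multiplicities.\<close>

lemma eigenvalue_count:
  assumes B: "eigset a B"
    and max: "\<And>g l. \<lbrakk>g \<in> perp B; g \<in> eig (complex_of_real l); a < l\<rbrakk> \<Longrightarrow> g = 0"
  defines "X \<equiv> {c. a < c \<and> (\<exists>f\<in>eig (complex_of_real c). f \<noteq> 0)}"
  shows "finite X" "card B = (\<Sum>c\<in>X. dim (eig (complex_of_real c)))"
proof -
  have fin: "finite B" using B by (auto simp: eigset_def)
  define S where "S c = B \<inter> eig (complex_of_real c)" for c
  have ne0: "b \<noteq> 0" if "b \<in> B" for b
    using B that ip_0_left[OF H_0] by (auto simp: eigset_def)
  have S_ne: "S c \<noteq> {}" if "c \<in> X" for c
  proof
    assume "S c = {}"
    then have "eig (complex_of_real c) \<subseteq> {0}"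
      using eig_span_eigset[OF B, of c] max that by (auto simp: S_def X_def)
    then show False using that by (auto simp: X_def)
  qed
  have S_disj: "S c \<inter> S d = {}" if "c \<noteq> d" for c d
    using eigenvalue_unique ne0 that by (fastforce simp: S_def)
  \<comment> \<open>Every element of \<open>X\<close> is the eigenvalue of some nonzero member of
    \<open>B\<close>, so \<open>X\<close> lies in the finite set \<open>ev\<close> applied to
    \<open>B\<close>; this gives its finiteness.\<close>
  define ev where "ev b = (SOME c. b \<in> eig (complex_of_real c))" for b
  have "c \<in> ev ` B" if "c \<in> X" for c
  proof -
    obtain b where b: "b \<in> B" "b \<in> eig (complex_of_real c)"
      using S_ne \<open>c \<in> X\<close> by (auto simp: S_def)
    have "b \<in> eig (complex_of_real (ev b))"
      unfolding ev_def using b(2) by (rule someI)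
    then have "complex_of_real (ev b) = complex_of_real c"
      using eigenvalue_unique b(2) ne0[OF b(1)] by blast
    then show ?thesis using b(1) by auto
  qed
  then show finX: "finite X" using fin by (meson finite_imageI finite_subset subsetI)
  have "B \<subseteq> (\<Union>c\<in>X. S c)"
  proof
    fix b assume b: "b \<in> B"
    then have "\<exists>c>a. b \<in> eig (complex_of_real c)" using B by (simp add: eigset_def)
    then obtain c where "a < c" "b \<in> eig (complex_of_real c)" by blast
    then show "b \<in> (\<Union>c\<in>X. S c)" using b ne0[OF b] by (auto simp: S_def X_def)
  qed
  then have "B = (\<Union>c\<in>X. S c)" by (auto simp: S_def)
  then have "card B = card (\<Union>c\<in>X. S c)" by simp
  also have "\<dots> = (\<Sum>c\<in>X. card (S c))"
    using finX fin S_disj by (intro card_UN_disjoint) (auto simp: S_def)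
  also have "\<dots> = (\<Sum>c\<in>X. dim (eig (complex_of_real c)))"
  proof (intro sum.cong refl)
    fix c assume c: "c \<in> X"
    show "card (S c) = dim (eig (complex_of_real c))"
      using eig_span_eigset[OF B, of c] max c eigset_independent[OF B, of "S c"]
      by (intro basis_card_eq_dim) (auto simp: S_def X_def)
  qed
  finally show "card B = (\<Sum>c\<in>X. dim (eig (complex_of_real c)))" .
qed

end

section \<open>Fourier inversion\<close>

lemma borel_measurable_cis [measurable (raw)]:
  "f \<in> borel_measurable M \<Longrightarrow> (\<lambda>x. cis (f x)) \<in> borel_measurable M"
  by (rule borel_measurable_continuous_on[of cis]) (intro continuous_intros)

text \<open>A product majorant justifies Fubini. All interchanges of integrals below rest on this
  criterion.\<close>

lemma integrable_lborel_prod_bound: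
  fixes F :: "real \<times> real \<Rightarrow> 'b::{banach, second_countable_topology}" and g h :: "real \<Rightarrow> real"
  assumes [measurable]: "F \<in> borel_measurable (lborel \<Otimes>\<^sub>M lborel)"
    and g: "integrable lborel g" and h: "integrable lborel h"
    and le: "\<And>x y. norm (F (x, y)) \<le> g x * h y"
  shows "integrable (lborel \<Otimes>\<^sub>M lborel) F"
proof -
  have [measurable]: "g \<in> borel_measurable borel" "h \<in> borel_measurable borel"
    using borel_measurable_integrable[OF g] borel_measurable_integrable[OF h] by simp_all
  have "integrable (lborel \<Otimes>\<^sub>M lborel) (\<lambda>p. g (fst p) * h (snd p))"
  proof (rule lborel_pair.Fubini_integrable)
    show "integrable lborel (\<lambda>x. \<integral> y. norm (g (fst (x, y)) * h (snd (x, y))) \<partial>lborel)"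
      using g by (simp add: abs_mult)
    show "AE x in lborel. integrable lborel (\<lambda>y. g (fst (x, y)) * h (snd (x, y)))"
      using h by simp
  qed measurable
  then show ?thesis
  proof (rule Bochner_Integration.integrable_bound)
    show "AE p in lborel \<Otimes>\<^sub>M lborel. norm (F p) \<le> norm (g (fst p) * h (snd p))"
      by (rule AE_I2) (metis abs_ge_self le order_trans prod.collapse real_norm_def)
  qed measurable
qed

lemma fourier_cis: "fourier f t = (LINT x|lborel. f x * cis (- (2 * pi * t * x)))"
  unfolding fourier_def
  by (intro Bochner_Integration.integral_cong) (auto simp: cis_conv_exp mult_ac)

lemma integrable_mult_cis:
  fixes f :: "real \<Rightarrow> complex"
  assumes f: "integrable lborel f"
  shows "integrable lborel (\<lambda>x. f x * cis (a * x))"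
  using f
proof (rule Bochner_Integration.integrable_bound)
  show "(\<lambda>x. f x * cis (a * x)) \<in> borel_measurable lborel"
    using borel_measurable_integrable[OF f] by measurable
qed (auto simp: norm_mult)

lemma continuous_fourier:
  assumes f: "integrable lborel f"
  shows "continuous_on UNIV (fourier f)"
proof -
  have [measurable]: "f \<in> borel_measurable borel" using borel_measurable_integrable[OF f] by simp
  have "isCont (fourier f) t" for t
  proof (rule continuous_at_sequentiallyI)
    fix u :: "nat \<Rightarrow> real" assume u: "u \<longlonglongrightarrow> t"
    show "(\<lambda>n. fourier f (u n)) \<longlonglongrightarrow> fourier f t"
      unfolding fourier_cis
    proof (rule integral_dominated_convergence[where w = "\<lambda>x. norm (f x)"])
      show "AE x in lborel. (\<lambda>n. f x * cis (- (2 * pi * u n * x))) \<longlonglongrightarrow> f x * cis (- (2 * pi * t * x))"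
        by (intro AE_I2 tendsto_intros tendsto_cis u)
    qed (use f in \<open>auto simp: norm_mult\<close>)
  qed
  then show ?thesis by (simp add: continuous_at_imp_continuous_on)
qed

text \<open>The characteristic function of the standard normal distribution at u / d, rewritten by
  the substitution v = 2 pi d s. The result is the normal density with standard deviation
  \<open>d\<close>, evaluated at \<open>u\<close>.\<close>

lemma gaussian_fourier:
  fixes u d :: real assumes d: "0 < d"
  shows "(LINT s|lborel. complex_of_real (exp (- (2 * pi * d * s)\<^sup>2 / 2)) * cis (2 * pi * s * u)) =
    complex_of_real (std_normal_density (u / d) / d)"
proof -
  have "(LINT v|lborel. complex_of_real (std_normal_density v) * cis (u / d * v))
      = char std_normal_distribution (u / d)"
    unfolding char_def
    by (subst integral_density) (auto simp: cis_conv_exp scaleR_conv_of_real mult_ac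
        intro!: Bochner_Integration.integral_cong)
  also have "\<dots> = complex_of_real (exp (- (u / d)\<^sup>2 / 2))"
    by (simp add: char_std_normal_distribution)
  finally have *: "complex_of_real (exp (- (u / d)\<^sup>2 / 2))
      = (LINT v|lborel. complex_of_real (std_normal_density v) * cis (u / d * v))" by simp
  also have "\<dots> = \<bar>2 * pi * d\<bar> *\<^sub>R (LINT s|lborel. complex_of_real (std_normal_density (0 + (2 * pi * d) * s)) *
        cis (u / d * (0 + (2 * pi * d) * s)))"
    using d by (intro lborel_integral_real_affine) simp
  also have "(\<lambda>s. complex_of_real (std_normal_density (0 + (2 * pi * d) * s)) * cis (u / d * (0 + (2 * pi * d) * s)))
    = (\<lambda>s. complex_of_real (1 / sqrt (2 * pi)) *
          (complex_of_real (exp (- (2 * pi * d * s)\<^sup>2 / 2)) * cis (2 * pi * s * u)))"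
    using d by (auto simp: fun_eq_iff normal_density_def mult_ac)
  also have "(LINT s|lborel. complex_of_real (1 / sqrt (2 * pi)) *
          (complex_of_real (exp (- (2 * pi * d * s)\<^sup>2 / 2)) * cis (2 * pi * s * u)))
     = complex_of_real (1 / sqrt (2 * pi)) *
       (LINT s|lborel. complex_of_real (exp (- (2 * pi * d * s)\<^sup>2 / 2)) * cis (2 * pi * s * u))"
    by (rule integral_mult_right_zero)
  finally have **: "complex_of_real (exp (- (u / d)\<^sup>2 / 2)) = complex_of_real (2 * pi * d / sqrt (2 * pi)) *
       (LINT s|lborel. complex_of_real (exp (- (2 * pi * d * s)\<^sup>2 / 2)) * cis (2 * pi * s * u))"
    (is "_ = _ * ?I")
    using d by (simp add: scaleR_conv_of_real)
  have s: "2 * pi * d / sqrt (2 * pi) = sqrt (2 * pi) * d"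
    by (simp add: real_div_sqrt divide_simps)
  have "sqrt (2 * pi) * d \<noteq> 0" using d by simp
  then have "?I = complex_of_real (exp (- (u / d)\<^sup>2 / 2)) / complex_of_real (sqrt (2 * pi) * d)"
    using ** d unfolding s by (simp add: field_simps)
  also have "\<dots> = complex_of_real (std_normal_density (u / d) / d)"
    by (simp add: normal_density_def)
  finally show ?thesis .
qed

text \<open>With z = u^2 / (2 d^2) the exponential is at most 1 / z, and dividing by
  \<open>d\<close> still leaves a factor \<open>d\<close>. Uniform smallness away from 0 lets the
  tail be controlled by the L^1 norm of \<open>f\<close> alone.\<close>

lemma std_normal_density_tail:
  fixes u d :: real
  assumes "1 \<le> \<bar>u\<bar>" and d: "0 < d"
  shows "std_normal_density (u / d) / d \<le> 2 * d"
proof -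
  define z where "z = (u / d)\<^sup>2 / 2"
  have u2: "1 \<le> u\<^sup>2" using assms(1) by (metis abs_1 abs_le_square_iff one_power2)
  have "0 < z" using d u2 by (auto simp: z_def)
  moreover have "1 / z = 2 * d\<^sup>2 / u\<^sup>2" using d u2 by (simp add: z_def power_divide)
  moreover have "2 * d\<^sup>2 / u\<^sup>2 \<le> 2 * d\<^sup>2 / 1" using u2 by (intro divide_left_mono) auto
  ultimately have z: "0 < z" "1 / z \<le> 2 * d\<^sup>2" by simp_all
  have "std_normal_density (u / d) = exp (- z) / sqrt (2 * pi)"
    by (simp add: normal_density_def z_def)
  also have "\<dots> \<le> exp (- z) / 1"
    using pi_ge_two by (intro divide_left_mono) auto
  also have "\<dots> \<le> 1 / z"
  proof -
    have "z \<le> exp z" using exp_ge_add_one_self[of z] by linarith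
    then show ?thesis using z by (simp add: exp_minus field_simps)
  qed
  also have "\<dots> \<le> 2 * d\<^sup>2" by (rule z)
  finally have "std_normal_density (u / d) / d \<le> 2 * d\<^sup>2 / d"
    using d by (intro divide_right_mono) auto
  then show ?thesis using d by (simp add: power2_eq_square)
qed

text \<open>Near \<open>t\<close>, rescaling by \<open>d n\<close> and dominated convergence use
  continuity at \<open>t\<close>; at distance at least 1 the Gaussian is at most 2 d everywhere and
  integrability of \<open>f\<close> suffices.\<close>

lemma gaussian_approx_identity:
  fixes f :: "real \<Rightarrow> complex"
  assumes cont: "continuous_on UNIV f" and f: "integrable lborel f"
    and d: "\<And>n. 0 < d n" "d \<longlonglongrightarrow> 0"
  shows "(\<lambda>n. LINT x|lborel. f x * complex_of_real (std_normal_density ((t - x) / d n) / d n)) \<longlonglongrightarrow> f t"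
proof -
  have [measurable]: "f \<in> borel_measurable borel" using borel_measurable_integrable[OF f] by simp
  \<comment> \<open>\<open>f\<close> is not known to be bounded on the line. Cutting at distance 1
    gives a bound \<open>M\<close> on the near part and matches the range of
    \<open>std_normal_density_tail\<close>.\<close>
  define I where "I x = (indicator {t - 1..t + 1} x :: real)" for x
  have [measurable]: "I \<in> borel_measurable borel" unfolding I_def by measurable
  define k where "k n x = std_normal_density ((t - x) / d n) / d n" for n x
  have [measurable]: "k n \<in> borel_measurable borel" for n
    unfolding k_def by measurable
  have "\<exists>M. \<forall>x\<in>{t - 1..t + 1}. norm (f x) \<le> M"
    using compact_imp_bounded[OF compact_continuous_image[OF continuous_on_subset[OF cont, of "{t - 1..t + 1}"]]]
    by (auto simp: bounded_iff)
  then obtain M where M: "\<And>x. x \<in> {t - 1..t + 1} \<Longrightarrow> norm (f x) \<le> M" by blast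
  have near_eq: "(LINT x|lborel. f x * of_real (I x * k n x))
      = (LINT y|lborel. f (t - d n * y) * of_real (I (t - d n * y) * std_normal_density y))" for n
  proof -
    have "(LINT x|lborel. f x * of_real (I x * k n x)) = \<bar>- d n\<bar> *\<^sub>R
      (LINT y|lborel. f (t + (- d n) * y) * of_real (I (t + (- d n) * y) * k n (t + (- d n) * y)))"
      using d(1)[of n] by (intro lborel_integral_real_affine) simp
    also have "\<dots> = (LINT y|lborel. \<bar>- d n\<bar> *\<^sub>R (f (t + (- d n) * y) * of_real (I (t + (- d n) * y) * k n (t + (- d n) * y))))"
      by simp
    also have "\<dots> = (LINT y|lborel. f (t - d n * y) * of_real (I (t - d n * y) * std_normal_density y))"
      using d(1)[of n] by (intro Bochner_Integration.integral_cong) (auto simp: k_def scaleR_conv_of_real)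
    finally show ?thesis .
  qed
  have near: "(\<lambda>n. LINT x|lborel. f x * of_real (I x * k n x)) \<longlonglongrightarrow> f t"
  proof -
    have "(\<lambda>n. LINT y|lborel. f (t - d n * y) * of_real (I (t - d n * y) * std_normal_density y))
        \<longlonglongrightarrow> (LINT y|lborel. f t * of_real (std_normal_density y))"
    proof (rule integral_dominated_convergence[where w = "\<lambda>y. M * std_normal_density y"])
      show "AE y in lborel. (\<lambda>n. f (t - d n * y) * of_real (I (t - d n * y) * std_normal_density y))
          \<longlonglongrightarrow> f t * of_real (std_normal_density y)"
      proof (rule AE_I2)
        fix y
        have dy: "(\<lambda>n. t - d n * y) \<longlonglongrightarrow> t - 0 * y" by (intro tendsto_intros d)
        then have lim: "(\<lambda>n. t - d n * y) \<longlonglongrightarrow> t" by simp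
        have f': "(\<lambda>n. f (t - d n * y)) \<longlonglongrightarrow> f t"
          using continuous_on_tendsto_compose[OF cont lim] by simp
        have "\<forall>\<^sub>F n in sequentially. dist (t - d n * y) t < 1"
          using tendstoD[OF lim] by simp
        then have "\<forall>\<^sub>F n in sequentially. I (t - d n * y) = 1"
          by eventually_elim (auto simp: I_def dist_real_def indicator_def)
        then have "(\<lambda>n. I (t - d n * y)) \<longlonglongrightarrow> 1" by (rule tendsto_eventually)
        from tendsto_mult[OF f' tendsto_of_real[OF tendsto_mult[OF this tendsto_const[of "std_normal_density y"]]]]
        show "(\<lambda>n. f (t - d n * y) * of_real (I (t - d n * y) * std_normal_density y))
          \<longlonglongrightarrow> f t * of_real (std_normal_density y)" by simp
      qed
      show "AE y in lborel. norm (f (t - d n * y) * of_real (I (t - d n * y) * std_normal_density y)) \<le> M * std_normal_density y" for n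
      proof (rule AE_I2)
        fix y
        have "0 \<le> M" using order_trans[OF norm_ge_zero M[of t]] by simp
        then show "norm (f (t - d n * y) * of_real (I (t - d n * y) * std_normal_density y)) \<le> M * std_normal_density y"
          using M[of "t - d n * y"]
          by (auto simp: I_def indicator_def norm_mult intro!: mult_right_mono)
      qed
      show "integrable lborel (\<lambda>y. M * std_normal_density y)"
        using integrable_std_normal_moment[of 0] by simp
    qed (auto simp del: of_real_mult)
    also have "(LINT y|lborel. f t * of_real (std_normal_density y)) = f t * of_real (LINT y|lborel. std_normal_density y)"
      by (simp add: integral_complex_of_real)
    also have "(LINT y|lborel. std_normal_density y) = 1"
      using integral_std_normal_moment_even[of 0] by simp
    finally show ?thesis unfolding near_eq by simp
  qed
  have far_le: "norm (of_real ((1 - I x) * k n x) :: complex) \<le> 2 * d n" for n x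
  proof (cases "x \<in> {t - 1..t + 1}")
    case True
    then show ?thesis using d(1)[of n] by (simp add: I_def)
  next
    case False
    then have "1 \<le> \<bar>t - x\<bar>" by auto
    then show ?thesis
      using False std_normal_density_tail[of "t - x" "d n"] d(1)[of n]
      by (simp add: I_def k_def norm_mult norm_divide)
  qed
  have far_int: "integrable lborel (\<lambda>x. f x * of_real ((1 - I x) * k n x))" for n
  proof (rule Bochner_Integration.integrable_bound)
    show "integrable lborel (\<lambda>x. f x * of_real (2 * d n))" using f by simp
    show "AE x in lborel. norm (f x * of_real ((1 - I x) * k n x)) \<le> norm (f x * of_real (2 * d n))"
      using far_le[of _ n] d(1)[of n]
      by (intro AE_I2) (simp add: norm_mult mult_left_mono del: of_real_mult)
  qed measurable
  have "(\<lambda>n. LINT x|lborel. f x * of_real ((1 - I x) * k n x)) \<longlonglongrightarrow> 0"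
  proof (rule Lim_null_comparison)
    show "\<forall>\<^sub>F n in sequentially. norm (LINT x|lborel. f x * of_real ((1 - I x) * k n x))
        \<le> 2 * d n * (LINT x|lborel. norm (f x))"
    proof (rule always_eventually, rule allI)
      fix n
      have "norm (LINT x|lborel. f x * of_real ((1 - I x) * k n x))
         \<le> (LINT x|lborel. norm (f x * of_real ((1 - I x) * k n x)))"
        by (rule integral_norm_bound)
      also have "\<dots> \<le> (LINT x|lborel. 2 * d n * norm (f x))"
        using far_int[of n] f far_le[of _ n] d(1)[of n]
        by (intro integral_mono integrable_norm integrable_mult_right)
           (simp_all add: norm_mult mult.commute mult_left_mono del: of_real_mult)
      finally show "norm (LINT x|lborel. f x * of_real ((1 - I x) * k n x))
        \<le> 2 * d n * (LINT x|lborel. norm (f x))" by simp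
    qed
    have "(\<lambda>n. 2 * d n * (LINT x|lborel. norm (f x))) \<longlonglongrightarrow> 2 * 0 * (LINT x|lborel. norm (f x))"
      by (intro tendsto_intros d)
    then show "(\<lambda>n. 2 * d n * (LINT x|lborel. norm (f x))) \<longlonglongrightarrow> 0" by simp
  qed
  from tendsto_add[OF near this]
  have "(\<lambda>n. (LINT x|lborel. f x * of_real (I x * k n x)) + (LINT x|lborel. f x * of_real ((1 - I x) * k n x)))
      \<longlonglongrightarrow> f t" by simp
  moreover have "(LINT x|lborel. f x * of_real (I x * k n x)) + (LINT x|lborel. f x * of_real ((1 - I x) * k n x))
     = (LINT x|lborel. f x * of_real (k n x))" for n
  proof -
    have "integrable lborel (\<lambda>x. f x * of_real (I x * k n x))"
    proof (rule Bochner_Integration.integrable_bound)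
      show "integrable lborel (\<lambda>x. f x * of_real (1 / d n))" using f by simp
      have "k n x \<le> 1 / d n" for x
      proof -
        have "std_normal_density ((t - x) / d n) \<le> 1 / sqrt (2 * pi) * 1"
          unfolding std_normal_density_def by (intro mult_left_mono) auto
        also have "\<dots> \<le> 1" using pi_ge_two by simp
        finally show ?thesis using d(1)[of n] by (simp add: k_def divide_right_mono)
      qed
      moreover have "0 \<le> k n x" for x using d(1)[of n] by (simp add: k_def)
      ultimately have "norm (of_real (I x * k n x) :: complex) \<le> norm (of_real (1 / d n) :: complex)" for x
        using d(1)[of n] by (auto simp: I_def indicator_def norm_divide)
      then show "AE x in lborel. norm (f x * of_real (I x * k n x)) \<le> norm (f x * of_real (1 / d n))"
        by (intro AE_I2) (simp only: norm_mult mult_left_mono norm_ge_zero)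
    qed measurable
    then show ?thesis using far_int[of n]
      by (subst Bochner_Integration.integral_add[symmetric])
         (auto intro!: Bochner_Integration.integral_cong simp: algebra_simps)
  qed
  ultimately show ?thesis by (simp add: k_def)
qed

text \<open>A Gaussian factor in \<open>s\<close> makes the double integral absolutely convergent.
  Integrating in \<open>s\<close> first gives a Gaussian average of \<open>f\<close> about
  \<open>t\<close>, which tends to \<open>f t\<close>; integrating in \<open>x\<close> first gives
  the damped inversion integral, whose damping is then removed by dominated convergence.\<close>

lemma fourier_inversion:
  fixes f :: "real \<Rightarrow> complex"
  assumes cont: "continuous_on UNIV f" and f: "integrable lborel f"
    and hat: "integrable lborel (fourier f)"
  shows "f t = (LINT s|lborel. fourier f s * cis (2 * pi * t * s))"
proof -
  have [measurable]: "f \<in> borel_measurable borel" using borel_measurable_integrable[OF f] by simp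
  have [measurable]: "fourier f \<in> borel_measurable borel" using borel_measurable_integrable[OF hat] by simp
  define d where "d n = 1 / real (Suc n)" for n
  have d: "\<And>n. 0 < d n" "d \<longlonglongrightarrow> 0"
    using LIMSEQ_Suc[OF lim_1_over_n[where 'a = real]] unfolding d_def by simp_all
  define G where "G n s = exp (- (2 * pi * d n * s)\<^sup>2 / 2)" for n s
  have [measurable]: "G n \<in> borel_measurable borel" for n unfolding G_def by measurable
  have G_int: "integrable lborel (G n)" for n
  proof -
    have "integrable lborel (\<lambda>s. std_normal_density (0 + (2 * pi * d n) * s))"
      using integrable_std_normal_moment[of 0] d(1)[of n]
      by (intro lborel_integrable_real_affine) auto
    then have "integrable lborel (\<lambda>s. sqrt (2 * pi) * std_normal_density (0 + (2 * pi * d n) * s))"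
      by (rule integrable_mult_right)
    also have "(\<lambda>s. sqrt (2 * pi) * std_normal_density (0 + (2 * pi * d n) * s)) = G n"
      by (auto simp: G_def normal_density_def fun_eq_iff)
    finally show ?thesis .
  qed
  have eq: "(LINT s|lborel. fourier f s * cis (2 * pi * t * s) * of_real (G n s))
     = (LINT x|lborel. f x * complex_of_real (std_normal_density ((t - x) / d n) / d n))" for n
  proof -
    have int: "integrable (lborel \<Otimes>\<^sub>M lborel)
        (\<lambda>(x, s). f x * (complex_of_real (G n s) * cis (2 * pi * s * (t - x))))"
      using f G_int[of n]
      by (intro integrable_lborel_prod_bound[where g = "\<lambda>x. norm (f x)" and h = "G n"])
         (auto simp: norm_mult G_def)
    have "(LINT s|lborel. fourier f s * cis (2 * pi * t * s) * of_real (G n s))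
      = (LINT s|lborel. LINT x|lborel. f x * (complex_of_real (G n s) * cis (2 * pi * s * (t - x))))"
    proof (intro Bochner_Integration.integral_cong refl)
      fix s
      have "fourier f s * cis (2 * pi * t * s) * of_real (G n s)
         = (LINT x|lborel. f x * cis (- (2 * pi * s * x)) * (cis (2 * pi * t * s) * of_real (G n s)))"
        unfolding fourier_cis integral_mult_left_zero by (rule mult.assoc)
      also have "\<dots> = (LINT x|lborel. f x * (complex_of_real (G n s) * cis (2 * pi * s * (t - x))))"
      proof (intro Bochner_Integration.integral_cong refl)
        fix x
        have "cis (- (2 * pi * s * x)) * cis (2 * pi * t * s) = cis (2 * pi * s * (t - x))"
          by (simp add: cis_mult algebra_simps)
        from this[symmetric]
        show "f x * cis (- (2 * pi * s * x)) * (cis (2 * pi * t * s) * of_real (G n s))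
          = f x * (complex_of_real (G n s) * cis (2 * pi * s * (t - x)))"
          by (simp only: ac_simps)
      qed
      finally show "fourier f s * cis (2 * pi * t * s) * of_real (G n s)
         = (LINT x|lborel. f x * (complex_of_real (G n s) * cis (2 * pi * s * (t - x))))" .
    qed
    also have "\<dots> = (LINT x|lborel. LINT s|lborel. f x * (complex_of_real (G n s) * cis (2 * pi * s * (t - x))))"
      using int by (rule lborel_pair.Fubini_integral)
    also have "\<dots> = (LINT x|lborel. f x * complex_of_real (std_normal_density ((t - x) / d n) / d n))"
      using gaussian_fourier[OF d(1)[of n]] unfolding G_def
      by (intro Bochner_Integration.integral_cong refl) (subst integral_mult_right_zero, simp only:)
    finally show ?thesis .
  qed
  have "(\<lambda>n. LINT s|lborel. fourier f s * cis (2 * pi * t * s) * of_real (G n s))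
     \<longlonglongrightarrow> (LINT s|lborel. fourier f s * cis (2 * pi * t * s))"
  proof (rule integral_dominated_convergence[where w = "\<lambda>s. norm (fourier f s)"])
    show "AE s in lborel. (\<lambda>n. fourier f s * cis (2 * pi * t * s) * of_real (G n s))
        \<longlonglongrightarrow> fourier f s * cis (2 * pi * t * s)"
    proof (rule AE_I2)
      fix s
      have "(\<lambda>n. G n s) \<longlonglongrightarrow> exp (- (2 * pi * 0 * s)\<^sup>2 / 2)"
        unfolding G_def by (intro tendsto_intros d) simp
      then have "(\<lambda>n. G n s) \<longlonglongrightarrow> 1" by simp
      from tendsto_mult[OF tendsto_const tendsto_of_real[OF this]]
      show "(\<lambda>n. fourier f s * cis (2 * pi * t * s) * of_real (G n s))
        \<longlonglongrightarrow> fourier f s * cis (2 * pi * t * s)" by force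
    qed
    show "AE s in lborel. norm (fourier f s * cis (2 * pi * t * s) * of_real (G n s)) \<le> norm (fourier f s)" for n
      by (intro AE_I2) (auto simp: norm_mult G_def intro!: mult_left_le)
    show "integrable lborel (\<lambda>s. norm (fourier f s))" using hat by simp
  qed measurable
  then have "(\<lambda>n. LINT x|lborel. f x * complex_of_real (std_normal_density ((t - x) / d n) / d n))
     \<longlonglongrightarrow> (LINT s|lborel. fourier f s * cis (2 * pi * t * s))"
    by (simp add: eq)
  with gaussian_approx_identity[OF cont f d, of t] show ?thesis
    by (rule LIMSEQ_unique)
qed

section \<open>The reproducing kernel in closed form\<close>

text \<open>The form with \<open>sinc\<close> supplies the value 2T at \<open>u = 0\<close>, which
  is the leading term of the kernel on the diagonal.\<close>

definition sinc_kernel :: "real \<Rightarrow> real \<Rightarrow> real" where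
  "sinc_kernel T u = 2 * T * sinc (2 * pi * T * u)"

text \<open>The two quotients are tanh c and coth c. They come from matching cosh and sinh to the
  even and the odd part of the boundary values.\<close>

definition kernel_corr :: "real \<Rightarrow> real \<Rightarrow> real \<Rightarrow> real" where
  "kernel_corr T t x = (let c = 2 * pi * T in
     (t * sin (c * (x - t)) - sinh c / cosh c * cos (c * t) * cos (c * x)
        - cosh c / sinh c * sin (c * t) * sin (c * x)) / (pi * (1 + t\<^sup>2)))"

definition kern :: "real \<Rightarrow> real \<Rightarrow> real \<Rightarrow> real" where
  "kern T t x = (sinc_kernel T (x - t) + kernel_corr T t x) / (1 + x\<^sup>2)"

text \<open>The solution of the boundary value problem vanishes at \<open>-T\<close> and \<open>T\<close>, so clamping the
  argument to \<open>[-T, T]\<close> extends it by zero.\<close>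

definition kernhat :: "real \<Rightarrow> real \<Rightarrow> real \<Rightarrow> complex" where
  "kernhat T t s = (let c = 2 * pi * T; r = max (- T) (min T s) in
     (cis (- (2 * pi * t * r)) - of_real (cos (c * t) * cosh (2 * pi * r) / cosh c)
        + \<i> * of_real (sin (c * t) * sinh (2 * pi * r) / sinh c)) / of_real (1 + t\<^sup>2))"

lemma one_plus_sq_pos: "0 < 1 + (x::real)\<^sup>2"
  by (rule add_pos_nonneg) auto

lemma one_plus_sq_nz [simp]: "1 + (x::real)\<^sup>2 \<noteq> 0"
  using one_plus_sq_pos[of x] by linarith

lemma sinc_kernel_mult: "u * sinc_kernel T u = sin (2 * pi * T * u) / pi"
  by (auto simp: sinc_kernel_def field_simps)

lemma sinc_kernel_0 [simp]: "sinc_kernel T 0 = 2 * T"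
  by (simp add: sinc_kernel_def)

lemma sinc_kernel_minus: "sinc_kernel T (- u) = sinc_kernel T u"
  by (simp add: sinc_kernel_def)

lemma continuous_sinc_kernel [continuous_intros]:
  "continuous_on S f \<Longrightarrow> continuous_on S (\<lambda>x. sinc_kernel T (f x))"
  unfolding sinc_kernel_def by (intro continuous_intros)

lemma abs_sinc_kernel_le:
  assumes "0 < T" shows "\<bar>sinc_kernel T u\<bar> \<le> 2 * T"
proof -
  have "\<bar>sinc y\<bar> \<le> 1" for y
    using abs_sin_x_le_abs_x[of y] by (auto simp: field_simps)
  moreover have "\<bar>2 * T * r\<bar> \<le> 2 * T" if "\<bar>r\<bar> \<le> 1" for r
    using that assms by (simp add: abs_mult mult_left_le)
  ultimately show ?thesis unfolding sinc_kernel_def by blast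
qed

lemma sinc_kernel_sq_le:
  assumes "u \<noteq> 0" shows "(sinc_kernel T u)\<^sup>2 \<le> 1 / u\<^sup>2"
proof -
  have "(u * sinc_kernel T u)\<^sup>2 = (sin (2 * pi * T * u))\<^sup>2 / pi\<^sup>2"
    by (simp add: sinc_kernel_mult power_divide)
  also have "\<dots> \<le> 1 / 1"
  proof (intro frac_le)
    show "(sin (2 * pi * T * u))\<^sup>2 \<le> 1" by (simp add: abs_square_le_1)
    have "1 * 1 \<le> pi * pi" using pi_ge_two by (intro mult_mono) auto
    then show "1 \<le> pi\<^sup>2" by (simp add: power2_eq_square)
  qed auto
  finally show ?thesis using assms by (simp add: power_mult_distrib field_simps)
qed

lemma cosh_complex_of_real: "cosh (complex_of_real x) = complex_of_real (cosh x)"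
  and sinh_complex_of_real: "sinh (complex_of_real x) = complex_of_real (sinh x)"
  by (simp_all add: cosh_def sinh_def scaleR_conv_of_real exp_of_real flip: of_real_minus)

section \<open>Inverse transforms of exponentials and hyperbolic functions on the band\<close>

lemma FTC_complex:
  fixes a b :: real
  assumes "a \<le> b" and "\<And>z. (G has_field_derivative g z) (at z)"
    and "continuous_on {a..b} (\<lambda>s. g (complex_of_real s))"
  shows "(LINT s|lborel. indicator {a..b} s *\<^sub>R g (complex_of_real s))
      = G (complex_of_real b) - G (complex_of_real a)"
  by (rule integral_FTC_atLeastAtMost[where F = "\<lambda>s. G (complex_of_real s)"])
     (auto intro!: has_vector_derivative_real_field assms)

lemma cis_eq_exp_of_real: "cis (a * s) = exp (\<i> * of_real a * of_real s)"
  by (simp add: cis_conv_exp mult_ac)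

lemma integral_cis:
  assumes "0 < T"
  shows "(LINT s|lborel. indicator {-T..T} s *\<^sub>R cis (2 * pi * u * s)) = complex_of_real (sinc_kernel T u)"
proof (cases "u = 0")
  case True
  have "(LINT s|lborel. indicator {-T..T} s *\<^sub>R (1::complex)) = complex_of_real T - complex_of_real (- T)"
    using assms by (intro FTC_complex) (auto intro!: derivative_eq_intros)
  then show ?thesis using True by (simp add: sinc_kernel_def)
next
  case False
  define w where "w = \<i> * complex_of_real (2 * pi * u)"
  have w: "w \<noteq> 0" using False by (simp add: w_def)
  have "(LINT s|lborel. indicator {-T..T} s *\<^sub>R cis (2 * pi * u * s))
      = (LINT s|lborel. indicator {-T..T} s *\<^sub>R exp (w * complex_of_real s))"
    by (simp add: cis_eq_exp_of_real w_def)
  also have "\<dots> = exp (w * complex_of_real T) / w - exp (w * complex_of_real (- T)) / w"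
    using assms w
    by (intro FTC_complex[where G = "\<lambda>z. exp (w * z) / w" and g = "\<lambda>z. exp (w * z)"])
       (auto intro!: derivative_eq_intros continuous_intros)
  also have "\<dots> = (cis (2 * pi * u * T) - cis (2 * pi * u * (- T))) / w"
    by (simp only: cis_eq_exp_of_real w_def diff_divide_distrib)
  also have "cis (2 * pi * u * T) - cis (2 * pi * u * (- T)) = 2 * \<i> * of_real (sin (2 * pi * u * T))"
    by (simp add: complex_eq_iff)
  also have "2 * \<i> * of_real (sin (2 * pi * u * T)) / w = of_real (sin (2 * pi * u * T) / (pi * u))"
    using False by (simp add: w_def field_simps)
  also have "sin (2 * pi * u * T) / (pi * u) = sinc_kernel T u"
    using False assms by (simp add: sinc_kernel_def field_simps)
  finally show ?thesis .
qed

lemma integral_cosh_cis: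
  assumes "0 < T"
  shows "(LINT s|lborel. indicator {-T..T} s *\<^sub>R (of_real (cosh (2 * pi * s)) * cis (2 * pi * x * s))) =
    complex_of_real ((sinh (2 * pi * T) * cos (2 * pi * T * x) + x * cosh (2 * pi * T) * sin (2 * pi * T * x)) / (pi * (1 + x\<^sup>2)))"
proof -
  define p where "p = complex_of_real (2 * pi)"
  \<comment> \<open>Up to the constant \<open>m\<close> an antiderivative: in the derivative the two
    sinh terms cancel and the cosh terms add up to the factor 1 + x^2.\<close>
  define G where "G z = (sinh (p * z) - \<i> * of_real x * cosh (p * z)) * exp (\<i> * (p * of_real x) * z)" for z
  define m where "m = p * of_real (1 + x\<^sup>2)"
  have m: "m \<noteq> 0" using one_plus_sq_nz[of x] by (simp add: m_def p_def del: of_real_add)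
  have cancel2: "(2 * r) / (2 * pi * q) = r / (pi * q)" for r q :: real by simp
  have m': "m = p * (1 + of_real x * of_real x)" by (simp add: m_def power2_eq_square)
  have "(LINT s|lborel. indicator {-T..T} s *\<^sub>R (of_real (cosh (2 * pi * s)) * cis (2 * pi * x * s)))
      = (LINT s|lborel. indicator {-T..T} s *\<^sub>R (cosh (p * of_real s) * exp (\<i> * (p * of_real x) * of_real s)))"
    by (simp add: cis_eq_exp_of_real p_def flip: cosh_complex_of_real of_real_mult)
  also have "\<dots> = G (complex_of_real T) / m - G (complex_of_real (- T)) / m"
  proof (rule FTC_complex[where G = "\<lambda>z. G z / m" and g = "\<lambda>z. cosh (p * z) * exp (\<i> * (p * of_real x) * z)"])
    fix z
    have "(G has_field_derivative m * (cosh (p * z) * exp (\<i> * (p * of_real x) * z))) (at z)"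
      unfolding G_def m' by (auto intro!: derivative_eq_intros simp: algebra_simps)
    then show "((\<lambda>z. G z / m) has_field_derivative cosh (p * z) * exp (\<i> * (p * of_real x) * z)) (at z)"
      using m by (auto intro!: derivative_eq_intros)
  qed (use assms in \<open>auto intro!: continuous_intros\<close>)
  also have "\<dots> = (G (complex_of_real T) - G (complex_of_real (- T))) / m"
    by (simp add: diff_divide_distrib)
  also have "G (complex_of_real T) - G (complex_of_real (- T)) =
     of_real (2 * (sinh (2 * pi * T) * cos (2 * pi * T * x) + x * cosh (2 * pi * T) * sin (2 * pi * T * x)))"
  proof -
    have "G (complex_of_real r) = (of_real (sinh (2 * pi * r)) - \<i> * of_real (x * cosh (2 * pi * r))) * cis (2 * pi * x * r)" for r
      by (simp add: G_def p_def cis_eq_exp_of_real flip: cosh_complex_of_real sinh_complex_of_real)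
    note this[of T] this[of "- T"]
    then show ?thesis by (simp only:) (simp add: complex_eq_iff algebra_simps)
  qed
  also have "of_real (2 * (sinh (2 * pi * T) * cos (2 * pi * T * x) + x * cosh (2 * pi * T) * sin (2 * pi * T * x))) / m
    = complex_of_real ((sinh (2 * pi * T) * cos (2 * pi * T * x) + x * cosh (2 * pi * T) * sin (2 * pi * T * x)) / (pi * (1 + x\<^sup>2)))"
    unfolding m_def p_def of_real_mult[symmetric] of_real_divide[symmetric] of_real_eq_iff by (rule cancel2)
  finally show ?thesis .
qed

lemma integral_sinh_cis:
  assumes "0 < T"
  shows "(LINT s|lborel. indicator {-T..T} s *\<^sub>R (of_real (sinh (2 * pi * s)) * cis (2 * pi * x * s))) =
    \<i> * complex_of_real ((cosh (2 * pi * T) * sin (2 * pi * T * x) - x * sinh (2 * pi * T) * cos (2 * pi * T * x)) / (pi * (1 + x\<^sup>2)))"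
proof -
  define p where "p = complex_of_real (2 * pi)"
  \<comment> \<open>The same antiderivative with cosh and sinh exchanged; now the cosh terms
    cancel.\<close>
  define G where "G z = (cosh (p * z) - \<i> * of_real x * sinh (p * z)) * exp (\<i> * (p * of_real x) * z)" for z
  define m where "m = p * of_real (1 + x\<^sup>2)"
  have m: "m \<noteq> 0" using one_plus_sq_nz[of x] by (simp add: m_def p_def del: of_real_add)
  have cancel2: "(2 * r) / (2 * pi * q) = r / (pi * q)" for r q :: real by simp
  have m': "m = p * (1 + of_real x * of_real x)" by (simp add: m_def power2_eq_square)
  have "(LINT s|lborel. indicator {-T..T} s *\<^sub>R (of_real (sinh (2 * pi * s)) * cis (2 * pi * x * s)))
      = (LINT s|lborel. indicator {-T..T} s *\<^sub>R (sinh (p * of_real s) * exp (\<i> * (p * of_real x) * of_real s)))"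
    by (simp add: cis_eq_exp_of_real p_def flip: sinh_complex_of_real of_real_mult)
  also have "\<dots> = G (complex_of_real T) / m - G (complex_of_real (- T)) / m"
  proof (rule FTC_complex[where G = "\<lambda>z. G z / m" and g = "\<lambda>z. sinh (p * z) * exp (\<i> * (p * of_real x) * z)"])
    fix z
    have "(G has_field_derivative m * (sinh (p * z) * exp (\<i> * (p * of_real x) * z))) (at z)"
      unfolding G_def m' by (auto intro!: derivative_eq_intros simp: algebra_simps)
    then show "((\<lambda>z. G z / m) has_field_derivative sinh (p * z) * exp (\<i> * (p * of_real x) * z)) (at z)"
      using m by (auto intro!: derivative_eq_intros)
  qed (use assms in \<open>auto intro!: continuous_intros\<close>)
  also have "\<dots> = (G (complex_of_real T) - G (complex_of_real (- T))) / m"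
    by (simp add: diff_divide_distrib)
  also have "G (complex_of_real T) - G (complex_of_real (- T)) =
     \<i> * of_real (2 * (cosh (2 * pi * T) * sin (2 * pi * T * x) - x * sinh (2 * pi * T) * cos (2 * pi * T * x)))"
  proof -
    have "G (complex_of_real r) = (of_real (cosh (2 * pi * r)) - \<i> * of_real (x * sinh (2 * pi * r))) * cis (2 * pi * x * r)" for r
      by (simp add: G_def p_def cis_eq_exp_of_real flip: cosh_complex_of_real sinh_complex_of_real)
    note this[of T] this[of "- T"]
    then show ?thesis by (simp only:) (simp add: complex_eq_iff algebra_simps)
  qed
  also have "\<i> * of_real (2 * (cosh (2 * pi * T) * sin (2 * pi * T * x) - x * sinh (2 * pi * T) * cos (2 * pi * T * x))) / m
    = \<i> * complex_of_real ((cosh (2 * pi * T) * sin (2 * pi * T * x) - x * sinh (2 * pi * T) * cos (2 * pi * T * x)) / (pi * (1 + x\<^sup>2)))"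
    unfolding m_def p_def of_real_mult[symmetric] times_divide_eq_right[symmetric] of_real_divide[symmetric]
      mult_left_cancel[OF complex_i_not_zero] of_real_eq_iff
    by (subst times_divide_eq_right) (rule cancel2)
  finally show ?thesis .
qed

text \<open>The right-hand side is what inverting \<open>kernhat\<close> term by term produces, with
  prefactor 1 / (1 + t^2). The identity sin (c (x - t)) = pi (x - t) K trades it for the prefactor 1
  / (1 + x^2) of \<open>kern\<close>.\<close>

lemma kern_eq:
  "kern T t x = (sinc_kernel T (x - t) - cos (2 * pi * T * t) / cosh (2 * pi * T) *
       ((sinh (2 * pi * T) * cos (2 * pi * T * x) + x * cosh (2 * pi * T) * sin (2 * pi * T * x)) / (pi * (1 + x\<^sup>2)))
     - sin (2 * pi * T * t) / sinh (2 * pi * T) *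
       ((cosh (2 * pi * T) * sin (2 * pi * T * x) - x * sinh (2 * pi * T) * cos (2 * pi * T * x)) / (pi * (1 + x\<^sup>2))))
     / (1 + t\<^sup>2)" if "0 < T"
proof -
  define C where "C = cosh (2 * pi * T)"
  define S where "S = sinh (2 * pi * T)"
  define K where "K = sinc_kernel T (x - t)"
  define ct where "ct = cos (2 * pi * T * t)"
  define st where "st = sin (2 * pi * T * t)"
  define cx where "cx = cos (2 * pi * T * x)"
  define sx where "sx = sin (2 * pi * T * x)"
  have nz: "C \<noteq> 0" "S \<noteq> 0" using that by (auto simp: C_def S_def)
  have sd: "sin (2 * pi * T * (x - t)) = sx * ct - cx * st"
    by (simp add: right_diff_distrib sin_diff sx_def ct_def cx_def st_def)
  have K: "sx * ct - cx * st = pi * ((x - t) * K)"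
    unfolding sd[symmetric] K_def sinc_kernel_mult by simp
  have "(K - ct / C * ((S * cx + x * C * sx) / (pi * (1 + x\<^sup>2)))
      - st / S * ((C * sx - x * S * cx) / (pi * (1 + x\<^sup>2)))) / (1 + t\<^sup>2)
    = (K - (x * (sx * ct - cx * st) + S / C * ct * cx + C / S * st * sx) / (pi * (1 + x\<^sup>2))) / (1 + t\<^sup>2)"
  proof -
    define Q where "Q = pi * (1 + x\<^sup>2)"
    have "ct / C * ((S * cx + x * C * sx) / Q) = (S / C * ct * cx + x * ct * sx) / Q"
      using nz by (simp add: field_simps)
    moreover have "st / S * ((C * sx - x * S * cx) / Q) = (C / S * st * sx - x * st * cx) / Q"
      using nz by (simp add: field_simps)
    ultimately show ?thesis unfolding Q_def[symmetric]
      by (simp only:) (simp add: algebra_simps add_divide_distrib diff_divide_distrib)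
  qed
  also have "\<dots> = (K + (t * (sx * ct - cx * st) - S / C * ct * cx - C / S * st * sx) / (pi * (1 + t\<^sup>2))) / (1 + x\<^sup>2)"
  proof -
    define P where "P = S / C * ct * cx + C / S * st * sx"
    \<comment> \<open>On both sides the coefficient of \<open>K\<close> is (1 + x t) / ((1 + x^2) (1
      + t^2)), and \<open>P\<close> is divided by pi (1 + x^2) (1 + t^2).\<close>
    have "(K - (x * (pi * ((x - t) * K)) + P) / (pi * (1 + x\<^sup>2))) / (1 + t\<^sup>2)
       = (K + (t * (pi * ((x - t) * K)) - P) / (pi * (1 + t\<^sup>2))) / (1 + x\<^sup>2)"
      by (simp add: divide_simps) (simp add: algebra_simps power2_eq_square)
    then show ?thesis unfolding K by (simp add: P_def algebra_simps)
  qed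
  finally show ?thesis
    unfolding kern_def kernel_corr_def Let_def sd
    by (simp add: C_def S_def K_def ct_def st_def cx_def sx_def)
qed

text \<open>The same trade of prefactors: the coefficient (1 + x t) / ((1 + x^2) (1 + t^2)) of the
  sinc term is symmetric, and so is \<open>P\<close>.\<close>

lemma kern_sym: "0 < T \<Longrightarrow> kern T t x = kern T x t"
proof -
  assume "0 < T"
  define K where "K = sinc_kernel T (x - t)"
  define P where "P = sinh (2 * pi * T) / cosh (2 * pi * T) * cos (2 * pi * T * t) * cos (2 * pi * T * x)
     + cosh (2 * pi * T) / sinh (2 * pi * T) * sin (2 * pi * T * t) * sin (2 * pi * T * x)"
  have K': "sinc_kernel T (t - x) = K"
    using sinc_kernel_minus[of T "x - t"] by (simp add: K_def)
  have s: "sin (2 * pi * T * (x - t)) = pi * ((x - t) * K)"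
    unfolding K_def sinc_kernel_mult by simp
  have s': "sin (2 * pi * T * (t - x)) = pi * ((t - x) * K)"
    unfolding K'[symmetric] sinc_kernel_mult by simp
  have "kern T t x = (K + (t * (pi * ((x - t) * K)) - P) / (pi * (1 + t\<^sup>2))) / (1 + x\<^sup>2)"
    unfolding kern_def kernel_corr_def Let_def s K_def[symmetric] P_def by (simp only: diff_diff_eq)
  also have "\<dots> = (K + (x * (pi * ((t - x) * K)) - P) / (pi * (1 + x\<^sup>2))) / (1 + t\<^sup>2)"
    by (simp add: divide_simps) (simp add: algebra_simps power2_eq_square)
  also have "\<dots> = kern T x t"
    unfolding kern_def kernel_corr_def Let_def s' K' P_def by (simp only: diff_diff_eq ac_simps)
  finally show ?thesis .
qed

lemma continuous_kernhat: "0 < T \<Longrightarrow> continuous_on UNIV (kernhat T t)"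
  unfolding kernhat_def Let_def
  by (intro continuous_intros) (auto simp del: of_real_add)

lemma kernhat_outside:
  assumes "0 < T" "s \<notin> {-T<..<T}" shows "kernhat T t s = 0"
proof -
  have "sinh (2 * pi * T) \<noteq> 0" using assms by simp
  moreover have "max (- T) (min T s) = T \<or> max (- T) (min T s) = - T"
    using assms by (auto simp: max_def min_def)
  ultimately show ?thesis
    by (auto simp: kernhat_def Let_def complex_eq_iff mult_ac)
qed

lemma kernhat_indicator:
  assumes "0 < T" shows "kernhat T t s = indicator {-T..T} s *\<^sub>R kernhat T t s"
  using kernhat_outside[OF assms, of s t] by (auto simp: indicator_def)

lemma integrable_kernhat: "0 < T \<Longrightarrow> integrable lborel (kernhat T t)"
  using borel_integrable_compact[OF compact_Icc continuous_on_subset[OF continuous_kernhat], of T "- T" T t]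
  by (simp flip: kernhat_indicator)

lemma integral_kernhat:
  assumes "0 < T"
  shows "(LINT s|lborel. kernhat T t s * cis (2 * pi * x * s)) = complex_of_real (kern T t x)"
proof -
  define c where "c = 2 * pi * T"
  define I where "I s = (indicator {-T..T} s :: real)" for s
  define a where "a = complex_of_real (cos (c * t) / cosh c)"
  define b where "b = complex_of_real (sin (c * t) / sinh c)"
  define m where "m = complex_of_real (1 / (1 + t\<^sup>2))"
  \<comment> \<open>The sinh part carries a factor i and its inverse transform another one, so the
    sum is real.\<close>
  have comb: "of_real w * ((of_real k - of_real u * of_real p) + (\<i> * of_real v) * (\<i> * of_real q))
      = complex_of_real ((k - u * p - v * q) * w)" for w k u p v q
    by (simp add: complex_eq_iff algebra_simps)
  define F1 where "F1 s = I s *\<^sub>R cis (2 * pi * (x - t) * s)" for s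
  define F2 where "F2 s = I s *\<^sub>R (of_real (cosh (2 * pi * s)) * cis (2 * pi * x * s))" for s
  define F3 where "F3 s = I s *\<^sub>R (of_real (sinh (2 * pi * s)) * cis (2 * pi * x * s))" for s
  have int: "integrable lborel F1" "integrable lborel F2" "integrable lborel F3"
    unfolding F1_def F2_def F3_def I_def
    by (intro borel_integrable_compact compact_Icc continuous_intros)+
  have "(LINT s|lborel. kernhat T t s * cis (2 * pi * x * s))
      = (LINT s|lborel. m * ((F1 s - a * F2 s) + (\<i> * b) * F3 s))"
  proof (intro Bochner_Integration.integral_cong refl)
    fix s
    show "kernhat T t s * cis (2 * pi * x * s) = m * ((F1 s - a * F2 s) + (\<i> * b) * F3 s)"
    proof (cases "s \<in> {-T..T}")
      case True
      then have "max (- T) (min T s) = s" by auto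
      moreover have "cis (2 * pi * (x - t) * s) = cis (- (2 * pi * t * s)) * cis (2 * pi * x * s)"
        by (simp add: cis_mult algebra_simps)
      ultimately show ?thesis using True
        by (simp add: kernhat_def Let_def F1_def F2_def F3_def I_def a_def b_def m_def c_def divide_inverse algebra_simps)
    next
      case False
      then show ?thesis using kernhat_outside[OF assms, of s t]
        by (auto simp: F1_def F2_def F3_def I_def)
    qed
  qed
  also have "\<dots> = m * (((LINT s|lborel. F1 s) - a * (LINT s|lborel. F2 s)) + (\<i> * b) * (LINT s|lborel. F3 s))"
    using int by (simp only: integral_mult_right_zero Bochner_Integration.integral_add
        Bochner_Integration.integral_diff Bochner_Integration.integrable_diff integrable_mult_right)
  also have "\<dots> = complex_of_real (kern T t x)"
    unfolding F1_def F2_def F3_def I_def integral_cis[OF assms] integral_cosh_cis[OF assms]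
      integral_sinh_cis[OF assms] a_def b_def m_def c_def comb kern_eq[OF assms]
    by simp
  finally show ?thesis .
qed

text \<open>The sine term is kept because it vanishes for x = t; it alone is responsible for the
  slower decay off the diagonal. The 3 is 1 for the tanh term plus 2 for the coth term.\<close>

lemma abs_kernel_corr_le:
  assumes "1 \<le> T"
  shows "\<bar>kernel_corr T t x\<bar> \<le> (\<bar>t * sin (2 * pi * T * (x - t))\<bar> + 3) / (pi * (1 + t\<^sup>2))"
proof -
  define c where "c = 2 * pi * T"
  have "2 * 1 * 1 \<le> 2 * pi * T" using assms pi_ge_two by (intro mult_mono) auto
  then have c: "2 \<le> c" by (simp add: c_def)
  have sp: "0 < sinh c" using c by simp
  have cp: "0 < cosh c" by simp
  have "sinh c \<le> cosh c" using sinh_less_cosh_real[of c] by simp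
  then have th: "\<bar>sinh c / cosh c\<bar> \<le> 1" using sp cp by simp
  \<comment> \<open>Equivalent to exp (2 c) \<ge> 3, which c \<ge> 2 guarantees.\<close>
  have "cosh c \<le> 2 * sinh c"
  proof -
    have "3 \<le> 1 + 2 * c" using c by simp
    also have "\<dots> \<le> exp (2 * c)" by (rule exp_ge_add_one_self)
    also have "exp (2 * c) = exp c * exp c" by (simp flip: exp_add)
    finally have "3 * exp (- c) \<le> exp c" by (simp add: exp_minus field_simps)
    then show ?thesis by (simp add: cosh_def sinh_def)
  qed
  then have ct: "\<bar>cosh c / sinh c\<bar> \<le> 2" using sp cp by (simp add: field_simps)
  have 2: "\<bar>sinh c / cosh c * cos (c * t) * cos (c * x)\<bar> \<le> 1 * 1 * 1"
    using th unfolding abs_mult by (intro mult_mono) auto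
  have 3: "\<bar>cosh c / sinh c * sin (c * t) * sin (c * x)\<bar> \<le> 2 * 1 * 1"
    using ct unfolding abs_mult by (intro mult_mono) auto
  have "\<bar>t * sin (c * (x - t)) - sinh c / cosh c * cos (c * t) * cos (c * x)
        - cosh c / sinh c * sin (c * t) * sin (c * x)\<bar> \<le> \<bar>t * sin (c * (x - t))\<bar> + 3"
    using 2 3 by linarith
  then have "\<bar>t * sin (c * (x - t)) - sinh c / cosh c * cos (c * t) * cos (c * x)
        - cosh c / sinh c * sin (c * t) * sin (c * x)\<bar> / (pi * (1 + t\<^sup>2)) \<le> (\<bar>t * sin (c * (x - t))\<bar> + 3) / (pi * (1 + t\<^sup>2))"
    using one_plus_sq_pos[of t] by (intro divide_right_mono) auto
  moreover have "\<bar>pi * (1 + t\<^sup>2)\<bar> = pi * (1 + t\<^sup>2)" using one_plus_sq_pos[of t] by simp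
  ultimately show ?thesis
    unfolding kernel_corr_def Let_def c_def[symmetric] abs_divide by simp
qed

lemma kernel_corr_sq_le:
  assumes "1 \<le> T"
  shows "(kernel_corr T t x)\<^sup>2 \<le> 2 / (1 + t\<^sup>2)"
proof -
  define m where "m = 1 + t\<^sup>2"
  have m: "0 < m" using one_plus_sq_pos by (simp add: m_def)
  have "\<bar>t * sin (2 * pi * T * (x - t))\<bar> \<le> \<bar>t\<bar>"
    unfolding abs_mult by (intro mult_left_le) auto
  then have "(\<bar>t * sin (2 * pi * T * (x - t))\<bar> + 3) / (pi * m) \<le> (\<bar>t\<bar> + 3) / (pi * m)"
    using m by (intro divide_right_mono) auto
  then have "\<bar>kernel_corr T t x\<bar> \<le> (\<bar>t\<bar> + 3) / (pi * m)"
    using abs_kernel_corr_le[OF assms, of t x] unfolding m_def by linarith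
  then have "(kernel_corr T t x)\<^sup>2 \<le> ((\<bar>t\<bar> + 3) / (pi * m))\<^sup>2"
    by (metis abs_ge_zero power2_abs power_mono)
  also have "\<dots> = (\<bar>t\<bar> + 3)\<^sup>2 / (pi\<^sup>2 * m\<^sup>2)" by (simp add: power_divide power_mult_distrib)
  also have "(\<bar>t\<bar> + 3)\<^sup>2 \<le> 10 * m"
  proof -
    \<comment> \<open>This square is exactly 10 (1 + t^2) - (|t| + 3)^2.\<close>
    have "0 \<le> (3 * \<bar>t\<bar> - 1)\<^sup>2" by simp
    then show ?thesis by (simp add: m_def power2_eq_square algebra_simps)
  qed
  then have "(\<bar>t\<bar> + 3)\<^sup>2 / (pi\<^sup>2 * m\<^sup>2) \<le> 10 * m / (pi\<^sup>2 * m\<^sup>2)"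
    using m by (intro divide_right_mono) auto
  also have "\<dots> = (10 / pi\<^sup>2) / m" using m by (simp add: power2_eq_square)
  also have "10 / pi\<^sup>2 \<le> 2"
  proof -
    have "3 * 3 \<le> pi * pi" using pi_gt3 by (intro mult_mono) auto
    then show ?thesis by (simp add: power2_eq_square field_simps)
  qed
  then have "(10 / pi\<^sup>2) / m \<le> 2 / m" using m by (intro divide_right_mono) auto
  finally show ?thesis by (simp add: m_def)
qed

lemma abs_kern_le:
  assumes "1 \<le> T" shows "\<bar>kern T t x\<bar> \<le> (2 * T + 2) / (1 + x\<^sup>2)"
proof -
  have "(kernel_corr T t x)\<^sup>2 \<le> 2 / 1"
    using kernel_corr_sq_le[OF assms, of t x] by (rule order_trans) (intro divide_left_mono, auto simp: one_plus_sq_pos)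
  also have "\<dots> \<le> 2\<^sup>2" by simp
  finally have "\<bar>kernel_corr T t x\<bar> \<le> 2" by (metis abs_le_square_iff abs_numeral)
  then have "\<bar>sinc_kernel T (x - t) + kernel_corr T t x\<bar> \<le> 2 * T + 2"
    using abs_sinc_kernel_le[of T "x - t"] assms by linarith
  then show ?thesis
    using one_plus_sq_pos[of x] by (simp add: kern_def abs_divide divide_right_mono)
qed

lemma continuous_kern2:
  fixes f g :: "'a::metric_space \<Rightarrow> real"
  assumes "continuous_on S f" "continuous_on S g"
  shows "continuous_on S (\<lambda>p. kern T (f p) (g p))"
proof -
  \<comment> \<open>\<open>T\<close> is arbitrary here, so \<open>sinh (2 * pi * T)\<close> may be
    0. Treated as constants, the quotients carry no side condition for continuity.\<close>
  define a where "a = sinh (2 * pi * T) / cosh (2 * pi * T)"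
  define b where "b = cosh (2 * pi * T) / sinh (2 * pi * T)"
  show ?thesis
    unfolding kern_def kernel_corr_def Let_def a_def[symmetric] b_def[symmetric]
    by (intro continuous_intros assms) auto
qed

section \<open>The weighted Paley-Wiener space\<close>

definition wip :: "(real \<Rightarrow> complex) \<Rightarrow> (real \<Rightarrow> complex) \<Rightarrow> complex" where
  "wip f g = (LINT x|lborel. f x * cnj (g x) * complex_of_real (1 + x\<^sup>2))"

definition kernf :: "real \<Rightarrow> real \<Rightarrow> real \<Rightarrow> complex" where
  "kernf T t x = complex_of_real (kern T t x)"

lemma integrable_inverse_one_plus_sq: "integrable lborel (\<lambda>x::real. 1 / (1 + x\<^sup>2))"
  using integrable_inverse_1_plus_square by (simp add: set_integrable_def inverse_eq_divide)

lemma PW_D: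
  assumes "f \<in> PW T"
  shows "continuous_on UNIV f" "integrable lborel (\<lambda>x. (cmod (f x))\<^sup>2 * (1 + x\<^sup>2))"
    "f \<in> borel_measurable borel" "\<And>t. t \<notin> {-T..T} \<Longrightarrow> fourier f t = 0"
  using assms by (auto simp: PW_def intro: borel_measurable_continuous_onI)

text \<open>Pointwise u <= u^2 m + 1 / m with m = 1 + x^2: the weight is strong enough to pass from
  square integrability to integrability.\<close>

lemma PW_integrable:
  assumes f: "f \<in> PW T" shows "integrable lborel f"
proof (rule Bochner_Integration.integrable_bound)
  show "integrable lborel (\<lambda>x. (cmod (f x))\<^sup>2 * (1 + x\<^sup>2) + 1 / (1 + x\<^sup>2))"
    using PW_D(2)[OF f] integrable_inverse_one_plus_sq by (rule Bochner_Integration.integrable_add)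
  show "f \<in> borel_measurable lborel" using PW_D(3)[OF f] by simp
  have "u \<le> u\<^sup>2 * m + 1 / m" if "0 < m" "0 \<le> u" for u m :: real
  proof -
    have "0 \<le> (u * m - 1)\<^sup>2 / m" using that by simp
    also have "\<dots> = u\<^sup>2 * m + 1 / m - 2 * u"
      using that by (simp add: power2_eq_square field_simps)
    finally show ?thesis using that by linarith
  qed
  then have "cmod (f x) \<le> (cmod (f x))\<^sup>2 * (1 + x\<^sup>2) + 1 / (1 + x\<^sup>2)" for x
    using one_plus_sq_pos by simp
  then show "AE x in lborel. norm (f x) \<le> norm ((cmod (f x))\<^sup>2 * (1 + x\<^sup>2) + 1 / (1 + x\<^sup>2))"
    by (intro AE_I2) (metis abs_ge_self order_trans real_norm_def)
qed

lemma wip_integrable: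
  assumes f: "f \<in> PW T" and g: "g \<in> PW T"
  shows "integrable lborel (\<lambda>x. f x * cnj (g x) * complex_of_real (1 + x\<^sup>2))"
proof (rule Bochner_Integration.integrable_bound)
  note [measurable] = PW_D(3)[OF f] PW_D(3)[OF g]
  show "integrable lborel (\<lambda>x. (cmod (f x))\<^sup>2 * (1 + x\<^sup>2) + (cmod (g x))\<^sup>2 * (1 + x\<^sup>2))"
    using PW_D(2)[OF f] PW_D(2)[OF g] by (rule Bochner_Integration.integrable_add)
  have "continuous_on UNIV (\<lambda>x. f x * cnj (g x) * complex_of_real (1 + x\<^sup>2))"
    using PW_D(1)[OF f] PW_D(1)[OF g] by (intro continuous_intros)
  then show "(\<lambda>x. f x * cnj (g x) * complex_of_real (1 + x\<^sup>2)) \<in> borel_measurable lborel"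
    using borel_measurable_continuous_onI by simp
  have "u * v \<le> u\<^sup>2 + v\<^sup>2" for u v :: real
    using sum_squares_bound[of u v] sum_power2_ge_zero[of u v] unfolding mult.assoc by linarith
  then have "cmod (f x) * cmod (g x) * (1 + x\<^sup>2) \<le> ((cmod (f x))\<^sup>2 + (cmod (g x))\<^sup>2) * (1 + x\<^sup>2)" for x
    using one_plus_sq_pos[of x] by (intro mult_right_mono) auto
  moreover have "norm (f x * cnj (g x) * complex_of_real (1 + x\<^sup>2)) = cmod (f x) * cmod (g x) * (1 + x\<^sup>2)" for x
    using one_plus_sq_pos[of x] unfolding norm_mult norm_of_real by simp
  moreover have "0 \<le> ((cmod (f x))\<^sup>2 + (cmod (g x))\<^sup>2) * (1 + x\<^sup>2)" for x
    using one_plus_sq_pos[of x] by simp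
  ultimately show "AE x in lborel. norm (f x * cnj (g x) * complex_of_real (1 + x\<^sup>2))
      \<le> norm ((cmod (f x))\<^sup>2 * (1 + x\<^sup>2) + (cmod (g x))\<^sup>2 * (1 + x\<^sup>2))"
    by (intro AE_I2) (simp add: distrib_right)
qed

lemma fourier_add:
  assumes "integrable lborel f" "integrable lborel g"
  shows "fourier (f + g) t = fourier f t + fourier g t"
  using integrable_mult_cis[OF assms(1), of "- (2 * pi * t)"] integrable_mult_cis[OF assms(2), of "- (2 * pi * t)"]
  by (simp add: fourier_cis distrib_right)

lemma fourier_scale: "fourier (\<lambda>x. c * f x) t = c * fourier f t"
  by (simp add: fourier_cis mult.assoc)

lemma PW_add:
  assumes f: "f \<in> PW T" and g: "g \<in> PW T" shows "f + g \<in> PW T"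
proof -
  note [measurable] = PW_D(3)[OF f] PW_D(3)[OF g]
  have "integrable lborel (\<lambda>x. (cmod ((f + g) x))\<^sup>2 * (1 + x\<^sup>2))"
  proof (rule Bochner_Integration.integrable_bound)
    show "integrable lborel (\<lambda>x. 2 * ((cmod (f x))\<^sup>2 * (1 + x\<^sup>2)) + 2 * ((cmod (g x))\<^sup>2 * (1 + x\<^sup>2)))"
      using PW_D(2)[OF f] PW_D(2)[OF g] by (intro Bochner_Integration.integrable_add integrable_mult_right)
    have "(cmod ((f + g) x))\<^sup>2 * (1 + x\<^sup>2) \<le> 2 * ((cmod (f x))\<^sup>2 * (1 + x\<^sup>2)) + 2 * ((cmod (g x))\<^sup>2 * (1 + x\<^sup>2))" for x
    proof -
      have "(cmod (f x + g x))\<^sup>2 \<le> (cmod (f x) + cmod (g x))\<^sup>2"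
        by (intro power_mono norm_triangle_ineq) auto
      also have "\<dots> \<le> 2 * (cmod (f x))\<^sup>2 + 2 * (cmod (g x))\<^sup>2"
        using sum_squares_bound[of "cmod (f x)" "cmod (g x)"] by (simp add: power2_sum)
      finally have "(cmod (f x + g x))\<^sup>2 * (1 + x\<^sup>2) \<le> (2 * (cmod (f x))\<^sup>2 + 2 * (cmod (g x))\<^sup>2) * (1 + x\<^sup>2)"
        using one_plus_sq_pos[of x] by (intro mult_right_mono) auto
      then show ?thesis by (simp add: algebra_simps)
    qed
    then show "AE x in lborel. norm ((cmod ((f + g) x))\<^sup>2 * (1 + x\<^sup>2))
        \<le> norm (2 * ((cmod (f x))\<^sup>2 * (1 + x\<^sup>2)) + 2 * ((cmod (g x))\<^sup>2 * (1 + x\<^sup>2)))"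
      using one_plus_sq_pos by (intro AE_I2) (simp add: abs_mult)
  qed (simp add: plus_fun_def)
  moreover have "continuous_on UNIV (f + g)"
    using PW_D(1)[OF f] PW_D(1)[OF g] unfolding plus_fun_def by (intro continuous_intros)
  moreover have "{t. fourier (f + g) t \<noteq> 0} \<subseteq> {-T..T}"
    using PW_D(4)[OF f] PW_D(4)[OF g] fourier_add[OF PW_integrable[OF f] PW_integrable[OF g]] by fastforce
  ultimately show ?thesis by (simp add: PW_def)
qed

lemma PW_scale:
  assumes f: "f \<in> PW T" shows "(\<lambda>x. c * f x) \<in> PW T"
proof -
  have "integrable lborel (\<lambda>x. (cmod c)\<^sup>2 * ((cmod (f x))\<^sup>2 * (1 + x\<^sup>2)))"
    using PW_D(2)[OF f] by (rule integrable_mult_right)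
  moreover have "continuous_on UNIV (\<lambda>x. c * f x)"
    using PW_D(1)[OF f] by (intro continuous_intros)
  moreover have "{t. fourier (\<lambda>x. c * f x) t \<noteq> 0} \<subseteq> {-T..T}"
    using PW_D(4)[OF f] unfolding fourier_scale
    by (metis (mono_tags, lifting) mem_Collect_eq mult_zero_right subsetI)
  ultimately show ?thesis by (simp add: PW_def norm_mult power_mult_distrib mult.assoc)
qed

lemma PW_0: "0 \<in> PW T"
  by (simp add: PW_def fourier_def)

text \<open>The definition of the space admits the closed interval as support; continuity of the
  transform excludes the end points. This is the Dirichlet condition of the boundary value
  problem.\<close>

lemma PW_fourier_boundary:
  assumes f: "f \<in> PW T" and T: "0 < T"
  shows "fourier f T = 0" "fourier f (- T) = 0"
proof -
  have cont: "isCont (fourier f) t" for t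
    using continuous_fourier[OF PW_integrable[OF f]] by (simp add: continuous_on_eq_continuous_at)
  have "(\<lambda>n. fourier f (T + 1 / real (Suc n))) \<longlonglongrightarrow> fourier f (T + 0)"
    by (intro isCont_tendsto_compose[OF cont] tendsto_intros LIMSEQ_Suc[OF lim_1_over_n])
  moreover have "fourier f (T + 1 / real (Suc n)) = 0" for n
    by (rule PW_D(4)[OF f]) simp
  ultimately show "fourier f T = 0" using LIMSEQ_unique[OF _ tendsto_const] by force
  have "(\<lambda>n. fourier f (- T - 1 / real (Suc n))) \<longlonglongrightarrow> fourier f (- T - 0)"
    by (intro isCont_tendsto_compose[OF cont] tendsto_intros LIMSEQ_Suc[OF lim_1_over_n])
  moreover have "fourier f (- T - 1 / real (Suc n)) = 0" for n
    by (rule PW_D(4)[OF f]) (simp add: not_le)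
  ultimately show "fourier f (- T) = 0" using LIMSEQ_unique[OF _ tendsto_const] by force
qed

lemma PW_fourier_indicator:
  assumes f: "f \<in> PW T"
  shows "fourier f s = indicator {-T..T} s *\<^sub>R fourier f s"
  using PW_D(4)[OF f] by (auto simp: indicator_def)

lemma PW_fourier_integrable:
  assumes f: "f \<in> PW T"
  shows "integrable lborel (fourier f)"
  using borel_integrable_compact[OF compact_Icc continuous_on_subset[OF continuous_fourier[OF PW_integrable[OF f]]], of "- T" T]
  by (simp flip: PW_fourier_indicator[OF f])

section \<open>Membership of the kernel in the space and the reproducing property\<close>

lemma continuous_kern: "continuous_on UNIV (kern T t)"
  using continuous_kern2[of UNIV "\<lambda>_. t" "\<lambda>x. x" T] by (simp add: continuous_on_const)

lemma borel_measurable_kern2 [measurable]: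
  "(\<lambda>p. kern T (fst p) (snd p)) \<in> borel_measurable (borel \<Otimes>\<^sub>M borel)"
  unfolding borel_prod by (intro borel_measurable_continuous_onI continuous_kern2 continuous_intros)

lemma borel_measurable_kern [measurable]: "kern T t \<in> borel_measurable borel"
  using continuous_kern by (rule borel_measurable_continuous_onI)

lemma abs_kern_le':
  assumes "1 \<le> T" shows "\<bar>kern T t x\<bar> \<le> 2 * T + 2"
proof -
  have "(2 * T + 2) / (1 + x\<^sup>2) \<le> (2 * T + 2) / 1"
    using assms one_plus_sq_pos[of x] by (intro divide_left_mono) auto
  then show ?thesis using abs_kern_le[OF assms, of t x] by simp
qed

lemma integrable_kern:
  assumes "1 \<le> T" shows "integrable lborel (kern T t)"
proof (rule Bochner_Integration.integrable_bound)
  show "integrable lborel (\<lambda>x. (2 * T + 2) * (1 / (1 + x\<^sup>2)))"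
    using integrable_inverse_one_plus_sq by (rule integrable_mult_right)
  show "AE x in lborel. norm (kern T t x) \<le> norm ((2 * T + 2) * (1 / (1 + x\<^sup>2)))"
  proof (rule AE_I2)
    fix x
    have "norm (kern T t x) \<le> (2 * T + 2) * (1 / (1 + x\<^sup>2))" using abs_kern_le[OF assms, of t x] by simp
    then show "norm (kern T t x) \<le> norm ((2 * T + 2) * (1 / (1 + x\<^sup>2)))"
      unfolding real_norm_def by linarith
  qed
qed simp

lemma decay_sq_integrable:
  fixes f :: "real \<Rightarrow> complex"
  assumes [measurable]: "f \<in> borel_measurable borel" and le: "\<And>x. cmod (f x) \<le> C / (1 + x\<^sup>2)"
  shows "integrable lborel (\<lambda>x. (cmod (f x))\<^sup>2 * (1 + x\<^sup>2))"
proof (rule Bochner_Integration.integrable_bound)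
  show "integrable lborel (\<lambda>x. C\<^sup>2 * (1 / (1 + x\<^sup>2)))"
    using integrable_inverse_one_plus_sq by (rule integrable_mult_right)
  have "(cmod (f x))\<^sup>2 * (1 + x\<^sup>2) \<le> C\<^sup>2 * (1 / (1 + x\<^sup>2))" for x
  proof -
    have "(cmod (f x))\<^sup>2 \<le> (C / (1 + x\<^sup>2))\<^sup>2" using le[of x] by (intro power_mono) auto
    then have "(cmod (f x))\<^sup>2 * (1 + x\<^sup>2) \<le> (C / (1 + x\<^sup>2))\<^sup>2 * (1 + x\<^sup>2)"
      using one_plus_sq_pos[of x] by (intro mult_right_mono) auto
    also have "\<dots> = C\<^sup>2 * (1 / (1 + x\<^sup>2))" by (simp add: power2_eq_square[of "C / _"] power2_eq_square[of C])
    finally show ?thesis .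
  qed
  then show "AE x in lborel. norm ((cmod (f x))\<^sup>2 * (1 + x\<^sup>2)) \<le> norm (C\<^sup>2 * (1 / (1 + x\<^sup>2)))"
    using one_plus_sq_pos by (intro AE_I2) (simp add: abs_mult)
qed measurable

text \<open>Inversion is applied to \<open>kernhat\<close>, not to \<open>kern\<close>: the
  transform of \<open>kernhat\<close> is the reflected kernel, integrable by its decay 1 / (1 +
  x^2), and the reflection x -> -x turns the inversion integral into the transform of
  \<open>kernf\<close>.\<close>

lemma fourier_kernf:
  assumes "1 \<le> T" shows "fourier (kernf T t) s = kernhat T t s"
proof -
  have T: "0 < T" using assms by simp
  have fh: "fourier (kernhat T t) x = complex_of_real (kern T t (- x))" for x
    using integral_kernhat[OF T, of t "- x"] by (simp add: fourier_cis)
  have "integrable lborel (\<lambda>x. complex_of_real (kern T t (0 + (- 1) * x)))"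
    using integrable_kern[OF assms, of t] by (intro integrable_of_real lborel_integrable_real_affine) auto
  then have int: "integrable lborel (fourier (kernhat T t))" by (simp add: fh[abs_def])
  have "kernhat T t s = (LINT x|lborel. fourier (kernhat T t) x * cis (2 * pi * s * x))"
    by (rule fourier_inversion[OF continuous_kernhat[OF T] integrable_kernhat[OF T] int])
  also have "\<dots> = \<bar>- 1\<bar> *\<^sub>R (LINT x|lborel. fourier (kernhat T t) (0 + (- 1) * x) * cis (2 * pi * s * (0 + (- 1) * x)))"
    by (rule lborel_integral_real_affine) simp
  also have "\<dots> = fourier (kernf T t) s"
    unfolding fh by (simp add: fourier_cis kernf_def)
  finally show ?thesis by simp
qed

lemma kernf_PW:
  assumes "1 \<le> T" shows "kernf T t \<in> PW T"
proof -
  have c: "continuous_on UNIV (kernf T t)"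
    unfolding kernf_def using continuous_kern by (intro continuous_intros)
  have "integrable lborel (\<lambda>x. (cmod (kernf T t x))\<^sup>2 * (1 + x\<^sup>2))"
    using abs_kern_le[OF assms] borel_measurable_continuous_onI[OF c]
    by (intro decay_sq_integrable[where C = "2 * T + 2"]) (simp_all add: kernf_def)
  moreover have "{s. fourier (kernf T t) s \<noteq> 0} \<subseteq> {-T..T}"
  proof
    fix s assume "s \<in> {s. fourier (kernf T t) s \<noteq> 0}"
    then have "s \<in> {-T<..<T}" using kernhat_outside[of T s t] assms by (auto simp: fourier_kernf)
    then show "s \<in> {-T..T}" by simp
  qed
  ultimately show ?thesis using c by (simp add: PW_def)
qed

text \<open>The sinc kernel is the integral of cis over the band. After Fubini this integral
  truncates \<open>fourier f\<close> to a set outside which it already vanishes, so inversion gives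
  back \<open>f t\<close>.\<close>

lemma PW_sinc_integral:
  assumes f: "f \<in> PW T" and T: "0 < T"
  shows "(LINT x|lborel. f x * complex_of_real (sinc_kernel T (x - t))) = f t"
proof -
  note [measurable] = PW_D(3)[OF f]
  have int: "integrable (lborel \<Otimes>\<^sub>M lborel)
      (\<lambda>(x, s). f x * (indicator {-T..T} s *\<^sub>R cis (2 * pi * (t - x) * s)))"
  proof (rule integrable_lborel_prod_bound[where g = "\<lambda>x. norm (f x)" and h = "indicator {-T..T}"])
    show "integrable lborel (\<lambda>x. norm (f x))" using PW_integrable[OF f] by simp
    show "integrable lborel (indicator {-T..T} :: real \<Rightarrow> real)" by (rule integrable_real_indicator) (auto simp: emeasure_lborel_Icc_eq)
  qed (auto simp: norm_mult)
  have "(LINT x|lborel. f x * complex_of_real (sinc_kernel T (x - t)))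
     = (LINT x|lborel. LINT s|lborel. f x * (indicator {-T..T} s *\<^sub>R cis (2 * pi * (t - x) * s)))"
  proof (intro Bochner_Integration.integral_cong refl)
    fix x
    show "f x * complex_of_real (sinc_kernel T (x - t))
       = (LINT s|lborel. f x * (indicator {-T..T} s *\<^sub>R cis (2 * pi * (t - x) * s)))"
      unfolding integral_mult_right_zero integral_cis[OF T] using sinc_kernel_minus[of T "x - t"] by simp
  qed
  also have "\<dots> = (LINT s|lborel. LINT x|lborel. f x * (indicator {-T..T} s *\<^sub>R cis (2 * pi * (t - x) * s)))"
    using int by (rule lborel_pair.Fubini_integral[symmetric])
  also have "\<dots> = (LINT s|lborel. fourier f s * cis (2 * pi * t * s))"
  proof (intro Bochner_Integration.integral_cong refl)
    fix s
    have "(LINT x|lborel. f x * (indicator {-T..T} s *\<^sub>R cis (2 * pi * (t - x) * s)))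
       = (LINT x|lborel. (f x * cis (- (2 * pi * s * x))) * (of_real (indicator {-T..T} s) * cis (2 * pi * t * s)))"
    proof (intro Bochner_Integration.integral_cong refl)
      fix x
      have "cis (2 * pi * (t - x) * s) = cis (- (2 * pi * s * x)) * cis (2 * pi * t * s)"
        by (simp add: cis_mult algebra_simps)
      then show "f x * (indicator {-T..T} s *\<^sub>R cis (2 * pi * (t - x) * s))
          = (f x * cis (- (2 * pi * s * x))) * (of_real (indicator {-T..T} s) * cis (2 * pi * t * s))"
        by (simp only: scaleR_conv_of_real ac_simps)
    qed
    also have "\<dots> = fourier f s * (of_real (indicator {-T..T} s) * cis (2 * pi * t * s))"
      unfolding fourier_cis by (rule integral_mult_left_zero)
    also have "\<dots> = fourier f s * cis (2 * pi * t * s)"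
      using PW_D(4)[OF f, of s] by (auto simp: indicator_def)
    finally show "(LINT x|lborel. f x * (indicator {-T..T} s *\<^sub>R cis (2 * pi * (t - x) * s)))
       = fourier f s * cis (2 * pi * t * s)" .
  qed
  also have "\<dots> = f t"
    using fourier_inversion[OF PW_D(1)[OF f] PW_integrable[OF f] PW_fourier_integrable[OF f]] by simp
  finally show ?thesis .
qed

text \<open>Both integrals are combinations of the transform of \<open>f\<close> at T and -T, which
  is 0 there.\<close>

lemma PW_trig_integral:
  assumes f: "f \<in> PW T" and T: "0 < T"
  shows "integrable lborel (\<lambda>x. f x * complex_of_real (cos (2 * pi * T * x)))"
    "(LINT x|lborel. f x * complex_of_real (cos (2 * pi * T * x))) = 0"
    "integrable lborel (\<lambda>x. f x * complex_of_real (sin (2 * pi * T * x)))"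
    "(LINT x|lborel. f x * complex_of_real (sin (2 * pi * T * x))) = 0"
proof -
  define P where "P x = f x * cis ((2 * pi * T) * x)" for x
  define Q where "Q x = f x * cis ((- (2 * pi * T)) * x)" for x
  have int: "integrable lborel P" "integrable lborel Q"
    unfolding P_def Q_def by (intro integrable_mult_cis PW_integrable[OF f])+
  have z: "(LINT x|lborel. P x) = 0" "(LINT x|lborel. Q x) = 0"
    using PW_fourier_boundary[OF f T] by (simp_all add: fourier_cis P_def Q_def)
  have c: "(\<lambda>x. f x * complex_of_real (cos (2 * pi * T * x))) = (\<lambda>x. (1 / 2) * (P x + Q x))"
  proof
    fix x
    have "cis ((2 * pi * T) * x) + cis ((- (2 * pi * T)) * x) = 2 * of_real (cos (2 * pi * T * x))"
      by (simp add: complex_eq_iff)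
    then show "f x * complex_of_real (cos (2 * pi * T * x)) = (1 / 2) * (P x + Q x)"
      unfolding P_def Q_def distrib_left[symmetric] by simp
  qed
  have s: "(\<lambda>x. f x * complex_of_real (sin (2 * pi * T * x))) = (\<lambda>x. (- \<i> / 2) * (P x - Q x))"
  proof
    fix x
    have "cis ((2 * pi * T) * x) - cis ((- (2 * pi * T)) * x) = 2 * \<i> * of_real (sin (2 * pi * T * x))"
      by (simp add: complex_eq_iff)
    then show "f x * complex_of_real (sin (2 * pi * T * x)) = (- \<i> / 2) * (P x - Q x)"
      unfolding P_def Q_def right_diff_distrib[symmetric] by (simp add: complex_eq_iff)
  qed
  show "integrable lborel (\<lambda>x. f x * complex_of_real (cos (2 * pi * T * x)))"
    unfolding c using int by (intro integrable_mult_right Bochner_Integration.integrable_add)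
  show "integrable lborel (\<lambda>x. f x * complex_of_real (sin (2 * pi * T * x)))"
    unfolding s using int by (intro integrable_mult_right Bochner_Integration.integrable_diff)
  show "(LINT x|lborel. f x * complex_of_real (cos (2 * pi * T * x))) = 0"
    unfolding c using int z by (simp add: Bochner_Integration.integral_add)
  show "(LINT x|lborel. f x * complex_of_real (sin (2 * pi * T * x))) = 0"
    unfolding s using int z by (simp add: Bochner_Integration.integral_diff)
qed

text \<open>Multiplying the kernel by the weight leaves the kernel of the unweighted space plus frequencies
  at the boundary of the band, to which the functions of the space are orthogonal.\<close>

lemma reproducing:
  assumes f: "f \<in> PW T" and T: "1 \<le> T"
  shows "wip f (kernf T t) = f t"
proof -
  have T0: "0 < T" using T by simp
  define c where "c = 2 * pi * T"
  define m where "m = pi * (1 + t\<^sup>2)"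
  define a where "a = complex_of_real ((- t * sin (c * t) - sinh c / cosh c * cos (c * t)) / m)"
  define b where "b = complex_of_real ((t * cos (c * t) - cosh c / sinh c * sin (c * t)) / m)"
  define F where "F x = f x * complex_of_real (cos (2 * pi * T * x))" for x
  define G where "G x = f x * complex_of_real (sin (2 * pi * T * x))" for x
  define S where "S x = f x * complex_of_real (sinc_kernel T (x - t))" for x
  \<comment> \<open>The addition formula separates \<open>t\<close> from \<open>x\<close>, so that
    the correction integrates to 0 against \<open>f\<close> by
    \<open>PW_trig_integral\<close>.\<close>
  have corr: "complex_of_real (kernel_corr T t x) = a * of_real (cos (2 * pi * T * x)) + b * of_real (sin (2 * pi * T * x))" for x
  proof -
    have "sin (c * (x - t)) = sin (c * x) * cos (c * t) - cos (c * x) * sin (c * t)"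
      by (simp add: right_diff_distrib sin_diff)
    then have "kernel_corr T t x = ((- t * sin (c * t) - sinh c / cosh c * cos (c * t)) * cos (c * x)
       + (t * cos (c * t) - cosh c / sinh c * sin (c * t)) * sin (c * x)) / m"
      unfolding kernel_corr_def Let_def c_def[symmetric] m_def[symmetric]
      by (simp only:) (simp add: algebra_simps)
    also have "\<dots> = (- t * sin (c * t) - sinh c / cosh c * cos (c * t)) / m * cos (c * x)
       + (t * cos (c * t) - cosh c / sinh c * sin (c * t)) / m * sin (c * x)"
      by (simp only: add_divide_distrib times_divide_eq_left)
    finally show ?thesis by (simp only: a_def b_def c_def of_real_add of_real_mult)
  qed
  have [measurable]: "S \<in> borel_measurable borel"
    unfolding S_def using PW_D(1)[OF f] by (intro borel_measurable_continuous_onI continuous_intros)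
  have Sint: "integrable lborel S"
  proof (rule Bochner_Integration.integrable_bound)
    show "integrable lborel (\<lambda>x. f x * of_real (2 * T))" using PW_integrable[OF f] by simp
    show "AE x in lborel. norm (S x) \<le> norm (f x * of_real (2 * T))"
      using abs_sinc_kernel_le[OF T0] T0 unfolding S_def norm_mult norm_of_real
      by (intro AE_I2 mult_left_mono) auto
  qed simp
  have "wip f (kernf T t) = (LINT x|lborel. S x + (a * F x + b * G x))"
    unfolding wip_def
  proof (intro Bochner_Integration.integral_cong refl)
    fix x
    have "complex_of_real (kern T t x) * of_real (1 + x\<^sup>2) = of_real (sinc_kernel T (x - t)) + of_real (kernel_corr T t x)"
      unfolding of_real_mult[symmetric] of_real_add[symmetric] of_real_eq_iff by (simp add: kern_def)
    then have "f x * cnj (kernf T t x) * of_real (1 + x\<^sup>2)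
       = f x * (of_real (sinc_kernel T (x - t)) + of_real (kernel_corr T t x))"
      by (simp add: kernf_def mult.assoc del: of_real_add of_real_power)
    then show "f x * cnj (kernf T t x) * of_real (1 + x\<^sup>2) = S x + (a * F x + b * G x)"
      unfolding corr S_def F_def G_def by (simp add: algebra_simps)
  qed
  also have "\<dots> = (LINT x|lborel. S x) + (a * (LINT x|lborel. F x) + b * (LINT x|lborel. G x))"
    using Sint PW_trig_integral(1,3)[OF f T0] unfolding F_def[symmetric] G_def[symmetric] by simp
  also have "\<dots> = f t"
    using PW_sinc_integral[OF f T0, of t] PW_trig_integral(2,4)[OF f T0]
    unfolding F_def[symmetric] G_def[symmetric] S_def[symmetric] by simp
  finally show ?thesis .
qed

lemma wip_self:
  assumes f: "f \<in> PW T"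
  shows "wip f f = complex_of_real (LINT x|lborel. (cmod (f x))\<^sup>2 * (1 + x\<^sup>2))"
proof -
  have "wip f f = (LINT x|lborel. complex_of_real ((cmod (f x))\<^sup>2 * (1 + x\<^sup>2)))"
    unfolding wip_def
    by (intro Bochner_Integration.integral_cong refl) (simp only: complex_norm_square of_real_mult)
  then show ?thesis by (simp only: integral_complex_of_real)
qed

lemma wip_psd_form: "psd_form (\<lambda>c f x. c * f x) (PW T) wip"
proof (intro psd_form.intro psd_form_axioms.intro)
  show "vector_space (\<lambda>(c::complex) (f::real \<Rightarrow> complex) x. c * f x)"
    by (rule cfun.vector_space_axioms)
  show "module.subspace (\<lambda>c (f::real \<Rightarrow> complex) x. c * f x) (PW T)"
    unfolding cfun.subspace_def using PW_0 PW_add PW_scale by auto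
next
  fix f g h assume fgh: "f \<in> PW T" "g \<in> PW T" "h \<in> PW T"
  show "wip (f + g) h = wip f h + wip g h"
    using wip_integrable[OF fgh(1,3)] wip_integrable[OF fgh(2,3)]
    unfolding wip_def plus_fun_def distrib_right by (rule Bochner_Integration.integral_add)
next
  fix f g c assume "f \<in> PW T" "g \<in> PW T"
  show "wip (\<lambda>x. c * f x) g = c * wip f g"
    unfolding wip_def mult.assoc by (rule integral_mult_right_zero)
  show "wip g f = cnj (wip f g)"
  proof -
    have "cnj (wip f g) = (LINT x|lborel. cnj (f x * cnj (g x) * complex_of_real (1 + x\<^sup>2)))"
      unfolding wip_def by (rule Bochner_Integration.integral_cnj[symmetric])
    also have "\<dots> = wip g f"
      unfolding wip_def by (intro Bochner_Integration.integral_cong refl) simp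
    finally show ?thesis by simp
  qed
next
  fix f assume "f \<in> PW T"
  then show "0 \<le> Re (wip f f)"
    using one_plus_sq_pos less_imp_le by (auto simp: wip_self intro!: integral_nonneg mult_nonneg_nonneg)
qed

section \<open>The concentration operator\<close>

interpretation wip: psd_form "\<lambda>(c::complex) (f::real \<Rightarrow> complex) x. c * f x" "PW T" wip for T
  by (rule wip_psd_form)

lemma sqn_wip: "f \<in> PW T \<Longrightarrow> wip.sqn f = (LINT x|lborel. (cmod (f x))\<^sup>2 * (1 + x\<^sup>2))"
  by (simp add: wip.sqn_def wip_self)

lemma kernf_sym: "1 \<le> T \<Longrightarrow> kernf T t x = kernf T x t"
  using kern_sym[of T t x] by (simp add: kernf_def)

lemma reproducing_kernel_at_iff:
  "reproducing_kernel_at T t L \<longleftrightarrow> L \<in> PW T \<and> (\<forall>f\<in>PW T. f t = wip f L)"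
  by (simp add: reproducing_kernel_at_def wip_def)

text \<open>Uniqueness: if \<open>L\<close> reproduces at t, then L(s) = <L, k_s> is the conjugate
  of <k_s, L> = k_s(t), and the kernel is real and symmetric.\<close>

lemma repr_kernel_eq:
  assumes T: "1 \<le> T" shows "repr_kernel T t = kernf T t"
  unfolding repr_kernel_def
proof (rule the_equality)
  show "reproducing_kernel_at T t (kernf T t)"
    using kernf_PW[OF T] reproducing[OF _ T] by (simp add: reproducing_kernel_at_iff)
next
  fix L assume L: "reproducing_kernel_at T t L"
  show "L = kernf T t"
  proof
    fix s
    have "L s = wip L (kernf T s)" using reproducing[OF _ T] L by (simp add: reproducing_kernel_at_iff)
    also have "\<dots> = cnj (wip (kernf T s) L)"
      using L kernf_PW[OF T, of s] by (intro wip.ip_commute[of _ T]) (auto simp: reproducing_kernel_at_iff)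
    also have "wip (kernf T s) L = kernf T s t"
      using L kernf_PW[OF T, of s] by (simp add: reproducing_kernel_at_iff)
    finally show "L s = kernf T t s" using kernf_sym[OF T, of t s] by (simp add: kernf_def)
  qed
qed

lemma borel_measurable_kernf_raw [measurable (raw)]:
  assumes "f \<in> borel_measurable M" "g \<in> borel_measurable M"
  shows "(\<lambda>x. kernf T (f x) (g x)) \<in> borel_measurable M"
proof -
  have "(\<lambda>x. (f x, g x)) \<in> M \<rightarrow>\<^sub>M borel \<Otimes>\<^sub>M borel" using assms by measurable
  from measurable_compose[OF this borel_measurable_kern2[of T]]
  show ?thesis unfolding kernf_def by simp
qed

lemma kernf_le:
  assumes "1 \<le> T" shows "cmod (kernf T x t) \<le> (2 * T + 2) / (1 + t\<^sup>2)" "cmod (kernf T x t) \<le> 2 * T + 2"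
  using abs_kern_le[OF assms, of x t] abs_kern_le'[OF assms, of x t] by (simp_all add: kernf_def)

text \<open>The superposition of kernels with an L^1 density. The density need not come from the
  space, which matters in \<open>W_compact\<close>, where it is built from a uniform limit on the
  interval alone.\<close>

definition kap :: "real \<Rightarrow> (real \<Rightarrow> complex) \<Rightarrow> real \<Rightarrow> complex" where
  "kap T \<phi> t = (LINT x|lborel. \<phi> x * kernf T x t)"

lemma kap_integrable:
  assumes T: "1 \<le> T" and \<phi>: "integrable lborel \<phi>"
  shows "integrable lborel (\<lambda>x. \<phi> x * kernf T x t)"
proof (rule Bochner_Integration.integrable_bound)
  show "integrable lborel (\<lambda>x. \<phi> x * of_real (2 * T + 2))" using \<phi> by simp
  have [measurable]: "\<phi> \<in> borel_measurable borel" using borel_measurable_integrable[OF \<phi>] by simp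
  show "(\<lambda>x. \<phi> x * kernf T x t) \<in> borel_measurable lborel" by measurable
  have "norm (complex_of_real (2 * T + 2)) = 2 * T + 2" using T unfolding norm_of_real by simp
  then show "AE x in lborel. norm (\<phi> x * kernf T x t) \<le> norm (\<phi> x * of_real (2 * T + 2))"
    using kernf_le(2)[OF T, of _ t] unfolding norm_mult by (intro AE_I2 mult_left_mono) auto
qed

lemma kap_add:
  assumes "1 \<le> T" "integrable lborel \<phi>" "integrable lborel \<psi>"
  shows "kap T (\<lambda>x. \<phi> x + \<psi> x) = kap T \<phi> + kap T \<psi>"
  using kap_integrable[OF assms(1,2)] kap_integrable[OF assms(1,3)]
  by (auto simp: kap_def distrib_right fun_eq_iff)

lemma kap_scale: "kap T (\<lambda>x. c * \<phi> x) = (\<lambda>t. c * kap T \<phi> t)"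
  by (simp add: kap_def[abs_def] mult.assoc)

lemma kap_le:
  assumes T: "1 \<le> T" and \<phi>: "integrable lborel \<phi>"
  shows "cmod (kap T \<phi> t) \<le> (LINT x|lborel. cmod (\<phi> x)) * (2 * T + 2) / (1 + t\<^sup>2)"
proof -
  have "cmod (kap T \<phi> t) \<le> (LINT x|lborel. cmod (\<phi> x * kernf T x t))"
    unfolding kap_def by (rule integral_norm_bound)
  also have "\<dots> \<le> (LINT x|lborel. cmod (\<phi> x) * ((2 * T + 2) / (1 + t\<^sup>2)))"
    using kap_integrable[OF T \<phi>, of t] \<phi> mult_left_mono[OF kernf_le(1)[OF T, of _ t] norm_ge_zero]
    by (intro integral_mono integrable_norm integrable_mult_left) (simp_all add: norm_mult)
  also have "\<dots> = (LINT x|lborel. cmod (\<phi> x)) * ((2 * T + 2) / (1 + t\<^sup>2))"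
    by (rule integral_mult_left_zero)
  finally show ?thesis by simp
qed

lemma continuous_kap:
  assumes T: "1 \<le> T" and \<phi>: "integrable lborel \<phi>"
  shows "continuous_on UNIV (kap T \<phi>)"
proof -
  have [measurable]: "\<phi> \<in> borel_measurable borel" using borel_measurable_integrable[OF \<phi>] by simp
  have "isCont (kap T \<phi>) t" for t
  proof (rule continuous_at_sequentiallyI)
    fix u :: "nat \<Rightarrow> real" assume u: "u \<longlonglongrightarrow> t"
    show "(\<lambda>n. kap T \<phi> (u n)) \<longlonglongrightarrow> kap T \<phi> t"
      unfolding kap_def
    proof (rule integral_dominated_convergence[where w = "\<lambda>x. norm (\<phi> x) * (2 * T + 2)"])
      show "AE x in lborel. (\<lambda>n. \<phi> x * kernf T x (u n)) \<longlonglongrightarrow> \<phi> x * kernf T x t"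
        using continuous_on_tendsto_compose[OF continuous_kern u]
        by (intro AE_I2 tendsto_intros) (simp add: kernf_def tendsto_of_real)
      show "AE x in lborel. norm (\<phi> x * kernf T x (u n)) \<le> norm (\<phi> x) * (2 * T + 2)" for n
        using kernf_le(2)[OF T, of _ "u n"] by (intro AE_I2) (auto simp: norm_mult intro!: mult_left_mono)
    qed (use \<phi> in auto)
  qed
  then show ?thesis by (simp add: continuous_at_imp_continuous_on)
qed

lemma fourier_kap:
  assumes T: "1 \<le> T" and \<phi>: "integrable lborel \<phi>"
  shows "fourier (kap T \<phi>) s = (LINT x|lborel. \<phi> x * kernhat T x s)"
proof -
  have [measurable]: "\<phi> \<in> borel_measurable borel" using borel_measurable_integrable[OF \<phi>] by simp
  have int: "integrable (lborel \<Otimes>\<^sub>M lborel) (\<lambda>(x, t). \<phi> x * kernf T x t * cis (- (2 * pi * s * t)))"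
  proof (rule integrable_lborel_prod_bound[where g = "\<lambda>x. norm (\<phi> x)" and h = "\<lambda>t. (2 * T + 2) * (1 / (1 + t\<^sup>2))"])
    show "integrable lborel (\<lambda>t. (2 * T + 2) * (1 / (1 + t\<^sup>2)))"
      using integrable_inverse_one_plus_sq by (rule integrable_mult_right)
    show "norm (case (x, t) of (x, t) \<Rightarrow> \<phi> x * kernf T x t * cis (- (2 * pi * s * t)))
        \<le> norm (\<phi> x) * ((2 * T + 2) * (1 / (1 + t\<^sup>2)))" for x t
      using mult_left_mono[OF kernf_le(1)[OF T, of x t] norm_ge_zero[of "\<phi> x"]] by (simp add: norm_mult)
  qed (use \<phi> in auto)
  have "fourier (kap T \<phi>) s = (LINT t|lborel. LINT x|lborel. \<phi> x * kernf T x t * cis (- (2 * pi * s * t)))"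
    by (simp add: fourier_cis kap_def)
  also have "\<dots> = (LINT x|lborel. LINT t|lborel. \<phi> x * kernf T x t * cis (- (2 * pi * s * t)))"
    using int by (rule lborel_pair.Fubini_integral)
  also have "\<dots> = (LINT x|lborel. \<phi> x * fourier (kernf T x) s)"
    unfolding fourier_cis mult.assoc by simp
  finally show ?thesis by (simp add: fourier_kernf[OF T])
qed

lemma kap_PW:
  assumes T: "1 \<le> T" and \<phi>: "integrable lborel \<phi>"
  shows "kap T \<phi> \<in> PW T"
proof -
  have c: "continuous_on UNIV (kap T \<phi>)" by (rule continuous_kap[OF assms])
  have "integrable lborel (\<lambda>x. (cmod (kap T \<phi> x))\<^sup>2 * (1 + x\<^sup>2))"
    using borel_measurable_continuous_onI[OF c] kap_le[OF assms] by (rule decay_sq_integrable)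
  moreover have "{s. fourier (kap T \<phi>) s \<noteq> 0} \<subseteq> {-T..T}"
  proof
    fix s assume s: "s \<in> {s. fourier (kap T \<phi>) s \<noteq> 0}"
    show "s \<in> {-T..T}"
    proof (rule ccontr)
      assume "s \<notin> {-T..T}"
      then have "kernhat T x s = 0" for x using T by (intro kernhat_outside) auto
      then show False using s by (simp add: fourier_kap[OF assms])
    qed
  qed
  ultimately show ?thesis using c by (simp add: PW_def)
qed

text \<open>The reproducing property under the integral sign. Fubini applies because the decay 1 /
  (1 + t^2) of the kernel cancels the weight and leaves the integrable function
  \<open>norm (f t)\<close>.\<close>

lemma wip_kap:
  assumes T: "1 \<le> T" and \<phi>: "integrable lborel \<phi>" and f: "f \<in> PW T"
  shows "wip (kap T \<phi>) f = (LINT x|lborel. \<phi> x * cnj (f x))"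
proof -
  have [measurable]: "\<phi> \<in> borel_measurable borel" using borel_measurable_integrable[OF \<phi>] by simp
  define w where "w t = cnj (f t) * complex_of_real (1 + t\<^sup>2)" for t
  have [measurable]: "w \<in> borel_measurable borel"
    unfolding w_def using PW_D(1)[OF f] by (intro borel_measurable_continuous_onI continuous_intros)
  have wn: "norm (w t) = norm (f t) * (1 + t\<^sup>2)" for t
    using one_plus_sq_pos[of t] unfolding w_def norm_mult norm_of_real by simp
  have int: "integrable (lborel \<Otimes>\<^sub>M lborel) (\<lambda>(x, t). \<phi> x * (kernf T x t * w t))"
  proof (rule integrable_lborel_prod_bound[where g = "\<lambda>x. norm (\<phi> x)" and h = "\<lambda>t. (2 * T + 2) * norm (f t)"])
    show "integrable lborel (\<lambda>t. (2 * T + 2) * norm (f t))" using PW_integrable[OF f] by simp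
    have "norm (kernf T x t * w t) \<le> (2 * T + 2) * norm (f t)" for x t
    proof -
      have "norm (kernf T x t * w t) \<le> (2 * T + 2) / (1 + t\<^sup>2) * (norm (f t) * (1 + t\<^sup>2))"
        unfolding norm_mult wn using kernf_le(1)[OF T, of x t] one_plus_sq_pos[of t]
        by (intro mult_right_mono) auto
      then show ?thesis by simp
    qed
    then show "norm (case (x, t) of (x, t) \<Rightarrow> \<phi> x * (kernf T x t * w t)) \<le> norm (\<phi> x) * ((2 * T + 2) * norm (f t))" for x t
      by (auto simp: norm_mult intro!: mult_left_mono)
  qed (use \<phi> in auto)
  have "wip (kap T \<phi>) f = (LINT t|lborel. (LINT x|lborel. \<phi> x * kernf T x t) * w t)"
    by (simp add: wip_def kap_def w_def mult.assoc)
  also have "\<dots> = (LINT t|lborel. LINT x|lborel. \<phi> x * (kernf T x t * w t))"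
    unfolding integral_mult_left_zero[symmetric] mult.assoc ..
  also have "\<dots> = (LINT x|lborel. LINT t|lborel. \<phi> x * (kernf T x t * w t))"
    using int by (rule lborel_pair.Fubini_integral)
  also have "\<dots> = (LINT x|lborel. \<phi> x * wip (kernf T x) f)"
    unfolding wip_def w_def mult.assoc by simp
  also have "\<dots> = (LINT x|lborel. \<phi> x * cnj (f x))"
    using wip.ip_commute[OF f kernf_PW[OF T]] reproducing[OF f T] by simp
  finally show ?thesis .
qed

text \<open>The weight is included so that \<open>kap T\<close> of the truncation is exactly the
  concentration operator.\<close>

definition trunc :: "real \<Rightarrow> (real \<Rightarrow> complex) \<Rightarrow> real \<Rightarrow> complex" where
  "trunc R f x = indicator {-R..R} x *\<^sub>R (f x * complex_of_real (1 + x\<^sup>2))"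

lemma trunc_integrable:
  assumes "continuous_on {-R..R} f" shows "integrable lborel (trunc R f)"
  unfolding trunc_def[abs_def] by (intro borel_integrable_compact compact_Icc continuous_intros assms)

lemma PW_trunc_integrable: "f \<in> PW T \<Longrightarrow> integrable lborel (trunc R f)"
  using PW_D(1) continuous_on_subset by (blast intro: trunc_integrable)

lemma W_eq_kap:
  assumes T: "1 \<le> T" shows "W R T f = kap T (trunc R f)"
proof
  fix t
  show "W R T f t = kap T (trunc R f) t"
    unfolding W_def set_lebesgue_integral_def kap_def repr_kernel_eq[OF T]
  proof (intro Bochner_Integration.integral_cong refl)
    fix x
    have "cnj (kernf T t x) = kernf T x t" using kernf_sym[OF T, of t x] by (simp add: kernf_def)
    then show "indicator {-R..R} x *\<^sub>R (f x * cnj (kernf T t x) * complex_of_real (1 + x\<^sup>2)) =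
        trunc R f x * kernf T x t"
      by (simp add: trunc_def)
  qed
qed

section \<open>Quadratic form and compactness of the operator\<close>

lemma W_PW: "\<lbrakk>1 \<le> T; f \<in> PW T\<rbrakk> \<Longrightarrow> W R T f \<in> PW T"
  by (simp add: W_eq_kap kap_PW PW_trunc_integrable)

lemma wip_W:
  assumes "1 \<le> T" "f \<in> PW T" "g \<in> PW T"
  shows "wip (W R T f) g = (LINT x|lborel. indicator {-R..R} x *\<^sub>R (f x * cnj (g x) * complex_of_real (1 + x\<^sup>2)))"
  unfolding W_eq_kap[OF assms(1)] wip_kap[OF assms(1) PW_trunc_integrable[OF assms(2)] assms(3)]
  by (intro Bochner_Integration.integral_cong refl) (simp add: trunc_def mult_ac)

lemma wip_W_self:
  assumes "1 \<le> T" "f \<in> PW T"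
  shows "wip (W R T f) f = complex_of_real (LINT x|lborel. indicator {-R..R} x * ((cmod (f x))\<^sup>2 * (1 + x\<^sup>2)))"
proof -
  have "wip (W R T f) f = (LINT x|lborel. complex_of_real (indicator {-R..R} x * ((cmod (f x))\<^sup>2 * (1 + x\<^sup>2))))"
    unfolding wip_W[OF assms(1,2,2)]
    by (intro Bochner_Integration.integral_cong refl)
       (simp only: complex_norm_square of_real_mult scaleR_conv_of_real)
  then show ?thesis by (simp only: integral_complex_of_real)
qed

text \<open>By \<open>wip_kap\<close> the squared norm pairs the density with its own superposition,
  and the latter is bounded by its L^1 norm times the bound 2T + 2 of the kernel. L^1 convergence of
  densities thus gives convergence in the space.\<close>

lemma sqn_kap_le:
  assumes T: "1 \<le> T" and \<phi>: "integrable lborel \<phi>"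
  shows "wip.sqn (kap T \<phi>) \<le> (2 * T + 2) * (LINT x|lborel. cmod (\<phi> x))\<^sup>2"
proof -
  define N where "N = (LINT x|lborel. cmod (\<phi> x))"
  have N: "0 \<le> N" by (simp add: N_def)
  have kb: "cmod (kap T \<phi> t) \<le> N * (2 * T + 2)" for t
  proof -
    have "N * (2 * T + 2) / (1 + t\<^sup>2) \<le> N * (2 * T + 2) / 1"
      using T N one_plus_sq_pos[of t] by (intro divide_left_mono) auto
    then show ?thesis using kap_le[OF T \<phi>, of t] by (simp add: N_def)
  qed
  have meas: "kap T \<phi> \<in> borel_measurable borel"
    by (rule borel_measurable_continuous_onI[OF continuous_kap[OF T \<phi>]])
  have "wip.sqn (kap T \<phi>) \<le> cmod (wip (kap T \<phi>) (kap T \<phi>))"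
    unfolding wip.sqn_def by (rule complex_Re_le_cmod)
  also have "\<dots> \<le> (LINT x|lborel. cmod (\<phi> x * cnj (kap T \<phi> x)))"
    unfolding wip_kap[OF T \<phi> kap_PW[OF T \<phi>]] by (rule integral_norm_bound)
  also have "\<dots> \<le> (LINT x|lborel. cmod (\<phi> x) * (N * (2 * T + 2)))"
  proof (rule integral_mono')
    show "integrable lborel (\<lambda>x. cmod (\<phi> x) * (N * (2 * T + 2)))" using \<phi> by simp
    show "cmod (\<phi> x * cnj (kap T \<phi> x)) \<le> cmod (\<phi> x) * (N * (2 * T + 2))" for x
      using kb[of x] by (simp add: norm_mult mult_left_mono)
  qed (use N T in simp)
  also have "\<dots> = N * (N * (2 * T + 2))" by (simp add: N_def)
  finally show ?thesis by (simp add: N_def power2_eq_square mult_ac)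
qed

lemma sqn_kernf: "1 \<le> T \<Longrightarrow> wip.sqn (kernf T t) = kern T t t"
  using reproducing[OF kernf_PW, of T t t] by (simp add: wip.sqn_def kernf_def)

lemma PW_pointwise_le:
  assumes T: "1 \<le> T" and f: "f \<in> PW T"
  shows "(cmod (f t))\<^sup>2 \<le> wip.sqn f * kern T t t"
  using wip.Cauchy_Schwarz[OF f kernf_PW[OF T, of t]] reproducing[OF f T, of t] by (simp add: sqn_kernf[OF T])

text \<open>The second factor is the squared distance of the kernels at \<open>t\<close> and
  \<open>s\<close>. It tends to 0 as \<open>s\<close> tends to \<open>t\<close>, so the unit ball is
  equicontinuous.\<close>

lemma PW_increment_le:
  assumes T: "1 \<le> T" and f: "f \<in> PW T"
  shows "(cmod (f t - f s))\<^sup>2 \<le> wip.sqn f * (kern T t t - 2 * kern T t s + kern T s s)"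
proof -
  have d: "kernf T t - kernf T s \<in> PW T" using kernf_PW[OF T] wip.H_diff by blast
  have "wip f (kernf T t - kernf T s) = f t - f s"
    using reproducing[OF f T] wip.ip_diff_right[OF kernf_PW[OF T] kernf_PW[OF T] f] by simp
  moreover have "wip (kernf T t) (kernf T s) = complex_of_real (kern T t s)"
    using reproducing[OF kernf_PW[OF T] T, of t s] by (simp add: kernf_def)
  then have "wip.sqn (kernf T t - kernf T s) = kern T t t - 2 * kern T t s + kern T s s"
    using wip.sqn_diff[OF kernf_PW[OF T] kernf_PW[OF T], of t s] by (simp add: sqn_kernf[OF T])
  ultimately show ?thesis using wip.Cauchy_Schwarz[OF f d] by simp
qed

text \<open>The unit ball is uniformly bounded and equicontinuous, so Arzela-Ascoli gives a
  subsequence converging uniformly on [-R, R]. The operator sees only this interval. The limit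
  \<open>g\<close> is merely continuous there, but its superposition \<open>G\<close> lies in the
  space and is the required limit.\<close>

lemma W_compact:
  assumes T: "1 \<le> T" and F: "\<And>n::nat. F n \<in> PW T" "\<And>n. wip.sqn (F n) \<le> 1"
  shows "\<exists>r g. strict_mono r \<and> g \<in> PW T \<and> (\<lambda>n. wip.sqn (W R T (F (r n)) - g)) \<longlonglongrightarrow> 0"
proof -
  define M where "M = 2 * T + 2"
  have bound: "norm (F n x) \<le> M" for n x
  proof -
    have k0: "0 \<le> kern T x x" using wip.sqn_ge0[OF kernf_PW[OF T, of x]] by (simp add: sqn_kernf[OF T])
    have "(cmod (F n x))\<^sup>2 \<le> 1 * kern T x x"
      using PW_pointwise_le[OF T F(1), of n x] mult_right_mono[OF F(2)[of n] k0] by linarith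
    also have "\<dots> \<le> M" using abs_kern_le'[OF T, of x x] by (simp add: M_def)
    \<comment> \<open>Valid since M \<ge> 1; it allows the same \<open>M\<close> to bound the values
      and the kernel.\<close>
    also have "\<dots> \<le> M\<^sup>2" using T by (simp add: M_def power2_eq_square)
    finally show ?thesis by (rule power2_le_imp_le) (use T in \<open>simp add: M_def\<close>)
  qed
  have equi: "\<exists>d>0. \<forall>n y. y \<in> {-R..R} \<and> norm (x - y) < d \<longrightarrow> norm (F n x - F n y) < e"
    if "0 < e" for x e
  proof -
    define q where "q y = kern T x x - 2 * kern T x y + kern T y y" for y
    have "continuous_on UNIV q"
      unfolding q_def by (intro continuous_intros continuous_kern2)
    then have "isCont q x" by (simp add: continuous_on_eq_continuous_at)
    moreover have "q x = 0" by (simp add: q_def)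
    ultimately obtain d where d: "0 < d" "\<And>y. dist y x < d \<Longrightarrow> \<bar>q y\<bar> < e\<^sup>2"
      using \<open>0 < e\<close> unfolding continuous_at_eps_delta
      by (metis dist_real_def diff_zero zero_less_power)
    have "norm (F n x - F n y) < e" if "norm (x - y) < d" for n y
    proof -
      have q0: "0 \<le> q y"
      proof -
        have "kernf T x - kernf T y \<in> PW T" using kernf_PW[OF T] wip.H_diff by blast
        moreover have "wip (kernf T x) (kernf T y) = complex_of_real (kern T x y)"
          using reproducing[OF kernf_PW[OF T] T, of x y] by (simp add: kernf_def)
        then have "wip.sqn (kernf T x - kernf T y) = q y"
          using wip.sqn_diff[OF kernf_PW[OF T] kernf_PW[OF T], of x y] by (simp add: sqn_kernf[OF T] q_def)
        ultimately show ?thesis using wip.sqn_ge0 by force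
      qed
      have "(cmod (F n x - F n y))\<^sup>2 \<le> wip.sqn (F n) * q y"
        using PW_increment_le[OF T F(1), of n x y] by (simp add: q_def)
      also have "\<dots> \<le> 1 * q y" using F(2)[of n] q0 by (intro mult_right_mono)
      also have "\<dots> < e\<^sup>2" using d(2)[of y] that q0 by (simp add: dist_real_def abs_minus_commute)
      finally show ?thesis by (rule power2_less_imp_less) (use \<open>0 < e\<close> in simp)
    qed
    then show ?thesis using d(1) by blast
  qed
  obtain g k where g: "continuous_on {-R..R} g" and k: "strict_mono (k :: nat \<Rightarrow> nat)"
    and unif: "\<And>e. 0 < e \<Longrightarrow> \<exists>N. \<forall>n x. n \<ge> N \<and> x \<in> {-R..R} \<longrightarrow> norm (F (k n) x - g x) < e"
    using Arzela_Ascoli[OF compact_Icc[of "- R" R], of F M] bound equi by metis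
  define G where "G = kap T (trunc R g)"
  have G: "G \<in> PW T" unfolding G_def by (rule kap_PW[OF T trunc_integrable[OF g]])
  define C where "C = (LINT x|lborel. indicator {-R..R} x * (1 + x\<^sup>2))"
  have Cint: "integrable lborel (\<lambda>x. indicator {-R..R} x * (1 + x\<^sup>2) :: real)"
    using borel_integrable_compact[OF compact_Icc[of "- R" R], of "\<lambda>x. 1 + x\<^sup>2"]
    by (simp add: continuous_intros)
  have C: "0 \<le> C" unfolding C_def by (intro Bochner_Integration.integral_nonneg) (auto simp: indicator_def)
  have diff: "W R T (F n) - G = kap T (\<lambda>x. trunc R (F n) x - trunc R g x)"
    and int: "integrable lborel (\<lambda>x. trunc R (F n) x - trunc R g x)" for n
  proof -
    have i: "integrable lborel (trunc R (F n))" "integrable lborel (\<lambda>x. - trunc R g x)"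
      using PW_trunc_integrable[OF F(1)] trunc_integrable[OF g] by auto
    have "kap T (\<lambda>x. - trunc R g x) = - kap T (trunc R g)"
      using kap_scale[of T "-1" "trunc R g"] by (simp add: fun_eq_iff)
    then show "W R T (F n) - G = kap T (\<lambda>x. trunc R (F n) x - trunc R g x)"
      using kap_add[OF T i] by (simp add: W_eq_kap[OF T] G_def)
    show "integrable lborel (\<lambda>x. trunc R (F n) x - trunc R g x)"
      using Bochner_Integration.integrable_add[OF i] by simp
  qed
  have "(\<lambda>n. wip.sqn (W R T (F (k n)) - G)) \<longlonglongrightarrow> 0"
  proof (rule LIMSEQ_I)
    fix e :: real assume e: "0 < e"
    \<comment> \<open>Chosen so that M (d C)^2 is at most e / 2; the summand 1 keeps the denominator
      positive when \<open>C\<close> is 0.\<close>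
    define d where "d = sqrt (e / (2 * M * (C\<^sup>2 + 1)))"
    have M0: "0 < M" using T by (simp add: M_def)
    have C1: "0 < C\<^sup>2 + 1" by (simp add: add_nonneg_pos)
    have d: "0 < d" unfolding d_def using e M0 C1 by simp
    have d2: "M * (d * C)\<^sup>2 < e"
    proof -
      have "d\<^sup>2 = e / (2 * M * (C\<^sup>2 + 1))" unfolding d_def using e M0 C1 by simp
      then have "M * (d * C)\<^sup>2 = e * (C\<^sup>2 / (C\<^sup>2 + 1)) / 2"
        using M0 by (simp add: power_mult_distrib)
      also have "C\<^sup>2 / (C\<^sup>2 + 1) \<le> 1" using C1 by simp
      then have "e * (C\<^sup>2 / (C\<^sup>2 + 1)) / 2 \<le> e * 1 / 2" using e by (intro divide_right_mono mult_left_mono) auto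
      also have "\<dots> < e" using e by simp
      finally show ?thesis .
    qed
    obtain N where N: "\<And>n x. n \<ge> N \<Longrightarrow> x \<in> {-R..R} \<Longrightarrow> norm (F (k n) x - g x) < d"
      using unif[OF d] by blast
    show "\<exists>N. \<forall>n\<ge>N. norm (wip.sqn (W R T (F (k n)) - G) - 0) < e"
    proof (intro exI allI impI)
      fix n assume n: "N \<le> n"
      let ?\<phi> = "\<lambda>x. trunc R (F (k n)) x - trunc R g x"
      have "(LINT x|lborel. cmod (?\<phi> x)) \<le> (LINT x|lborel. d * (indicator {-R..R} x * (1 + x\<^sup>2)))"
      proof (rule integral_mono')
        show "integrable lborel (\<lambda>x. d * (indicator {-R..R} x * (1 + x\<^sup>2)))"
          using Cint by (rule integrable_mult_right)
        show "cmod (?\<phi> x) \<le> d * (indicator {-R..R} x * (1 + x\<^sup>2))" for x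
        proof (cases "x \<in> {-R..R}")
          case True
          have "?\<phi> x = (F (k n) x - g x) * complex_of_real (1 + x\<^sup>2)"
            using True by (simp add: trunc_def left_diff_distrib del: of_real_add)
          then have "cmod (?\<phi> x) = cmod (F (k n) x - g x) * (1 + x\<^sup>2)"
            using one_plus_sq_pos[of x] by (simp only: norm_mult norm_of_real abs_of_pos)
          also have "\<dots> \<le> d * (1 + x\<^sup>2)"
            using N[OF n True] one_plus_sq_pos[of x] by (intro mult_right_mono) auto
          finally show ?thesis using True by simp
        next
          case False
          then show ?thesis by (simp add: trunc_def)
        qed
        show "0 \<le> d * (indicator {-R..R} x * (1 + x\<^sup>2))" for x
          using d by (simp add: indicator_def)
      qed
      then have "(LINT x|lborel. cmod (?\<phi> x)) \<le> d * C" by (simp add: C_def)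
      then have "(LINT x|lborel. cmod (?\<phi> x))\<^sup>2 \<le> (d * C)\<^sup>2" by (intro power_mono) auto
      then have "M * (LINT x|lborel. cmod (?\<phi> x))\<^sup>2 \<le> M * (d * C)\<^sup>2" using M0 by (intro mult_left_mono) auto
      then have "wip.sqn (W R T (F (k n)) - G) < e"
        using sqn_kap_le[OF T int[of "k n"]] d2 unfolding diff M_def by linarith
      moreover have "0 \<le> wip.sqn (W R T (F (k n)) - G)"
        using G W_PW[OF T F(1)] wip.H_diff wip.sqn_ge0 by blast
      ultimately show "norm (wip.sqn (W R T (F (k n)) - G) - 0) < e" by simp
    qed
  qed
  then show ?thesis using k G by blast
qed

text \<open>The quadratic form of the operator is the energy inside [-R, R], hence between 0 and the
  full energy. Definiteness follows from the bounded point evaluations.\<close>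

lemma W_compact_contraction:
  assumes T: "1 \<le> T"
  shows "compact_contraction (\<lambda>c f x. c * f x) (PW T) wip (W R T)"
proof (intro compact_contraction.intro compact_contraction_axioms.intro wip_psd_form)
  fix f assume f: "f \<in> PW T" and "psd_form.sqn wip f = 0"
  then have "(cmod (f t))\<^sup>2 \<le> 0" for t using PW_pointwise_le[OF T f, of t] by simp
  then show "f = 0" by (auto simp: fun_eq_iff)
next
  fix f assume f: "f \<in> PW T"
  show "W R T f \<in> PW T" by (rule W_PW[OF T f])
  show "0 \<le> Re (wip (W R T f) f)"
    using one_plus_sq_pos less_imp_le unfolding wip_W_self[OF T f]
    by (auto intro!: Bochner_Integration.integral_nonneg mult_nonneg_nonneg)
  show "Re (wip (W R T f) f) \<le> psd_form.sqn wip f"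
    unfolding wip_W_self[OF T f] sqn_wip[OF f] Re_complex_of_real
  proof (rule integral_mono')
    show "integrable lborel (\<lambda>x. (cmod (f x))\<^sup>2 * (1 + x\<^sup>2))" by (rule PW_D(2)[OF f])
  qed (auto simp: indicator_def)
  fix c
  have "trunc R (\<lambda>x. c * f x) = (\<lambda>x. c * trunc R f x)"
    by (auto simp: trunc_def fun_eq_iff)
  then show "W R T (\<lambda>x. c * f x) = (\<lambda>x. c * W R T f x)"
    by (simp add: W_eq_kap[OF T] kap_scale)
next
  fix f g assume fg: "f \<in> PW T" "g \<in> PW T"
  have "trunc R (f + g) = (\<lambda>x. trunc R f x + trunc R g x)"
    by (auto simp: trunc_def fun_eq_iff algebra_simps)
  then show "W R T (f + g) = W R T f + W R T g"
    using kap_add[OF T PW_trunc_integrable[OF fg(1)] PW_trunc_integrable[OF fg(2)]]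
    by (simp add: W_eq_kap[OF T])
  have "wip f (W R T g) = cnj (wip (W R T g) f)"
    using wip.ip_commute[OF W_PW[OF T fg(2)] fg(1)] .
  also have "\<dots> = (LINT x|lborel. cnj (indicator {-R..R} x *\<^sub>R (g x * cnj (f x) * complex_of_real (1 + x\<^sup>2))))"
    unfolding wip_W[OF T fg(2,1)] by (rule Bochner_Integration.integral_cnj[symmetric])
  also have "\<dots> = wip (W R T f) g"
    unfolding wip_W[OF T fg] by (intro Bochner_Integration.integral_cong refl) (simp add: mult_ac)
  finally show "wip (W R T f) g = wip f (W R T g)" by simp
next
  fix F :: "nat \<Rightarrow> real \<Rightarrow> complex"
  assume "\<And>n. F n \<in> PW T" "\<And>n. psd_form.sqn wip (F n) \<le> 1"
  then show "\<exists>r g. strict_mono r \<and> g \<in> PW T \<and> (\<lambda>n. psd_form.sqn wip (W R T (F (r n)) - g)) \<longlonglongrightarrow> 0"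
    by (rule W_compact[OF T])
qed

section \<open>Trace and energy loss\<close>

lemma inverse_sq_tail_integral:
  fixes y R :: real assumes "y < R"
  shows "has_bochner_integral lborel (\<lambda>x. indicator {R..} x * (1 / (x - y)\<^sup>2)) (1 / (R - y))"
proof (rule has_bochner_integral_nn_integral)
  have *: "(\<integral>\<^sup>+ x. ennreal (1 / (x - y)\<^sup>2) * indicator {R..} x \<partial>lborel) = ennreal (0 - (- 1 / (R - y)))"
  proof (rule nn_integral_FTC_atLeast)
    fix x assume "R \<le> x"
    then have "x - y \<noteq> 0" using assms by simp
    then show "((\<lambda>x. - 1 / (x - y)) has_real_derivative 1 / (x - y)\<^sup>2) (at x)"
      by (auto intro!: derivative_eq_intros simp: power2_eq_square)
  next
    have "filterlim (\<lambda>x. x - y) at_top at_top"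
      using filterlim_tendsto_add_at_top[OF tendsto_const[of "- y"] filterlim_ident] by simp
    then show "((\<lambda>x. - 1 / (x - y)) \<longlongrightarrow> 0) at_top"
      by (intro tendsto_divide_0[OF tendsto_const] filterlim_at_top_imp_at_infinity)
  qed auto
  show "(\<integral>\<^sup>+ x. ennreal (indicator {R..} x * (1 / (x - y)\<^sup>2)) \<partial>lborel) = ennreal (1 / (R - y))"
  proof -
    have "(\<lambda>x. ennreal (indicator {R..} x * (1 / (x - y)\<^sup>2))) = (\<lambda>x. ennreal (1 / (x - y)\<^sup>2) * indicator {R..} x)"
      by (auto simp: fun_eq_iff indicator_def)
    then show ?thesis using * by simp
  qed
qed (use assms in auto)

text \<open>Off the interval this majorises the squared sinc kernel centred at \<open>y\<close>, by
  \<open>sinc_kernel_sq_le\<close>; centred at 0 it will majorise the correction term.\<close>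

definition outer :: "real \<Rightarrow> real \<Rightarrow> real \<Rightarrow> real" where
  "outer R y x = indicator {R..} x * (1 / (x - y)\<^sup>2) + indicator {..- R} x * (1 / (x - y)\<^sup>2)"

lemma outer_integral:
  assumes "\<bar>y\<bar> < R"
  shows "has_bochner_integral lborel (outer R y) (1 / (R - y) + 1 / (R + y))"
proof -
  have "has_bochner_integral lborel (\<lambda>x. indicator {R..} x * (1 / (x - (- y))\<^sup>2)) (1 / (R - (- y)))"
    using assms by (intro inverse_sq_tail_integral) auto
  then have "has_bochner_integral lborel (\<lambda>x. indicator {R..} (0 + (- 1) * x) * (1 / ((0 + (- 1) * x) - (- y))\<^sup>2))
      ((1 / (R - (- y))) /\<^sub>R \<bar>- 1\<bar>)"
    by (subst (asm) lborel_has_bochner_integral_real_affine_iff[of "- 1" _ _ 0]) auto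
  also have "(\<lambda>x. indicator {R..} (0 + (- 1) * x) * (1 / ((0 + (- 1) * x) - (- y))\<^sup>2))
      = (\<lambda>x. indicator {..- R} x * (1 / (x - y)\<^sup>2))"
    by (auto simp: fun_eq_iff indicator_def power2_commute)
  finally have "has_bochner_integral lborel (\<lambda>x. indicator {..- R} x * (1 / (x - y)\<^sup>2)) (1 / (R + y))"
    by simp
  with inverse_sq_tail_integral[of y R] assms show ?thesis
    unfolding outer_def[abs_def] by (intro has_bochner_integral_add) auto
qed

text \<open>Since |y| < R < |x|, the quotient (1 + y^2) / (1 + x^2) is at most 1, which settles the
  sinc part. In the correction part the square is at most 2 / (1 + y^2), so the factor 1 + y^2
  cancels and only 4 / (1 + x^2) remains.\<close>

lemma kern_outer_le:
  assumes T: "1 \<le> T" and y: "\<bar>y\<bar> < R" and x: "x \<notin> {-R..R}"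
  shows "(kern T y x)\<^sup>2 * (1 + x\<^sup>2) * (1 + y\<^sup>2) \<le> 2 * outer R y x + 4 * outer R 0 x"
proof -
  define S where "S = sinc_kernel T (x - y)"
  define r where "r = kernel_corr T y x"
  define m where "m = 1 + x\<^sup>2"
  define n where "n = 1 + y\<^sup>2"
  have pos: "0 < m" "0 < n" using one_plus_sq_pos by (auto simp: m_def n_def)
  have xR: "R < \<bar>x\<bar>" using x by auto
  then have "y\<^sup>2 \<le> x\<^sup>2" using y by (simp flip: abs_le_square_iff)
  then have nm: "n \<le> m" by (simp add: m_def n_def)
  have xy: "x - y \<noteq> 0" "x \<noteq> 0" using xR y by auto
  have out: "outer R z x = 1 / (x - z)\<^sup>2" for z
    using xR y by (auto simp: outer_def indicator_def)
  have k: "kern T y x = (S + r) / m" by (simp add: kern_def S_def r_def m_def)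
  have "(kern T y x)\<^sup>2 * m * n = (S + r)\<^sup>2 * (n / m)"
    using pos unfolding k by (simp add: power_divide power2_eq_square)
  also have "\<dots> \<le> (2 * S\<^sup>2 + 2 * r\<^sup>2) * (n / m)"
    using pos sum_squares_bound[of S r] by (intro mult_right_mono) (auto simp: power2_sum)
  also have "\<dots> = 2 * (S\<^sup>2 * (n / m)) + 2 * r\<^sup>2 * (n / m)" by (simp add: algebra_simps)
  also have "S\<^sup>2 * (n / m) \<le> S\<^sup>2 * 1" using pos nm by (intro mult_left_mono) auto
  also have "S\<^sup>2 * 1 \<le> 1 / (x - y)\<^sup>2" using sinc_kernel_sq_le[OF xy(1), of T] by (simp add: S_def)
  also have "2 * r\<^sup>2 * (n / m) \<le> 2 * (2 / n) * (n / m)"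
    using kernel_corr_sq_le[OF T, of y x] pos by (intro mult_right_mono mult_left_mono) (auto simp: r_def n_def)
  also have "2 * (2 / n) * (n / m) = 4 / m" using pos by simp
  also have "4 / m \<le> 4 / x\<^sup>2" using xy by (intro divide_left_mono) (auto simp: m_def one_plus_sq_pos)
  finally show ?thesis using out[of y] out[of 0] by (simp add: m_def n_def)
qed

lemma kern_diag:
  "kern T y y * (1 + y\<^sup>2) = 2 * T + kernel_corr T y y"
  by (simp add: kern_def)

lemma kernel_corr_diag_le: "1 \<le> T \<Longrightarrow> \<bar>kernel_corr T y y\<bar> \<le> 1 / (1 + y\<^sup>2)"
proof -
  assume "1 \<le> T"
  then have "\<bar>kernel_corr T y y\<bar> \<le> 3 / (pi * (1 + y\<^sup>2))"
    using abs_kernel_corr_le[of T y y] by simp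
  also have "\<dots> \<le> 3 / (3 * (1 + y\<^sup>2))"
    using pi_gt3 one_plus_sq_pos[of y] by (intro divide_left_mono mult_right_mono) auto
  also have "\<dots> = 1 / (1 + y\<^sup>2)" by (subst mult_divide_mult_cancel_left[of 3 1, symmetric]) auto
  finally show ?thesis .
qed

text \<open>Within distance 1 of the boundary the energy outside \<open>[-R, R]\<close> is bounded by the full energy;
  further inside it decays like the inverse distance to the boundary.\<close>

definition loss :: "real \<Rightarrow> real \<Rightarrow> real \<Rightarrow> real" where
  "loss R T y = (2 * T + 1) * (indicator {-R..-R+1} y + indicator {R-1..R} y)
     + 4 / (R + 1 - y) + 4 / (R + 1 + y) + 8 / R"

text \<open>The difference is the energy outside [-R, R] of the kernel centred at \<open>y\<close>.
  In the end layers it is replaced by the full weighted diagonal, at most 2T + 1; elsewhere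
  \<open>kern_outer_le\<close> is integrated in \<open>x\<close>.\<close>

lemma kernf_loss:
  assumes T: "1 \<le> T" and R: "1 \<le> R" and y: "y \<in> {-R..R}"
  shows "(kern T y y - Re (wip (W R T (kernf T y)) (kernf T y))) * (1 + y\<^sup>2) \<le> loss R T y"
proof -
  have k: "kernf T y \<in> PW T" by (rule kernf_PW[OF T])
  define E where "E x = (kern T y x)\<^sup>2 * (1 + x\<^sup>2)" for x
  have E0: "0 \<le> E x" for x using one_plus_sq_pos[of x] by (simp add: E_def)
  have Eint: "integrable lborel E" using PW_D(2)[OF k] by (simp add: E_def[abs_def] kernf_def)
  have q: "Re (wip (W R T (kernf T y)) (kernf T y)) = (LINT x|lborel. indicator {-R..R} x * E x)"
    using wip_W_self[OF T k, of R] by (simp add: E_def kernf_def)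
  have kk: "kern T y y = (LINT x|lborel. E x)"
    using sqn_kernf[OF T, of y] sqn_wip[OF k] by (simp add: E_def kernf_def)
  have iint: "integrable lborel (\<lambda>x. indicator {-R..R} x * E x)"
    using integrable_real_mult_indicator[OF _ Eint, of "{-R..R}"] by (simp add: mult.commute)
  have q0: "0 \<le> Re (wip (W R T (kernf T y)) (kernf T y))"
    unfolding q using E0 by (intro Bochner_Integration.integral_nonneg) auto
  have pos4: "0 \<le> 4 / (R + 1 - y)" "0 \<le> 4 / (R + 1 + y)" "0 \<le> 8 / R" using y R by auto
  show ?thesis
  proof (cases "y \<in> {-R..-R+1} \<or> y \<in> {R-1..R}")
    case True
    have "(kern T y y - Re (wip (W R T (kernf T y)) (kernf T y))) * (1 + y\<^sup>2) \<le> kern T y y * (1 + y\<^sup>2)"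
      using q0 one_plus_sq_pos[of y] by (intro mult_right_mono) auto
    also have "\<dots> = 2 * T + kernel_corr T y y" by (rule kern_diag)
    also have "\<dots> \<le> 2 * T + 1"
    proof -
      have "1 / (1 + y\<^sup>2) \<le> 1 / 1" using one_plus_sq_pos[of y] by (intro divide_left_mono) auto
      then show ?thesis using kernel_corr_diag_le[OF T, of y] by linarith
    qed
    also have "2 * T + 1 \<le> (2 * T + 1) * (indicator {-R..-R+1} y + indicator {R-1..R} y)"
      using True T by (auto simp: indicator_def)
    also have "\<dots> \<le> loss R T y" unfolding loss_def using pos4 by linarith
    finally show ?thesis .
  next
    case False
    then have yR: "\<bar>y\<bar> < R - 1" using y by auto
    then have yR': "\<bar>y\<bar> < R" by simp
    have R0: "\<bar>0\<bar> < R" using R by simp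
    note o = outer_integral[OF yR'] outer_integral[OF R0]
    have "(kern T y y - Re (wip (W R T (kernf T y)) (kernf T y))) * (1 + y\<^sup>2)
       = (LINT x|lborel. (E x - indicator {-R..R} x * E x) * (1 + y\<^sup>2))"
      unfolding q kk using Eint iint by simp
    also have "\<dots> \<le> (LINT x|lborel. 2 * outer R y x + 4 * outer R 0 x)"
    proof (rule integral_mono)
      show "integrable lborel (\<lambda>x. (E x - indicator {-R..R} x * E x) * (1 + y\<^sup>2))"
        using Eint iint by (intro integrable_mult_left Bochner_Integration.integrable_diff)
      show "integrable lborel (\<lambda>x. 2 * outer R y x + 4 * outer R 0 x)"
        using o by (intro Bochner_Integration.integrable_add integrable_mult_right)
          (auto simp: has_bochner_integral_iff)
      show "(E x - indicator {-R..R} x * E x) * (1 + y\<^sup>2) \<le> 2 * outer R y x + 4 * outer R 0 x" for x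
      proof (cases "x \<in> {-R..R}")
        case True
        then show ?thesis by (simp add: outer_def)
      next
        case False
        then show ?thesis using kern_outer_le[OF T yR' False] by (simp add: E_def)
      qed
    qed
    also have "\<dots> = 2 * (1 / (R - y) + 1 / (R + y)) + 4 * (1 / (R - 0) + 1 / (R + 0))"
      using o by (simp add: has_bochner_integral_iff)
    also have "\<dots> \<le> 4 / (R + 1 - y) + 4 / (R + 1 + y) + 8 / R"
    proof -
      \<comment> \<open>Shifting the denominators by 1 at the cost of a factor 2 makes the majorant
        integrable in \<open>y\<close> up to the ends of the interval.\<close>
      have "2 / u \<le> 4 / (u + 1)" if "1 \<le> u" for u :: real using that by (simp add: field_simps)
      from this[of "R - y"] this[of "R + y"] yR
      have "2 / (R - y) \<le> 4 / (R - y + 1)" "2 / (R + y) \<le> 4 / (R + y + 1)" by auto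
      moreover have "R - y + 1 = R + 1 - y" "R + y + 1 = R + 1 + y" by simp_all
      ultimately have "2 / (R - y) + 2 / (R + y) \<le> 4 / (R + 1 - y) + 4 / (R + 1 + y)" by simp
      then show ?thesis by simp
    qed
    also have "\<dots> \<le> loss R T y"
      using T by (simp add: loss_def)
    finally show ?thesis .
  qed
qed

text \<open>Each end layer has width 1 and contributes 2T + 1, the shifted reciprocals give the
  logarithm, and the constant 8 / R over length 2R gives 16.\<close>

lemma loss_integral:
  assumes R: "1 \<le> R"
  shows "integrable lborel (\<lambda>y. indicator {-R..R} y * loss R T y)"
    and "(LINT y|lborel. indicator {-R..R} y * loss R T y) = 2 * (2 * T + 1) + 8 * ln (2 * R + 1) + 16"
proof -
  have "has_bochner_integral lborel (\<lambda>y. (4 / (R + 1 - y) + 4 / (R + 1 + y) + 8 / R) * indicator {-R..R} y)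
     ((- 4 * ln (R + 1 - R) + 4 * ln (R + 1 + R) + 8 / R * R) -
      (- 4 * ln (R + 1 - (- R)) + 4 * ln (R + 1 + (- R)) + 8 / R * (- R)))"
    using R by (intro has_bochner_integral_FTC_Icc_real[where F = "\<lambda>y. - 4 * ln (R + 1 - y) + 4 * ln (R + 1 + y) + 8 / R * y"])
      (auto intro!: derivative_eq_intros continuous_intros)
  then have 1: "has_bochner_integral lborel (\<lambda>y. (4 / (R + 1 - y) + 4 / (R + 1 + y) + 8 / R) * indicator {-R..R} y)
      (8 * ln (2 * R + 1) + 16)"
    using R by (simp add: algebra_simps)
  have 2: "has_bochner_integral lborel (\<lambda>y. (2 * T + 1) * (indicator {-R..-R+1} y + indicator {R-1..R} y)) ((2 * T + 1) * (1 + 1))"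
  proof -
    have "has_bochner_integral lborel (indicator {a..a+1} :: real \<Rightarrow> real) 1" for a :: real
      using has_bochner_integral_real_indicator[of "{a..a+1}" lborel] by simp
    from this[of "- R"] this[of "R - 1"] show ?thesis
      by (intro has_bochner_integral_mult_right has_bochner_integral_add) auto
  qed
  have eq: "(\<lambda>y. indicator {-R..R} y * loss R T y) = (\<lambda>y. (2 * T + 1) * (indicator {-R..-R+1} y + indicator {R-1..R} y)
      + (4 / (R + 1 - y) + 4 / (R + 1 + y) + 8 / R) * indicator {-R..R} y)"
    using R by (auto simp: fun_eq_iff loss_def indicator_def)
  from has_bochner_integral_add[OF 2 1]
  show "integrable lborel (\<lambda>y. indicator {-R..R} y * loss R T y)"
    and "(LINT y|lborel. indicator {-R..R} y * loss R T y) = 2 * (2 * T + 1) + 8 * ln (2 * R + 1) + 16"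
    unfolding eq by (auto simp: has_bochner_integral_iff)
qed

text \<open>The leading term 2T of the weighted diagonal integrates to 4RT; the remainder is at most
  1 / (1 + y^2), whose integral over the whole line is pi.\<close>

lemma trace_integral:
  assumes T: "1 \<le> T" and R: "0 \<le> R"
  shows "integrable lborel (\<lambda>y. indicator {-R..R} y * (kern T y y * (1 + y\<^sup>2)))"
    and "\<bar>(LINT y|lborel. indicator {-R..R} y * (kern T y y * (1 + y\<^sup>2))) - 4 * R * T\<bar> \<le> pi"
proof -
  have cont: "continuous_on {-R..R} (\<lambda>y. kern T y y * (1 + y\<^sup>2))"
    by (intro continuous_intros continuous_kern2)
  show int: "integrable lborel (\<lambda>y. indicator {-R..R} y * (kern T y y * (1 + y\<^sup>2)))"
    using borel_integrable_compact[OF compact_Icc cont] by simp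
  have 1: "has_bochner_integral lborel (\<lambda>y. 2 * T * indicator {-R..R} y) (2 * T * R - 2 * T * (- R))"
    using R by (intro has_bochner_integral_FTC_Icc_real) (auto intro!: derivative_eq_intros)
  have 2: "has_bochner_integral lborel (\<lambda>y. 1 / (1 + y\<^sup>2) * indicator {-R..R} y) (arctan R - arctan (- R))"
    using R by (intro has_bochner_integral_FTC_Icc_real) (auto intro!: derivative_eq_intros continuous_intros simp: divide_inverse)
  have "\<bar>(LINT y|lborel. indicator {-R..R} y * (kern T y y * (1 + y\<^sup>2))) - 4 * R * T\<bar>
     = \<bar>LINT y|lborel. indicator {-R..R} y * (kern T y y * (1 + y\<^sup>2)) - 2 * T * indicator {-R..R} y\<bar>"
  proof -
    have i: "integrable lborel (\<lambda>y. 2 * T * indicator {-R..R} y)"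
      "(LINT y|lborel. 2 * T * indicator {-R..R} y) = 2 * T * R - 2 * T * (- R)"
      using 1 unfolding has_bochner_integral_iff by auto
    show ?thesis unfolding Bochner_Integration.integral_diff[OF int i(1)] i(2) by (simp add: algebra_simps)
  qed
  also have "\<dots> \<le> (LINT y|lborel. \<bar>indicator {-R..R} y * (kern T y y * (1 + y\<^sup>2)) - 2 * T * indicator {-R..R} y\<bar>)"
    by (rule integral_abs_bound)
  also have "\<dots> \<le> (LINT y|lborel. 1 / (1 + y\<^sup>2) * indicator {-R..R} y)"
  proof (rule integral_mono)
    show "integrable lborel (\<lambda>y. \<bar>indicator {-R..R} y * (kern T y y * (1 + y\<^sup>2)) - 2 * T * indicator {-R..R} y\<bar>)"
      using int 1 by (intro integrable_abs Bochner_Integration.integrable_diff) (auto simp: has_bochner_integral_iff)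
    show "integrable lborel (\<lambda>y. 1 / (1 + y\<^sup>2) * indicator {-R..R} y)"
      using 2 by (simp add: has_bochner_integral_iff)
    show "\<bar>indicator {-R..R} y * (kern T y y * (1 + y\<^sup>2)) - 2 * T * indicator {-R..R} y\<bar>
        \<le> 1 / (1 + y\<^sup>2) * indicator {-R..R} y" for y
      using kernel_corr_diag_le[OF T, of y] unfolding kern_diag by (simp add: indicator_def)
  qed
  also have "\<dots> = 2 * arctan R" using 2 by (simp add: has_bochner_integral_iff arctan_minus)
  also have "\<dots> \<le> pi" using arctan_ubound[of R] by simp
  finally show "\<bar>(LINT y|lborel. indicator {-R..R} y * (kern T y y * (1 + y\<^sup>2))) - 4 * R * T\<bar> \<le> pi" .
qed

section \<open>Counting eigenvalues\<close>

text \<open>For a normalised eigenvector the integral of this function is its eigenvalue. That is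
  how inequalities pointwise in \<open>y\<close> become inequalities for sums over
  eigenvalues.\<close>

definition density :: "real \<Rightarrow> (real \<Rightarrow> complex) \<Rightarrow> real \<Rightarrow> real" where
  "density R b y = indicator {-R..R} y * ((cmod (b y))\<^sup>2 * (1 + y\<^sup>2))"

definition kernel_trace :: "real \<Rightarrow> real \<Rightarrow> real" where
  "kernel_trace R T = (LINT y|lborel. indicator {-R..R} y * (kern T y y * (1 + y\<^sup>2)))"

text \<open>The integral of the explicit majorant \<open>loss\<close>, hence an upper bound for the
  trace of W - W^2 and not this trace itself.\<close>

definition total_loss :: "real \<Rightarrow> real \<Rightarrow> real" where
  "total_loss R T = (LINT y|lborel. indicator {-R..R} y * loss R T y)"

lemma density_integral:
  assumes "1 \<le> T" "b \<in> PW T"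
  shows "integrable lborel (density R b)"
    and "(LINT y|lborel. density R b y) = Re (wip (W R T b) b)"
proof -
  show "integrable lborel (density R b)"
    using integrable_real_mult_indicator[OF _ PW_D(2)[OF assms(2)], of "{-R..R}"]
    by (simp add: density_def[abs_def] mult.commute)
  show "(LINT y|lborel. density R b y) = Re (wip (W R T b) b)"
    using wip_W_self[OF assms] by (simp add: density_def)
qed

section \<open>Bounds for the size of eigenvector families at fixed \<open>R\<close> and
  \<open>T\<close>\<close>

context
  fixes R T :: real
  assumes T: "1 \<le> T" and R: "1 \<le> R"
begin

interpretation op: compact_contraction "\<lambda>(c::complex) (f::real \<Rightarrow> complex) x. c * f x" "PW T" wip "W R T"
  by (rule W_compact_contraction[OF T])

lemma eigenspace_eq: "eigenspace R T c = op.eig c"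
  by (auto simp: eigenspace_def op.eig_def fun_eq_iff)

lemma integral_sum_density:
  assumes "B \<subseteq> PW T"
  shows "integrable lborel (\<lambda>y. \<Sum>b\<in>B. u b * density R b y)"
    and "(LINT y|lborel. (\<Sum>b\<in>B. u b * density R b y)) = (\<Sum>b\<in>B. u b * Re (wip (W R T b) b))"
proof -
  have b: "b \<in> PW T" if "b \<in> B" for b using that assms by auto
  then show "integrable lborel (\<lambda>y. \<Sum>b\<in>B. u b * density R b y)"
    using density_integral(1)[OF T] by (intro Bochner_Integration.integrable_sum integrable_mult_right) auto
  have "(LINT y|lborel. (\<Sum>b\<in>B. u b * density R b y)) = (\<Sum>b\<in>B. (LINT y|lborel. u b * density R b y))"
    using density_integral(1)[OF T b] by (intro Bochner_Integration.integral_sum integrable_mult_right) auto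
  also have "\<dots> = (\<Sum>b\<in>B. u b * Re (wip (W R T b) b))"
    using density_integral(2)[OF T b] by (intro sum.cong) auto
  finally show "(LINT y|lborel. (\<Sum>b\<in>B. u b * density R b y)) = (\<Sum>b\<in>B. u b * Re (wip (W R T b) b))" .
qed

text \<open>The coefficient of the kernel at \<open>y\<close> along \<open>b\<close> has modulus
  |b(y)| by the reproducing property, so the residual identities become pointwise statements about
  the eigenfunctions.\<close>

lemma kernf_residual:
  assumes B: "op.eigset a B"
  obtains g where "g \<in> op.perp B"
    and "wip.sqn g = kern T y y - (\<Sum>b\<in>B. (cmod (b y))\<^sup>2)"
    and "Re (wip (W R T g) g) = Re (wip (W R T (kernf T y)) (kernf T y))
           - (\<Sum>b\<in>B. Re (wip (W R T b) b) * (cmod (b y))\<^sup>2)"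
proof -
  have k: "kernf T y \<in> PW T" by (rule kernf_PW[OF T])
  have BH: "B \<subseteq> PW T" using B by (simp add: op.eigset_def)
  have c: "cmod (wip (kernf T y) b) = cmod (b y)" if "b \<in> B" for b
  proof -
    have b: "b \<in> PW T" using that BH by auto
    show ?thesis using wip.ip_commute[OF b k] reproducing[OF b T, of y] by simp
  qed
  show ?thesis
    using op.eigset_residual[OF B k] c sqn_kernf[OF T, of y] by (intro that) simp_all
qed

lemma loss_ge: "indicator {-R..R} y * (kern T y y * (1 + y\<^sup>2)) - indicator {-R..R} y * loss R T y
    \<le> indicator {-R..R} y * (Re (wip (W R T (kernf T y)) (kernf T y)) * (1 + y\<^sup>2))"
  using kernf_loss[OF T R, of y] by (auto simp: indicator_def algebra_simps)

lemma sum_density: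
  "(\<Sum>b\<in>B. u b * density R b y) = indicator {-R..R} y * ((\<Sum>b\<in>B. u b * (cmod (b y))\<^sup>2) * (1 + y\<^sup>2))"
  by (simp add: density_def sum_distrib_left sum_distrib_right mult_ac)

text \<open>Nonnegativity of the squared norm of the residual bounds the sum of the eigenvalues by
  the trace; the contraction property at the residual bounds the sum of l (1 - l) by the loss. Since
  every l exceeds \<open>a\<close>, the latter controls the sum of 1 - l, and the cardinality is the
  sum of l plus the sum of 1 - l.\<close>

lemma card_eigset_le:
  assumes B: "op.eigset a B" and a: "0 < a"
  shows "real (card B) \<le> kernel_trace R T + total_loss R T / a"
proof -
  have BH: "B \<subseteq> PW T" using B by (simp add: op.eigset_def)
  define l where "l b = Re (wip (W R T b) b)" for b
  have l: "a < l b" "l b \<le> 1" if "b \<in> B" for b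
    using op.eigset_eigenvalue[OF B that] by (auto simp: l_def)
  have w0: "0 \<le> 1 + y\<^sup>2" for y :: real using one_plus_sq_pos[of y] by simp
  have "(LINT y|lborel. (\<Sum>b\<in>B. 1 * density R b y)) \<le> kernel_trace R T"
    unfolding kernel_trace_def
  proof (rule integral_mono)
    show "integrable lborel (\<lambda>y. indicator {-R..R} y * (kern T y y * (1 + y\<^sup>2)))"
      using trace_integral(1)[OF T] R by simp
    show "(\<Sum>b\<in>B. 1 * density R b y) \<le> indicator {-R..R} y * (kern T y y * (1 + y\<^sup>2))" for y
    proof -
      obtain g where "g \<in> op.perp B" "wip.sqn g = kern T y y - (\<Sum>b\<in>B. (cmod (b y))\<^sup>2)"
        using kernf_residual[OF B] by blast
      then have "(\<Sum>b\<in>B. 1 * (cmod (b y))\<^sup>2) \<le> kern T y y"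
        using wip.sqn_ge0[of g T] by (auto simp: op.perp_def)
      then show ?thesis unfolding sum_density by (intro mult_left_mono mult_right_mono w0) auto
    qed
  qed (rule integral_sum_density[OF BH])
  then have 1: "(\<Sum>b\<in>B. l b) \<le> kernel_trace R T"
    unfolding integral_sum_density(2)[OF BH] by (simp add: l_def)
  have "(LINT y|lborel. (\<Sum>b\<in>B. (1 - l b) * density R b y)) \<le> total_loss R T"
    unfolding total_loss_def
  proof (rule integral_mono)
    show "integrable lborel (\<lambda>y. indicator {-R..R} y * loss R T y)"
      by (rule loss_integral(1)[OF R])
    show "(\<Sum>b\<in>B. (1 - l b) * density R b y) \<le> indicator {-R..R} y * loss R T y" for y
    proof -
      obtain g where g: "g \<in> op.perp B" "wip.sqn g = kern T y y - (\<Sum>b\<in>B. (cmod (b y))\<^sup>2)"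
         "Re (wip (W R T g) g) = Re (wip (W R T (kernf T y)) (kernf T y)) - (\<Sum>b\<in>B. l b * (cmod (b y))\<^sup>2)"
        using kernf_residual[OF B] unfolding l_def by blast
      have "Re (wip (W R T g) g) \<le> wip.sqn g" using g(1) op.A_le by (auto simp: op.perp_def)
      then have "(\<Sum>b\<in>B. (1 - l b) * (cmod (b y))\<^sup>2) \<le> kern T y y - Re (wip (W R T (kernf T y)) (kernf T y))"
        unfolding g by (simp add: left_diff_distrib sum_subtractf)
      then have "(\<Sum>b\<in>B. (1 - l b) * density R b y)
        \<le> indicator {-R..R} y * ((kern T y y - Re (wip (W R T (kernf T y)) (kernf T y))) * (1 + y\<^sup>2))"
        unfolding sum_density by (intro mult_left_mono mult_right_mono w0) auto
      then show ?thesis using loss_ge[of y] by (simp add: algebra_simps)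
    qed
  qed (rule integral_sum_density[OF BH])
  then have 2: "(\<Sum>b\<in>B. (1 - l b) * l b) \<le> total_loss R T"
    unfolding integral_sum_density(2)[OF BH] by (simp add: l_def)
  have "a * (\<Sum>b\<in>B. 1 - l b) = (\<Sum>b\<in>B. (1 - l b) * a)" by (simp add: sum_distrib_left mult.commute)
  also have "\<dots> \<le> (\<Sum>b\<in>B. (1 - l b) * l b)"
    using l by (intro sum_mono mult_left_mono) (auto simp: less_imp_le)
  finally have "(\<Sum>b\<in>B. 1 - l b) \<le> total_loss R T / a" using 2 a by (simp add: field_simps)
  then show ?thesis using 1 by (simp add: sum_subtractf)
qed

text \<open>Here maximality enters: the residual satisfies the bound by \<open>a\<close> instead of
  1. Since the inner energy of a kernel is at least its full energy minus the loss, the family must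
  account for at least (1 - a) times the trace minus the loss.\<close>

lemma card_eigset_ge:
  assumes B: "op.eigset a B" and a: "0 \<le> a" "a < 1"
    and max: "\<And>g l. \<lbrakk>g \<in> op.perp B; g \<in> op.eig (complex_of_real l); a < l\<rbrakk> \<Longrightarrow> g = 0"
  shows "kernel_trace R T - total_loss R T / (1 - a) \<le> real (card B)"
proof -
  have BH: "B \<subseteq> PW T" using B by (simp add: op.eigset_def)
  define l where "l b = Re (wip (W R T b) b)" for b
  have l: "a < l b" "l b \<le> 1" if "b \<in> B" for b
    using op.eigset_eigenvalue[OF B that] by (auto simp: l_def)
  have w0: "0 \<le> 1 + y\<^sup>2" for y :: real using one_plus_sq_pos[of y] by simp
  note ti = trace_integral(1)[OF T, of R] note li = loss_integral(1)[OF R, of T]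
  have "(LINT y|lborel. (1 - a) * (indicator {-R..R} y * (kern T y y * (1 + y\<^sup>2))) - indicator {-R..R} y * loss R T y)
    \<le> (LINT y|lborel. (\<Sum>b\<in>B. (l b - a) * density R b y))"
  proof (rule integral_mono)
    show "integrable lborel (\<lambda>y. (1 - a) * (indicator {-R..R} y * (kern T y y * (1 + y\<^sup>2))) - indicator {-R..R} y * loss R T y)"
      using ti li R by (intro Bochner_Integration.integrable_diff integrable_mult_right) auto
    show "(1 - a) * (indicator {-R..R} y * (kern T y y * (1 + y\<^sup>2))) - indicator {-R..R} y * loss R T y
        \<le> (\<Sum>b\<in>B. (l b - a) * density R b y)" for y
    proof -
      obtain g where g: "g \<in> op.perp B" "wip.sqn g = kern T y y - (\<Sum>b\<in>B. (cmod (b y))\<^sup>2)"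
         "Re (wip (W R T g) g) = Re (wip (W R T (kernf T y)) (kernf T y)) - (\<Sum>b\<in>B. l b * (cmod (b y))\<^sup>2)"
        using kernf_residual[OF B] unfolding l_def by blast
      have "Re (wip (W R T g) g) \<le> a * wip.sqn g" by (rule op.perp_quad_le[OF B a(1) max g(1)])
      then have "Re (wip (W R T (kernf T y)) (kernf T y)) - a * kern T y y \<le> (\<Sum>b\<in>B. (l b - a) * (cmod (b y))\<^sup>2)"
        unfolding g by (simp add: left_diff_distrib right_diff_distrib sum_subtractf sum_distrib_left)
      then have "indicator {-R..R} y * ((Re (wip (W R T (kernf T y)) (kernf T y)) - a * kern T y y) * (1 + y\<^sup>2))
        \<le> (\<Sum>b\<in>B. (l b - a) * density R b y)"
        unfolding sum_density by (intro mult_left_mono mult_right_mono w0) auto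
      then show ?thesis using loss_ge[of y] by (simp add: algebra_simps)
    qed
  qed (rule integral_sum_density[OF BH])
  also have "\<dots> = (\<Sum>b\<in>B. (l b - a) * l b)"
    unfolding integral_sum_density(2)[OF BH] by (simp add: l_def)
  \<comment> \<open>From a < l \<le> 1 both factors of (l - a) l are bounded, by 1 - a and by
    1.\<close>
  also have "\<dots> \<le> (\<Sum>b\<in>B. (1 - a) * 1)"
    using l a by (intro sum_mono mult_mono) (auto intro: order_trans[OF _ less_imp_le])
  also have "\<dots> = (1 - a) * real (card B)" by simp
  also have "(LINT y|lborel. (1 - a) * (indicator {-R..R} y * (kern T y y * (1 + y\<^sup>2))) - indicator {-R..R} y * loss R T y)
     = (1 - a) * kernel_trace R T - total_loss R T"
    using ti li R unfolding kernel_trace_def total_loss_def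
    by (subst Bochner_Integration.integral_diff) auto
  finally show ?thesis using a by (simp add: field_simps)
qed

text \<open>The upper estimate holds for every family and therefore bounds all cardinalities; this
  yields a maximal family, to which the lower estimate applies and whose size is the number of
  eigenvalues.\<close>

lemma eigenvalue_number:
  assumes a: "0 < a" "a < 1"
  shows "\<exists>n. has_num_eigenvalues_above R T a n \<and>
    real n \<le> kernel_trace R T + total_loss R T / a \<and> kernel_trace R T - total_loss R T / (1 - a) \<le> real n"
proof -
  have "card B \<le> nat \<lceil>kernel_trace R T + total_loss R T / a\<rceil>" if "op.eigset a B" for B
    using card_eigset_le[OF that a(1)] by linarith
  then obtain B where B: "op.eigset a B"
    and max: "\<And>g l. \<lbrakk>g \<in> op.perp B; g \<in> op.eig (complex_of_real l); a < l\<rbrakk> \<Longrightarrow> g = 0"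
    using op.maximal_eigset by blast
  have ev: "eigenvalues_above R T a = {c. a < c \<and> (\<exists>f\<in>op.eig (complex_of_real c). f \<noteq> 0)}"
    by (simp add: eigenvalues_above_def eigenspace_eq)
  have fin: "finite B" using B by (simp add: op.eigset_def)
  have "has_num_eigenvalues_above R T a (card B)"
    unfolding has_num_eigenvalues_above_def
  proof (intro conjI ballI)
    show "finite (eigenvalues_above R T a)"
      unfolding ev by (rule op.eigenvalue_count(1)[OF B max])
    show "card B = (\<Sum>c\<in>eigenvalues_above R T a. cfun.dim (eigenspace R T (complex_of_real c)))"
      unfolding ev eigenspace_eq by (rule op.eigenvalue_count(2)[OF B max])
    fix c assume "c \<in> eigenvalues_above R T a"
    then have "eigenspace R T (complex_of_real c) \<subseteq> cfun.span (B \<inter> op.eig (complex_of_real c))"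
      unfolding eigenspace_eq using op.eig_span_eigset[OF B _ max] by (simp add: ev)
    then show "\<exists>B. finite B \<and> eigenspace R T (complex_of_real c) \<subseteq> cfun.span B"
      using fin by blast
  qed
  moreover have "kernel_trace R T - total_loss R T / (1 - a) \<le> real (card B)"
    by (rule card_eigset_ge[OF B less_imp_le[OF a(1)] a(2)]) (rule max)
  ultimately show ?thesis using card_eigset_le[OF B a(1)] by blast
qed

end

text \<open>The 4 bounds pi, the error of the trace. The 22 bounds the loss 4T + 18 + 8 ln (2R + 1):
  R \<ge> 3 gives 2R + 1 \<le> R^2 and so at most 16 ln R, and T \<ge> 1 absorbs 18 into 18T. The
  factor 1 / (a (1 - a)) dominates both 1 / a and 1 / (1 - a).\<close>

lemma eigenvalue_number_estimate:
  assumes T: "1 \<le> T" and R: "3 \<le> R" and a: "0 < a" "a < 1"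
  shows "\<exists>n. has_num_eigenvalues_above R T a n \<and>
    \<bar>real n - 4 * R * T\<bar> \<le> (4 + 22 / (a * (1 - a))) * (ln R + T)"
proof -
  have R1: "1 \<le> R" "0 \<le> R" using R by auto
  obtain n where n: "has_num_eigenvalues_above R T a n"
    "real n \<le> kernel_trace R T + total_loss R T / a" "kernel_trace R T - total_loss R T / (1 - a) \<le> real n"
    using eigenvalue_number[OF T R1(1) a] by blast
  have lnR: "0 \<le> ln R" using R by simp
  have "2 * R + 1 \<le> R\<^sup>2"
  proof -
    have "3 * R \<le> R * R" using R by (intro mult_right_mono) auto
    then have "2 * R + 1 \<le> R * R" using R by linarith
    then show ?thesis by (simp add: power2_eq_square)
  qed
  then have "ln (2 * R + 1) \<le> ln (R\<^sup>2)" using R by simp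
  also have "\<dots> = 2 * ln R" using R by (simp add: ln_realpow)
  finally have "8 * ln (2 * R + 1) \<le> 16 * ln R" by simp
  then have D: "total_loss R T \<le> 22 * (ln R + T)"
    unfolding total_loss_def loss_integral(2)[OF R1(1)] using T lnR by (simp add: distrib_left)
  have aa: "0 < a * (1 - a)" using a by simp
  have inv: "1 / a \<le> 1 / (a * (1 - a))" "1 / (1 - a) \<le> 1 / (a * (1 - a))"
    using a by (auto intro!: divide_left_mono simp: mult_left_le mult_left_le_one_le)
  have div: "total_loss R T / u \<le> 22 / (a * (1 - a)) * (ln R + T)"
    if "0 < u" "1 / u \<le> 1 / (a * (1 - a))" for u
  proof -
    have "total_loss R T / u \<le> 22 * (ln R + T) * (1 / u)"
      using D that by (simp add: divide_right_mono)
    also have "\<dots> \<le> 22 * (ln R + T) * (1 / (a * (1 - a)))"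
      using that lnR T by (intro mult_left_mono) auto
    finally show ?thesis by simp
  qed
  have "pi \<le> 4 * (ln R + T)" unfolding distrib_left using pi_less_4 T lnR by linarith
  then have tr: "\<bar>kernel_trace R T - 4 * R * T\<bar> \<le> 4 * (ln R + T)"
    using trace_integral(2)[OF T R1(2)] unfolding kernel_trace_def by linarith
  have combine: "\<bar>x - z\<bar> \<le> Y + X"
    if "\<bar>t - z\<bar> \<le> Y" "x \<le> t + p" "t - q \<le> x" "p \<le> X" "q \<le> X" for x z t p q X Y :: real
    using that by linarith
  have "\<bar>real n - 4 * R * T\<bar> \<le> (4 + 22 / (a * (1 - a))) * (ln R + T)"
    unfolding distrib_right
  proof (rule combine[OF tr n(2,3)])
    show "total_loss R T / a \<le> 22 / (a * (1 - a)) * (ln R + T)" by (rule div[OF a(1) inv(1)])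
    show "total_loss R T / (1 - a) \<le> 22 / (a * (1 - a)) * (ln R + T)" using a inv(2) by (intro div) auto
  qed
  then show ?thesis using n(1) by blast
qed

text \<open>The condition \<epsilon> < 1 keeps the threshold positive. The operator is compact,
  positive and injective on an infinite-dimensional space, so above a threshold that is 0 or
  negative there are infinitely many eigenvalues.\<close>

theorem theorem2:
  fixes \<epsilon> :: real
  assumes "0 < \<epsilon>" and "\<epsilon> < 1"
  shows "\<exists>E\<^sub>1 E\<^sub>2 :: real \<times> real \<Rightarrow> real.
           E\<^sub>1 \<in> O[at_top \<times>\<^sub>F at_top](\<lambda>(R, T). ln R) \<and>
           E\<^sub>2 \<in> O[at_top \<times>\<^sub>F at_top](\<lambda>(R, T). T) \<and>
           (\<forall>\<^sub>F (R, T) in at_top \<times>\<^sub>F at_top.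
              \<exists>n. has_num_eigenvalues_above R T (1 - \<epsilon>) n \<and>
                  real n = 4 * R * T + E\<^sub>1 (R, T) + E\<^sub>2 (R, T))"
proof -
  define C where "C = 4 + 22 / ((1 - \<epsilon>) * (1 - (1 - \<epsilon>)))"
  have ex: "\<exists>n. 1 \<le> T \<longrightarrow> 3 \<le> R \<longrightarrow> has_num_eigenvalues_above R T (1 - \<epsilon>) n \<and>
      \<bar>real n - 4 * R * T\<bar> \<le> C * (ln R + T)" for R T
    using eigenvalue_number_estimate[of T R "1 - \<epsilon>"] assms unfolding C_def by auto
  \<comment> \<open>The range conditions sit inside the choice, so that a witness exists for all
    pairs and \<open>someI_ex\<close> applies uniformly.\<close>
  define N where "N R T = (SOME n. 1 \<le> T \<longrightarrow> 3 \<le> R \<longrightarrow> has_num_eigenvalues_above R T (1 - \<epsilon>) n \<and>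
      \<bar>real n - 4 * R * T\<bar> \<le> C * (ln R + T))" for R T
  have N: "has_num_eigenvalues_above R T (1 - \<epsilon>) (N R T) \<and> \<bar>real (N R T) - 4 * R * T\<bar> \<le> C * (ln R + T)"
    if "1 \<le> T" "3 \<le> R" for R T
    using someI_ex[OF ex[of T R]] that unfolding N_def by blast
  define e where "e R T = real (N R T) - 4 * R * T" for R T
  \<comment> \<open>The total error is at most C (ln R + T). Splitting it in the proportion ln R : T
    makes one share O(ln R) and the other O(T), while their sum is exact.\<close>
  define E1 where "E1 = (\<lambda>(R, T). e R T * (ln R / (ln R + T)))"
  define E2 where "E2 = (\<lambda>(R, T). e R T * (T / (ln R + T)))"
  have ev: "\<forall>\<^sub>F p :: real \<times> real in at_top \<times>\<^sub>F at_top. 3 \<le> fst p \<and> 1 \<le> snd p"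
    unfolding eventually_prod_filter
    by (intro exI[of _ "\<lambda>R. 3 \<le> R"] exI[of _ "\<lambda>T. 1 \<le> T"]) (auto intro: eventually_ge_at_top)
  have frac: "\<bar>e R T * (u / (ln R + T))\<bar> \<le> C * \<bar>u\<bar>" if "3 \<le> R" "1 \<le> T" for R T u
  proof -
    have pos: "0 < ln R + T" using that by (simp add: add_nonneg_pos)
    have "\<bar>e R T * (u / (ln R + T))\<bar> = \<bar>e R T\<bar> * (\<bar>u\<bar> / (ln R + T))"
      using pos by (simp add: abs_mult abs_divide)
    also have "\<dots> \<le> (C * (ln R + T)) * (\<bar>u\<bar> / (ln R + T))"
      using N[OF that(2,1)] pos by (intro mult_right_mono) (auto simp: e_def)
    also have "\<dots> = C * \<bar>u\<bar>" using pos by simp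
    finally show ?thesis .
  qed
  have "E1 \<in> O[at_top \<times>\<^sub>F at_top](\<lambda>(R, T). ln R)"
    by (rule bigoI[of _ C], rule eventually_mono[OF ev])
       (simp only: E1_def case_prod_beta real_norm_def, rule frac, auto)
  moreover have "E2 \<in> O[at_top \<times>\<^sub>F at_top](\<lambda>(R, T). T)"
    by (rule bigoI[of _ C], rule eventually_mono[OF ev])
       (simp only: E2_def case_prod_beta real_norm_def, rule frac, auto)
  moreover have "\<forall>\<^sub>F (R, T) in at_top \<times>\<^sub>F at_top. \<exists>n. has_num_eigenvalues_above R T (1 - \<epsilon>) n \<and>
      real n = 4 * R * T + E1 (R, T) + E2 (R, T)"
  proof (rule eventually_mono[OF ev])
    fix p :: "real \<times> real" assume p: "3 \<le> fst p \<and> 1 \<le> snd p"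
    obtain R T where RT: "p = (R, T)" by (rule prod.exhaust)
    then have pos: "0 < ln R + T" using p by (simp add: add_nonneg_pos)
    have "E1 (R, T) + E2 (R, T) = e R T * ((ln R + T) / (ln R + T))"
      unfolding E1_def E2_def prod.case add_divide_distrib by (rule distrib_left[symmetric])
    also have "\<dots> = e R T" using pos by simp
    finally have "real (N R T) = 4 * R * T + E1 (R, T) + E2 (R, T)" by (simp add: e_def)
    then show "case p of (R, T) \<Rightarrow> \<exists>n. has_num_eigenvalues_above R T (1 - \<epsilon>) n \<and>
        real n = 4 * R * T + E1 (R, T) + E2 (R, T)"
      using N[of T R] RT p by auto
  qed
  ultimately show ?thesis by blast
qed

end
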